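(* Let $\tau>0$, assume that $\mathcal{D}(M^\tau)=\mathcal{D}(A^\tau)$ with equivalent norms, and further assume that $\mathcal{D}(M^{2\tau})\subset_c\mathcal{D}(A^{2\tau})$. Suppose that for each $j=1,\dots,\ell$ both $$\frac{\sum_{k=n+1}^\infty\mu_k^{4\tau}|(u_j,q_k)_0|^2}{\sum_{k=n+1}^\infty\mu_k^{2\tau}|(u_j,q_k)_0|^2}=O\big(\mu_{n+1}^{2\tau}\big)\quad\text{as }n\to\infty,$$ and $u_j\in\mathcal{D}(M^\sigma)$ with $\sigma\ge\tau$. Then, for all large $n$, there exist eigenvectors $u_{j,n}$ of $A$ in the $\lambda_j$-eigenspace, normalized in $\mathcal{H}_{-1/2}$, such that $$\|u_{j,n}-u_j^{(n,0)}\|_\tau=o\big(\mu_{n+1}^{\tau-\sigma}\big)\quad\text{as }n\to\infty,\qquad j=1,\dots,\ell.$$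
   Context: $\mathcal{H}=\mathcal{H}_0$ is a separable complex Hilbert space with inner product $\langle\cdot,\cdot\rangle$ and norm $\|\cdot\|=\|\cdot\|_0$. $A$ is a selfadjoint operator in $\mathcal{H}$ that is positive definite ($\langle Au,u\rangle\ge\alpha\|u\|^2$ for $u\in\mathcal{D}(A)$, some $\alpha>0$), and the lower part of its spectrum consists of isolated eigenvalues of finite multiplicity $0<\lambda_1\le\lambda_2\le\dots$ (counted with multiplicity) lying below $\lambda_\infty$, the least point of the essential spectrum ($\lambda_\infty=\infty$ if $A^{-1}$ is compact), with corresponding orthonormal eigenvectors $u_1,u_2,\dots$. The eigenpairs with indices $1,\dots,\ell$ are among these. $T=A^{-1}$. For real $\tau$, $\mathcal{H}_\tau=\mathcal{D}(A^\tau)$ with inner product $\langle u,v\rangle_\tau=\langle A^\tau u,A^\tau v\rangle$ and norm $\|u\|_\tau=\|A^\tau u\|$; for $\tau<0$ it is the completion of $\mathcal{H}$ in that norm. $\mathcal{G}_0$ is a Hilbert space consisting of the same elements as $\mathcal{H}_0$ with an equivalent norm; its inner product and norm are $(\cdot,\cdot)_0$ and $|\cdot|_0$. $M$ is a positive definite selfadjoint operator in $\mathcal{G}_0$ with $M^{-1}$ compact, with eigenvalues $0<\mu_1\le\mu_2\le\dots\to\infty$ (counted with multiplicity) and corresponding eigenvectors $q_1,q_2,\dots$ orthonormal in $\mathcal{G}_0$. For $s\ge0$, $\mathcal{D}(M^s)$ carries the norm $|M^sv|_0$. $\mathcal{V}_1\subset_c\mathcal{V}_0$ means $\mathcal{V}_1\subset\mathcal{V}_0$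 with continuous injection. Dual harmonic Ritz method (Rayleigh–Ritz in $\mathcal{H}_0$) with trial vectors $q_k$: $\Lambda_1^{(n,0)}\le\dots\le\Lambda_n^{(n,0)}$ are the eigenvalues of $[\langle q_i,q_j\rangle]_{i,j=1}^n\mathbf{x}=\Lambda[\langle Tq_i,q_j\rangle]_{i,j=1}^n\mathbf{x}$, and $u_1^{(n,0)},\dots,u_n^{(n,0)}\in\mathrm{span}\{q_1,\dots,q_n\}$ are the corresponding eigenvectors normalized so that $\langle u_i^{(n,0)},u_j^{(n,0)}\rangle_{-1/2}=\delta_{ij}$ and $\langle u_i^{(n,0)},u_j^{(n,0)}\rangle=\Lambda_i^{(n,0)}\delta_{ij}$.
   Formalization: Added assumption: the indices 1,…,ℓ do not split a multiple eigenvalue (λ_ℓ < λ_{ℓ+1} whenever λ_{ℓ+1} exists below λ_∞); without it the claim fails, since a less regular eigenvector of the same eigenvalue can be the one approximated. *)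

theory Defs
  imports "HOL-Analysis.Analysis" "HOL-Computational_Algebra.Polynomial"
    "HOL-Library.Extended_Nat" "HOL-Library.Landau_Symbols"
begin

section \<open>Complex Hilbert spaces\<close>

text \<open>The scalar multiplication and the inner product are explicit parameters because two
  inner products, those of \<open>H\<^sub>0\<close> and of \<open>G\<^sub>0\<close>, live on the same vector space.
  Inner products are conjugate linear in the first and linear in the second argument; with
  this convention the matrix pencil of the Ritz problem below is literally the Galerkin system
  for \<open>\<Sum>j. x\<^sub>j q\<^sub>j\<close>.\<close>

definition ip_norm :: "('a \<Rightarrow> 'a \<Rightarrow> complex) \<Rightarrow> 'a \<Rightarrow> real" where
  "ip_norm ip v = sqrt (Re (ip v v))"

locale complex_hilbert_space = vector_space sc
  for sc :: "complex \<Rightarrow> 'a::ab_group_add \<Rightarrow> 'a" +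
  fixes ip :: "'a \<Rightarrow> 'a \<Rightarrow> complex"
  assumes ip_add_right: "ip x (y + z) = ip x y + ip x z"
    and ip_scale_right: "ip x (sc c y) = c * ip x y"
    and ip_commute: "ip y x = cnj (ip x y)"
    and ip_pos: "x \<noteq> 0 \<Longrightarrow> Re (ip x x) > 0"
    and complete: "(\<forall>e>0. \<exists>K. \<forall>m\<ge>K. \<forall>n\<ge>K. ip_norm ip (X m - X n) < e)
          \<Longrightarrow> \<exists>L. (\<lambda>n. ip_norm ip (X n - L)) \<longlonglongrightarrow> 0"

definition ip_dense :: "('a::ab_group_add \<Rightarrow> 'a \<Rightarrow> complex) \<Rightarrow> 'a set \<Rightarrow> bool" where
  "ip_dense ip S \<longleftrightarrow> (\<forall>v. \<forall>e>0. \<exists>s\<in>S. ip_norm ip (v - s) < e)"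

definition ip_separable :: "('a::ab_group_add \<Rightarrow> 'a \<Rightarrow> complex) \<Rightarrow> bool" where
  "ip_separable ip \<longleftrightarrow> (\<exists>S. countable S \<and> ip_dense ip S)"

definition equivalent_norms_on :: "'a set \<Rightarrow> ('a \<Rightarrow> real) \<Rightarrow> ('a \<Rightarrow> real) \<Rightarrow> bool" where
  "equivalent_norms_on S N1 N2 \<longleftrightarrow>
     (\<exists>c>0. \<exists>C>0. \<forall>v\<in>S. c * N1 v \<le> N2 v \<and> N2 v \<le> C * N1 v)"

definition continuously_included ::
  "'a set \<Rightarrow> ('a \<Rightarrow> real) \<Rightarrow> 'a set \<Rightarrow> ('a \<Rightarrow> real) \<Rightarrow> bool" where
  "continuously_included S1 N1 S2 N2 \<longleftrightarrow> S1 \<subseteq> S2 \<and> (\<exists>C. \<forall>v\<in>S1. N2 v \<le> C * N1 v)"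


section \<open>Unbounded selfadjoint operators\<close>

text \<open>An operator is a domain \<open>D\<close> together with a function \<open>A\<close>, whose values outside \<open>D\<close>
  are irrelevant.\<close>

definition linear_operator ::
  "(complex \<Rightarrow> 'a::ab_group_add \<Rightarrow> 'a) \<Rightarrow> 'a set \<Rightarrow> ('a \<Rightarrow> 'a) \<Rightarrow> bool" where
  "linear_operator sc D A \<longleftrightarrow> module.subspace sc D \<and>
     (\<forall>u\<in>D. \<forall>v\<in>D. A (u + v) = A u + A v) \<and> (\<forall>c. \<forall>u\<in>D. A (sc c u) = sc c (A u))"

definition adjoint_graph ::
  "('a \<Rightarrow> 'a \<Rightarrow> complex) \<Rightarrow> 'a set \<Rightarrow> ('a \<Rightarrow> 'a) \<Rightarrow> ('a \<times> 'a) set" where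
  "adjoint_graph ip D A = {(v, w). \<forall>u\<in>D. ip (A u) v = ip u w}"

definition selfadjoint_operator ::
  "(complex \<Rightarrow> 'a::ab_group_add \<Rightarrow> 'a) \<Rightarrow> ('a \<Rightarrow> 'a \<Rightarrow> complex) \<Rightarrow> 'a set \<Rightarrow> ('a \<Rightarrow> 'a) \<Rightarrow> bool"
where
  "selfadjoint_operator sc ip D A \<longleftrightarrow> linear_operator sc D A \<and> ip_dense ip D \<and>
     adjoint_graph ip D A = {(v, A v) | v. v \<in> D}"

definition positive_definite_operator ::
  "('a \<Rightarrow> 'a \<Rightarrow> complex) \<Rightarrow> 'a set \<Rightarrow> ('a \<Rightarrow> 'a) \<Rightarrow> bool" where
  "positive_definite_operator ip D A \<longleftrightarrow>
     (\<exists>\<alpha>>0. \<forall>u\<in>D. Re (ip (A u) u) \<ge> \<alpha> * (ip_norm ip u)\<^sup>2)"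

definition compact_operator ::
  "('a::ab_group_add \<Rightarrow> 'a \<Rightarrow> complex) \<Rightarrow> ('a \<Rightarrow> 'a) \<Rightarrow> bool" where
  "compact_operator ip B \<longleftrightarrow>
     (\<forall>X :: nat \<Rightarrow> 'a. (\<exists>C. \<forall>n. ip_norm ip (X n) \<le> C) \<longrightarrow>
        (\<exists>r L. strict_mono r \<and> (\<lambda>n. ip_norm ip (B (X (r n)) - L)) \<longlonglongrightarrow> 0))"

definition eigenspace ::
  "(complex \<Rightarrow> 'a \<Rightarrow> 'a) \<Rightarrow> 'a set \<Rightarrow> ('a \<Rightarrow> 'a) \<Rightarrow> complex \<Rightarrow> 'a set" where
  "eigenspace sc D A z = {v \<in> D. A v = sc z v}"

definition resolvent_set ::
  "(complex \<Rightarrow> 'a::ab_group_add \<Rightarrow> 'a) \<Rightarrow> ('a \<Rightarrow> 'a \<Rightarrow> complex) \<Rightarrow> 'a set \<Rightarrow> ('a \<Rightarrow> 'a)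
     \<Rightarrow> complex set" where
  "resolvent_set sc ip D A =
     {z. bij_betw (\<lambda>u. A u - sc z u) D UNIV \<and>
         (\<exists>C. \<forall>u\<in>D. ip_norm ip u \<le> C * ip_norm ip (A u - sc z u))}"

definition op_spectrum ::
  "(complex \<Rightarrow> 'a::ab_group_add \<Rightarrow> 'a) \<Rightarrow> ('a \<Rightarrow> 'a \<Rightarrow> complex) \<Rightarrow> 'a set \<Rightarrow> ('a \<Rightarrow> 'a)
     \<Rightarrow> complex set" where
  "op_spectrum sc ip D A = - resolvent_set sc ip D A"

definition discrete_spectrum ::
  "(complex \<Rightarrow> 'a::ab_group_add \<Rightarrow> 'a) \<Rightarrow> ('a \<Rightarrow> 'a \<Rightarrow> complex) \<Rightarrow> 'a set \<Rightarrow> ('a \<Rightarrow> 'a)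
     \<Rightarrow> complex set" where
  "discrete_spectrum sc ip D A =
     {z. z isolated_in op_spectrum sc ip D A \<and> eigenspace sc D A z \<noteq> {0} \<and>
         (\<exists>B. finite B \<and> eigenspace sc D A z \<subseteq> module.span sc B)}"

definition essential_spectrum ::
  "(complex \<Rightarrow> 'a::ab_group_add \<Rightarrow> 'a) \<Rightarrow> ('a \<Rightarrow> 'a \<Rightarrow> complex) \<Rightarrow> 'a set \<Rightarrow> ('a \<Rightarrow> 'a)
     \<Rightarrow> complex set" where
  "essential_spectrum sc ip D A = op_spectrum sc ip D A - discrete_spectrum sc ip D A"

text \<open>\<open>\<lambda>\<^sub>\<infinity>\<close>; the infimum of the empty set is \<open>\<infinity>\<close>, which is the case of compact \<open>A\<^sup>-\<^sup>1\<close>.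
  The spectrum of a selfadjoint operator is real, so that taking real parts is harmless.\<close>

definition ess_bottom ::
  "(complex \<Rightarrow> 'a::ab_group_add \<Rightarrow> 'a) \<Rightarrow> ('a \<Rightarrow> 'a \<Rightarrow> complex) \<Rightarrow> 'a set \<Rightarrow> ('a \<Rightarrow> 'a) \<Rightarrow> ereal"
where
  "ess_bottom sc ip D A = (INF z\<in>essential_spectrum sc ip D A. ereal (Re z))"

text \<open>The eigenpairs below \<open>\<lambda>\<^sub>\<infinity>\<close>, numbered from 1; there are \<open>N \<le> \<infinity>\<close> of them.  The last
  condition says that the list is exhaustive and respects multiplicities (for \<open>z\<close> that is not
  an eigenvalue it reads \<open>{0} = span {}\<close>).\<close>

definition lower_eigensystem ::
  "(complex \<Rightarrow> 'a::ab_group_add \<Rightarrow> 'a) \<Rightarrow> ('a \<Rightarrow> 'a \<Rightarrow> complex) \<Rightarrow> 'a set \<Rightarrow> ('a \<Rightarrow> 'a)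
     \<Rightarrow> enat \<Rightarrow> (nat \<Rightarrow> real) \<Rightarrow> (nat \<Rightarrow> 'a) \<Rightarrow> bool" where
  "lower_eigensystem sc ip D A N lam u \<longleftrightarrow>
     (let J = {i. 1 \<le> i \<and> enat i \<le> N} in
       (\<forall>i\<in>J. 0 < lam i \<and> ereal (lam i) < ess_bottom sc ip D A \<and>
               u i \<in> eigenspace sc D A (of_real (lam i))) \<and>
       (\<forall>i\<in>J. \<forall>j\<in>J. i \<le> j \<longrightarrow> lam i \<le> lam j) \<and>
       (\<forall>i\<in>J. \<forall>j\<in>J. ip (u i) (u j) = (if i = j then 1 else 0)) \<and>
       (\<forall>z. ereal (Re z) < ess_bottom sc ip D A \<longrightarrow>
              eigenspace sc D A z = module.span sc {u i | i. i \<in> J \<and> of_real (lam i) = z}))"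

text \<open>All eigenpairs of an operator with compact inverse, again numbered from 1.\<close>

definition full_eigensystem ::
  "(complex \<Rightarrow> 'a::ab_group_add \<Rightarrow> 'a) \<Rightarrow> ('a \<Rightarrow> 'a \<Rightarrow> complex) \<Rightarrow> 'a set \<Rightarrow> ('a \<Rightarrow> 'a)
     \<Rightarrow> (nat \<Rightarrow> real) \<Rightarrow> (nat \<Rightarrow> 'a) \<Rightarrow> bool" where
  "full_eigensystem sc ip D M mu q \<longleftrightarrow>
     (\<forall>k\<ge>1. 0 < mu k \<and> q k \<in> eigenspace sc D M (of_real (mu k))) \<and>
     (\<forall>j\<ge>1. \<forall>k\<ge>j. mu j \<le> mu k) \<and> filterlim mu at_top sequentially \<and>
     (\<forall>j\<ge>1. \<forall>k\<ge>1. ip (q j) (q k) = (if j = k then 1 else 0)) \<and>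
     (\<forall>z. eigenspace sc D M z = module.span sc {q k | k. k \<ge> 1 \<and> of_real (mu k) = z})"


section \<open>Real powers of positive definite operators\<close>

definition op_poly ::
  "(complex \<Rightarrow> 'a::ab_group_add \<Rightarrow> 'a) \<Rightarrow> real poly \<Rightarrow> ('a \<Rightarrow> 'a) \<Rightarrow> 'a \<Rightarrow> 'a" where
  "op_poly sc p T v = (\<Sum>i\<le>degree p. sc (of_real (coeff p i)) ((T ^^ i) v))"

text \<open>Continuous functional calculus for a bounded selfadjoint \<open>T \<ge> 0\<close>: \<open>B = f(T)\<close> is the
  limit in operator norm of \<open>p\<^sub>n(T)\<close> for polynomials \<open>p\<^sub>n\<close> converging to \<open>f\<close> uniformly on an
  interval \<open>[0, c]\<close> with \<open>\<parallel>T\<parallel> \<le> c\<close>, which contains the spectrum of \<open>T\<close>.\<close>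

definition is_fun_calc ::
  "(complex \<Rightarrow> 'a::ab_group_add \<Rightarrow> 'a) \<Rightarrow> ('a \<Rightarrow> 'a \<Rightarrow> complex) \<Rightarrow> ('a \<Rightarrow> 'a)
     \<Rightarrow> (real \<Rightarrow> real) \<Rightarrow> ('a \<Rightarrow> 'a) \<Rightarrow> bool" where
  "is_fun_calc sc ip T f B \<longleftrightarrow>
     (\<exists>c\<ge>0. \<exists>p :: nat \<Rightarrow> real poly.
        (\<forall>v. ip_norm ip (T v) \<le> c * ip_norm ip v) \<and>
        uniform_limit {0..c} (\<lambda>n. poly (p n)) f sequentially \<and>
        (\<forall>e>0. \<forall>\<^sub>F n in sequentially. \<forall>v.
            ip_norm ip (op_poly sc (p n) T v - B v) \<le> e * ip_norm ip v))"

definition bounded_power ::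
  "(complex \<Rightarrow> 'a::ab_group_add \<Rightarrow> 'a) \<Rightarrow> ('a \<Rightarrow> 'a \<Rightarrow> complex) \<Rightarrow> ('a \<Rightarrow> 'a) \<Rightarrow> real
     \<Rightarrow> 'a \<Rightarrow> 'a" where
  "bounded_power sc ip T s = (THE B. is_fun_calc sc ip T (\<lambda>x. x powr s) B)"

text \<open>For \<open>s > 0\<close> a positive definite selfadjoint \<open>A\<close> has \<open>A\<^sup>-\<^sup>s = (A\<^sup>-\<^sup>1)\<^sup>s\<close>, a bounded injective
  operator, and \<open>A\<^sup>s\<close> is the inverse of \<open>A\<^sup>-\<^sup>s\<close>, with domain the range of \<open>A\<^sup>-\<^sup>s\<close>.  These are
  the operators \<open>\<integral> x\<^sup>s dE(x)\<close> given by the spectral resolution \<open>E\<close> of \<open>A\<close>.\<close>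

abbreviation op_inverse :: "'a set \<Rightarrow> ('a \<Rightarrow> 'a) \<Rightarrow> 'a \<Rightarrow> 'a" where
  "op_inverse D A \<equiv> inv_into D A"

definition power_domain ::
  "(complex \<Rightarrow> 'a::ab_group_add \<Rightarrow> 'a) \<Rightarrow> ('a \<Rightarrow> 'a \<Rightarrow> complex) \<Rightarrow> 'a set \<Rightarrow> ('a \<Rightarrow> 'a)
     \<Rightarrow> real \<Rightarrow> 'a set" where
  "power_domain sc ip D A s =
     (if s \<le> 0 then UNIV else range (bounded_power sc ip (op_inverse D A) s))"

definition op_power ::
  "(complex \<Rightarrow> 'a::ab_group_add \<Rightarrow> 'a) \<Rightarrow> ('a \<Rightarrow> 'a \<Rightarrow> complex) \<Rightarrow> 'a set \<Rightarrow> ('a \<Rightarrow> 'a)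
     \<Rightarrow> real \<Rightarrow> 'a \<Rightarrow> 'a" where
  "op_power sc ip D A s =
     (if s = 0 then id
      else if s < 0 then bounded_power sc ip (op_inverse D A) (- s)
      else inv (bounded_power sc ip (op_inverse D A) s))"

text \<open>For negative \<open>s\<close> only the restriction to \<open>H\<close> of the inner product and norm of the completion
  \<open>H\<^sub>s\<close> is needed.\<close>

definition power_ip ::
  "(complex \<Rightarrow> 'a::ab_group_add \<Rightarrow> 'a) \<Rightarrow> ('a \<Rightarrow> 'a \<Rightarrow> complex) \<Rightarrow> 'a set \<Rightarrow> ('a \<Rightarrow> 'a)
     \<Rightarrow> real \<Rightarrow> 'a \<Rightarrow> 'a \<Rightarrow> complex" where
  "power_ip sc ip D A s u v = ip (op_power sc ip D A s u) (op_power sc ip D A s v)"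

definition power_norm ::
  "(complex \<Rightarrow> 'a::ab_group_add \<Rightarrow> 'a) \<Rightarrow> ('a \<Rightarrow> 'a \<Rightarrow> complex) \<Rightarrow> 'a set \<Rightarrow> ('a \<Rightarrow> 'a)
     \<Rightarrow> real \<Rightarrow> 'a \<Rightarrow> real" where
  "power_norm sc ip D A s v = ip_norm ip (op_power sc ip D A s v)"


section \<open>The dual harmonic Ritz method\<close>

text \<open>\<open>L i\<close> and \<open>w i\<close> (\<open>1 \<le> i \<le> n\<close>) are the Ritz values in increasing order and the normalized
  Ritz vectors.  As the \<open>w i\<close> are \<open>n\<close> orthonormal vectors for \<open>\<langle>\<cdot>,\<cdot>\<rangle>\<^sub>-\<^sub>1\<^sub>/\<^sub>2\<close> in an
  \<open>n\<close>-dimensional space, the \<open>L i\<close> are all the eigenvalues, counted with multiplicity.\<close>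

definition dual_harmonic_ritz ::
  "(complex \<Rightarrow> 'a::ab_group_add \<Rightarrow> 'a) \<Rightarrow> ('a \<Rightarrow> 'a \<Rightarrow> complex) \<Rightarrow> 'a set \<Rightarrow> ('a \<Rightarrow> 'a)
     \<Rightarrow> (nat \<Rightarrow> 'a) \<Rightarrow> nat \<Rightarrow> (nat \<Rightarrow> real) \<Rightarrow> (nat \<Rightarrow> 'a) \<Rightarrow> bool" where
  "dual_harmonic_ritz sc ip D A q n L w \<longleftrightarrow>
     (\<forall>i\<in>{1..n}. \<forall>j\<in>{1..n}. i \<le> j \<longrightarrow> L i \<le> L j) \<and>
     (\<forall>i\<in>{1..n}. \<exists>x :: nat \<Rightarrow> complex.
        w i = (\<Sum>k=1..n. sc (x k) (q k)) \<and>
        (\<forall>r\<in>{1..n}. (\<Sum>k=1..n. ip (q r) (q k) * x k)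
            = of_real (L i) * (\<Sum>k=1..n. ip (op_inverse D A (q r)) (q k) * x k))) \<and>
     (\<forall>i\<in>{1..n}. \<forall>j\<in>{1..n}.
        power_ip sc ip D A (- 1 / 2) (w i) (w j) = (if i = j then 1 else 0) \<and>
        ip (w i) (w j) = (if i = j then of_real (L i) else 0))"

end

theory Submission
  imports Defs
begin

text \<open>
  The Ritz values are the reciprocals of the Rayleigh--Ritz values of the bounded operator
  \<open>T = A\<^sup>-\<^sup>1\<close> on \<open>V\<^sub>n = span {q\<^sub>1, \<dots>, q\<^sub>n}\<close>, and the eigenvalues in question are the largest ones
  of \<open>T\<close>, separated from the rest of its spectrum. Hence the eigenvectors are approximated
  in \<open>H\<^sub>0\<close> to the order \<open>\<epsilon>\<^sub>n\<close> of the distance of the \<open>u\<^sub>i\<close> from \<open>V\<^sub>n\<close>. Truncating the expansion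
  of \<open>u\<^sub>i \<in> D(M\<^sup>\<sigma>)\<close> in the \<open>q\<^sub>k\<close> shows \<open>\<epsilon>\<^sub>n = o(\<mu>\<^sub>n\<^sub>+\<^sub>1\<^sup>-\<^sup>\<sigma>)\<close>. With \<open>Q\<^sub>n\<close> the truncation, the norm of
  \<open>H\<^sub>\<tau>\<close> is that of \<open>D(M\<^sup>\<tau>)\<close>, in which \<open>v - Q\<^sub>n v\<close> is \<open>o(\<mu>\<^sub>n\<^sub>+\<^sub>1\<^sup>\<tau>\<^sup>-\<^sup>\<sigma>)\<close> for \<open>v\<close> in the eigenspace,
  while the difference of \<open>Q\<^sub>n v\<close> and the Ritz vector lies in \<open>V\<^sub>n\<close>, where passing to this norm
  costs at most a factor \<open>\<mu>\<^sub>n\<^sup>\<tau>\<close>.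
\<close>

section \<open>Geometry of complex Hilbert spaces\<close>

text \<open>No spectral measure is constructed. A real point \<open>m\<close> counts as outside the
  spectrum of \<open>T\<close> when \<open>T - m\<close> is bounded below, and the separation of the
  wanted eigenvalues becomes an inequality of quadratic forms on the orthogonal complement of the
  \<open>u i\<close>. Polynomials of \<open>T\<close> serve only to give meaning to fractional
  powers, which are afterwards evaluated on eigenvectors and on expansion coefficients.

  Multiple eigenvalues shape the estimate: a Ritz vector singles out no eigenvector, so it is
  compared with its own projection onto the whole eigenspace, rescaled to norm 1 in
  \<open>H\<^sub>-\<^sub>1\<^sub>/\<^sub>2\<close>. The eigenspace belonging to \<open>lam l\<close>
  must then lie entirely in the span of the \<open>u i\<close>, which is why the list may not stop
  inside a multiple eigenvalue.

  All constants have to be fixed before the trial space is. They come from the norm of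
  \<open>T\<close>, the number \<open>l\<close> and the distances between finitely many eigenvalues;
  the dependence on \<open>n\<close> sits in one null sequence, the tails of the expansions of the
  \<open>M\<^sup>\<sigma> u\<^sub>i\<close>.\<close>

context complex_hilbert_space
begin

abbreviation nm :: "'a \<Rightarrow> real" where "nm \<equiv> ip_norm ip"

lemma ip_add_left: "ip (x + y) z = ip x z + ip y z"
  by (metis complex_cnj_add ip_add_right ip_commute)

lemma ip_scale_left: "ip (sc c x) y = cnj c * ip x y"
  by (metis complex_cnj_mult ip_scale_right ip_commute)

lemma ip_zero_right [simp]: "ip x 0 = 0"
  using ip_add_right[of x 0 0] by simp

lemma ip_zero_left [simp]: "ip 0 x = 0"
  using ip_add_left[of 0 0 x] by simp

lemma ip_minus_right [simp]: "ip x (- y) = - ip x y"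
  using ip_add_right[of x y "- y"] by (simp add: eq_neg_iff_add_eq_0 add.commute)

lemma ip_minus_left [simp]: "ip (- x) y = - ip x y"
  using ip_add_left[of x "- x" y] by (simp add: eq_neg_iff_add_eq_0 add.commute)

lemma ip_diff_right: "ip x (y - z) = ip x y - ip x z"
  using ip_add_right[of x y "- z"] by simp

lemma ip_diff_left: "ip (x - y) z = ip x z - ip y z"
  using ip_add_left[of x "- y" z] by simp

lemmas ip_simps = ip_add_left ip_add_right ip_diff_left ip_diff_right ip_scale_left ip_scale_right

lemma ip_sum_right: "ip x (\<Sum>i\<in>I. f i) = (\<Sum>i\<in>I. ip x (f i))"
  by (induction I rule: infinite_finite_induct) (auto simp: ip_add_right)

lemma ip_sum_left: "ip (\<Sum>i\<in>I. f i) x = (\<Sum>i\<in>I. ip (f i) x)"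
  by (induction I rule: infinite_finite_induct) (auto simp: ip_add_left)

lemma Re_ip_commute: "Re (ip x y) = Re (ip y x)"
  by (metis complex_cnj(1) ip_commute complex.sel(1) complex.collapse)

lemma cmod_ip_commute: "cmod (ip x y) = cmod (ip y x)"
  by (metis complex_mod_cnj ip_commute)

lemma Re_ip_self_nonneg: "0 \<le> Re (ip x x)"
  using ip_pos[of x] by (cases "x = 0") auto

lemma nm_nonneg [simp]: "0 \<le> nm x"
  by (simp add: ip_norm_def Re_ip_self_nonneg)

lemma nm_sq: "(nm x)\<^sup>2 = Re (ip x x)"
  by (simp add: ip_norm_def Re_ip_self_nonneg)

lemma ip_self: "ip x x = of_real ((nm x)\<^sup>2)"
  by (metis Reals_cnj_iff complex_is_Real_iff ip_commute nm_sq complex_of_real_def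
      complex_surj)

lemma nm_zero [simp]: "nm 0 = 0"
  by (simp add: ip_norm_def)

lemma nm_eq_0_iff [simp]: "nm x = 0 \<longleftrightarrow> x = 0"
  using ip_pos[of x] by (cases "x = 0") (auto simp: ip_norm_def)

lemma nm_le_0_iff [simp]: "nm x \<le> 0 \<longleftrightarrow> x = 0"
  using nm_eq_0_iff[of x] nm_nonneg[of x] by linarith

lemma nm_pos_iff: "0 < nm x \<longleftrightarrow> x \<noteq> 0"
  using nm_eq_0_iff[of x] nm_nonneg[of x] by linarith

lemma mult_cnj_self: "c * cnj c = (of_real (cmod c))\<^sup>2"
  by (simp flip: of_real_power add: complex_norm_square)

lemma nm_scale: "nm (sc c x) = cmod c * nm x"
proof -
  have "(nm (sc c x))\<^sup>2 = (cmod c * nm x)\<^sup>2"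
  proof -
    have "ip (sc c x) (sc c x) = (c * cnj c) * ip x x"
      by (simp add: ip_scale_left ip_scale_right)
    also have "\<dots> = of_real ((cmod c * nm x)\<^sup>2)"
      by (simp add: ip_self mult_cnj_self power_mult_distrib)
    finally show ?thesis by (simp only: nm_sq Re_complex_of_real)
  qed
  then show ?thesis by (simp add: power2_eq_iff_nonneg)
qed

lemma nm_minus [simp]: "nm (- x) = nm x"
  by (simp add: ip_norm_def)

lemma nm_minus_commute: "nm (x - y) = nm (y - x)"
  by (metis minus_diff_eq nm_minus)

lemma nm_add_sq: "(nm (x + y))\<^sup>2 = (nm x)\<^sup>2 + (nm y)\<^sup>2 + 2 * Re (ip x y)"
  using Re_ip_commute[of x y] by (simp add: nm_sq ip_simps)

lemma nm_diff_sq: "(nm (x - y))\<^sup>2 = (nm x)\<^sup>2 + (nm y)\<^sup>2 - 2 * Re (ip x y)"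
  using Re_ip_commute[of x y] by (simp add: nm_sq ip_simps)

lemma Cauchy_Schwarz: "cmod (ip x y) \<le> nm x * nm y"
proof (cases "x = 0")
  case False
  define c where "c = ip x y / of_real ((nm x)\<^sup>2)"
  have nx: "nm x \<noteq> 0" using False by simp
  have "0 \<le> (nm (y - sc c x))\<^sup>2" by simp
  also have "(nm (y - sc c x))\<^sup>2 = (nm y)\<^sup>2 - (cmod (ip x y))\<^sup>2 / (nm x)\<^sup>2"
  proof -
    have r: "ip y (sc c x) = of_real ((cmod (ip x y))\<^sup>2 / (nm x)\<^sup>2)"
      using nx unfolding c_def ip_scale_right ip_commute[of y x]
      by (simp add: mult_cnj_self)
    have "(nm (sc c x))\<^sup>2 = (cmod (ip x y))\<^sup>2 / (nm x)\<^sup>2"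
    proof -
      have "cmod c = cmod (ip x y) / (nm x)\<^sup>2" by (simp add: c_def norm_divide norm_power)
      then show ?thesis using nx by (simp add: nm_scale power2_eq_square field_simps)
    qed
    then show ?thesis unfolding nm_diff_sq r by simp
  qed
  finally have "(cmod (ip x y))\<^sup>2 \<le> (nm x * nm y)\<^sup>2"
    using nx by (simp add: divide_le_eq power_mult_distrib mult.commute)
  then show ?thesis by (meson nm_nonneg mult_nonneg_nonneg power2_le_imp_le)
qed simp

lemma Re_ip_le: "Re (ip x y) \<le> nm x * nm y"
  using Cauchy_Schwarz[of x y] complex_Re_le_cmod[of "ip x y"] by linarith

lemma nm_triangle: "nm (x + y) \<le> nm x + nm y"
proof -
  have "(nm (x + y))\<^sup>2 \<le> (nm x + nm y)\<^sup>2"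
    using Re_ip_le[of x y] by (simp add: nm_add_sq power2_sum)
  then show ?thesis by (meson add_nonneg_nonneg nm_nonneg power2_le_imp_le)
qed

lemma nm_triangle_diff: "nm (x - y) \<le> nm x + nm y"
  using nm_triangle[of x "- y"] by simp

lemma nm_triangle_mid: "nm (x - z) \<le> nm (x - y) + nm (y - z)"
  using nm_triangle[of "x - y" "y - z"] by simp

lemma nm_reverse_triangle: "\<bar>nm x - nm y\<bar> \<le> nm (x - y)"
  using nm_triangle[of "x - y" y] nm_triangle[of "y - x" x] nm_minus_commute[of x y] by auto

lemma nm_sum_le: "nm (\<Sum>i\<in>I. f i) \<le> (\<Sum>i\<in>I. nm (f i))"
proof (induction I rule: infinite_finite_induct)
  case (insert i I)
  then show ?case using nm_triangle[of "f i" "sum f I"] by auto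
qed auto

definition orthonormal_on :: "nat set \<Rightarrow> (nat \<Rightarrow> 'a) \<Rightarrow> bool" where
  "orthonormal_on I e \<longleftrightarrow> (\<forall>i\<in>I. \<forall>j\<in>I. ip (e i) (e j) = (if i = j then 1 else 0))"

lemma orthonormal_on_subset: "orthonormal_on I e \<Longrightarrow> J \<subseteq> I \<Longrightarrow> orthonormal_on J e"
  unfolding orthonormal_on_def by blast

lemma nm_orthonormal: "orthonormal_on I e \<Longrightarrow> i \<in> I \<Longrightarrow> nm (e i) = 1"
  by (simp add: orthonormal_on_def ip_norm_def)

lemma ip_orthonormal_sum:
  assumes "orthonormal_on I e" "finite J" "J \<subseteq> I" "i \<in> I"
  shows "ip (e i) (\<Sum>k\<in>J. sc (a k) (e k)) = (if i \<in> J then a i else 0)"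
proof -
  have "ip (e i) (\<Sum>k\<in>J. sc (a k) (e k)) = (\<Sum>k\<in>J. if k = i then a i else 0)"
    unfolding ip_sum_right
    by (rule sum.cong) (use assms in \<open>auto simp: ip_scale_right orthonormal_on_def subset_iff\<close>)
  then show ?thesis using assms(2) by simp
qed

lemma nm_orthonormal_sum:
  assumes "orthonormal_on I e" "finite J" "J \<subseteq> I"
  shows "(nm (\<Sum>k\<in>J. sc (a k) (e k)))\<^sup>2 = (\<Sum>k\<in>J. (cmod (a k))\<^sup>2)"
proof -
  have "ip (\<Sum>k\<in>J. sc (a k) (e k)) (\<Sum>k\<in>J. sc (a k) (e k)) =
      (\<Sum>i\<in>J. cnj (a i) * ip (e i) (\<Sum>k\<in>J. sc (a k) (e k)))"
    by (simp only: ip_sum_left ip_scale_left)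
  also have "\<dots> = (\<Sum>i\<in>J. of_real ((cmod (a i))\<^sup>2))"
    by (rule sum.cong) (use assms ip_orthonormal_sum[OF assms] in
        \<open>auto simp: mult_cnj_self mult.commute subset_iff\<close>)
  finally show ?thesis by (simp add: nm_sq)
qed

section \<open>Norm convergence and orthogonal projection\<close>

abbreviation conv :: "(nat \<Rightarrow> 'a) \<Rightarrow> 'a \<Rightarrow> bool" where
  "conv X L \<equiv> (\<lambda>n. nm (X n - L)) \<longlonglongrightarrow> 0"

lemma conv_nm: assumes "conv X L" shows "(\<lambda>n. nm (X n)) \<longlonglongrightarrow> nm L"
proof (rule Lim_transform[OF tendsto_const])
  show "(\<lambda>n. nm (X n) - nm L) \<longlonglongrightarrow> 0"
    by (rule Lim_null_comparison[OF _ assms])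
      (use nm_reverse_triangle in \<open>auto intro!: always_eventually\<close>)
qed

lemma conv_ip: assumes "conv X L" shows "(\<lambda>n. ip y (X n)) \<longlonglongrightarrow> ip y L"
proof (rule LIM_zero_cancel, rule Lim_null_comparison)
  show "\<forall>\<^sub>F n in sequentially. norm (ip y (X n) - ip y L) \<le> nm y * nm (X n - L)"
    by (metis (mono_tags, lifting) Cauchy_Schwarz always_eventually ip_diff_right)
  show "(\<lambda>n. nm y * nm (X n - L)) \<longlonglongrightarrow> 0"
    using tendsto_mult_left[OF assms, of "nm y"] by simp
qed

lemma conv_unique: assumes "conv X L" "conv X L'" shows "L = L'"
proof -
  have "(\<lambda>n. nm (X n - L) + nm (X n - L')) \<longlonglongrightarrow> 0"
    using tendsto_add[OF assms] by simp
  moreover have "nm (L - L') \<le> nm (X n - L) + nm (X n - L')" for n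
    using nm_triangle_mid[of L L' "X n"] nm_minus_commute[of L] by auto
  ultimately have "nm (L - L') \<le> 0"
    by (intro tendsto_lowerbound[of _ 0 sequentially]) auto
  then show ?thesis using nm_nonneg[of "L - L'"] by (simp flip: nm_eq_0_iff[of "L - L'"])
qed

lemma conv_subseq: "conv X L \<Longrightarrow> strict_mono r \<Longrightarrow> conv (\<lambda>n. X (r n)) L"
  using LIMSEQ_subseq_LIMSEQ[of "\<lambda>n. nm (X n - L)" 0 r] by (simp add: o_def)

lemma conv_linear_image:
  assumes "conv X L" "\<And>x. nm (S x) \<le> c * nm x" "\<And>x y. S (x - y) = S x - S y"
  shows "conv (\<lambda>n. S (X n)) (S L)"
proof (rule Lim_null_comparison)
  show "\<forall>\<^sub>F n in sequentially. norm (nm (S (X n) - S L)) \<le> c * nm (X n - L)"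
    using assms(2,3) by (auto intro!: always_eventually simp flip: assms(3))
  show "(\<lambda>n. c * nm (X n - L)) \<longlonglongrightarrow> 0"
    using tendsto_mult_left[OF assms(1), of c] by simp
qed

lemma conv_dist: assumes "conv X L" shows "(\<lambda>n. nm (X n - y)) \<longlonglongrightarrow> nm (L - y)"
  by (rule conv_nm) (use assms in simp)

lemma Cauchy_conv:
  assumes "\<And>m n. nm (X m - X n) \<le> a m + a n" "a \<longlonglongrightarrow> (0::real)"
  obtains L where "conv X L"
proof -
  have "\<exists>K. \<forall>m\<ge>K. \<forall>n\<ge>K. nm (X m - X n) < e" if "e > 0" for e
  proof -
    have "\<forall>\<^sub>F n in sequentially. a n < e / 2"
      using order_tendstoD(2)[OF assms(2), of "e / 2"] that by simp
    then obtain K where "\<And>n. n \<ge> K \<Longrightarrow> a n < e / 2"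
      by (auto simp: eventually_sequentially)
    then have "nm (X m - X n) < e" if "m \<ge> K" "n \<ge> K" for m n
      using assms(1)[of m n] that by (smt (verit) field_sum_of_halves)
    then show ?thesis by blast
  qed
  then show ?thesis using complete[of X] that by blast
qed

text \<open>The projection theorem: a minimizing sequence for the distance to \<open>S\<close> is
  Cauchy, and its limit leaves an orthogonal remainder. It is used to show that a positive definite
  selfadjoint operator is onto.\<close>

lemma orthogonal_decomposition:
  assumes S: "subspace S" and closed: "\<forall>X L. (\<forall>n. X n \<in> S) \<longrightarrow> conv X L \<longrightarrow> L \<in> S"
  obtains y where "y \<in> S" "\<And>s. s \<in> S \<Longrightarrow> ip s (x - y) = 0"
proof -
  define d where "d = (INF s\<in>S. (nm (x - s))\<^sup>2)"
  have S0: "0 \<in> S" using S by (rule subspace_0)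
  have bdd: "bdd_below ((\<lambda>s. (nm (x - s))\<^sup>2) ` S)" by (rule bdd_belowI2[of _ 0]) simp
  have lower: "d \<le> (nm (x - s))\<^sup>2" if "s \<in> S" for s
    unfolding d_def by (rule cINF_lower[OF bdd that])
  have "\<exists>s\<in>S. (nm (x - s))\<^sup>2 < d + inverse (real (Suc n))" for n
    using cINF_less_iff[OF _ bdd, of "d + inverse (real (Suc n))"] S0
    unfolding d_def by auto
  then obtain X where X: "\<And>n. X n \<in> S" "\<And>n. (nm (x - X n))\<^sup>2 < d + inverse (real (Suc n))"
    by metis
  have par: "(nm (X m - X n))\<^sup>2 \<le> 2 * inverse (real (Suc m)) + 2 * inverse (real (Suc n))" for m n
  proof -
    \<comment> \<open>The midpoint of \<open>X m\<close> and \<open>X n\<close> lies in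
      \<open>S\<close>, hence is at distance at least \<open>sqrt d\<close> from \<open>x\<close>;
      the parallelogram law turns this into a bound for \<open>X m - X n\<close>.\<close>
    define s where "s = sc (1/2) (X m + X n)"
    have "s \<in> S" unfolding s_def using S X by (simp add: subspace_add subspace_scale)
    then have "4 * d \<le> (2 * nm (x - s))\<^sup>2" using lower by (simp add: power_mult_distrib)
    also have "2 * nm (x - s) = nm (sc 2 (x - s))" by (simp add: nm_scale)
    also have "sc 2 (x - s) = (x - X m) + (x - X n)"
      by (simp add: s_def scale_right_diff_distrib scale_left_distrib[of 1 1, simplified])
    finally have "4 * d \<le> (nm ((x - X m) + (x - X n)))\<^sup>2" .
    moreover have "(nm (X m - X n))\<^sup>2 = (nm ((x - X n) - (x - X m)))\<^sup>2" by simp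
    ultimately show ?thesis using X(2)[of m] X(2)[of n]
      unfolding nm_add_sq nm_diff_sq[of "x - X n" "x - X m"] Re_ip_commute[of "x - X n" "x - X m"]
      by argo
  qed
  have "nm (X m - X n) \<le> sqrt (2 * inverse (real (Suc m))) + sqrt (2 * inverse (real (Suc n)))"
    for m n
  proof -
    have "nm (X m - X n) \<le> sqrt (2 * inverse (real (Suc m)) + 2 * inverse (real (Suc n)))"
      using par by (intro real_le_rsqrt)
    also have "\<dots> \<le> sqrt (2 * inverse (real (Suc m))) + sqrt (2 * inverse (real (Suc n)))"
      by (intro sqrt_add_le_add_sqrt) auto
    finally show ?thesis .
  qed
  moreover have "(\<lambda>n. sqrt (2 * inverse (real (Suc n)))) \<longlonglongrightarrow> 0"
    using tendsto_real_sqrt[OF tendsto_mult_left[OF LIMSEQ_inverse_real_of_nat, of 2]] by simp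
  ultimately obtain y where y: "conv X y" by (rule Cauchy_conv)
  have yS: "y \<in> S" using X(1) y closed by blast
  have "(\<lambda>n. nm (X n - x)) \<longlonglongrightarrow> nm (y - x)" using y by (rule conv_dist)
  then have "(\<lambda>n. (nm (x - X n))\<^sup>2) \<longlonglongrightarrow> (nm (x - y))\<^sup>2"
    by (simp add: nm_minus_commute[of x] tendsto_power)
  moreover have "(\<lambda>n. d + inverse (real (Suc n))) \<longlonglongrightarrow> d"
    using tendsto_add[OF tendsto_const LIMSEQ_inverse_real_of_nat, of d] by simp
  ultimately have yd: "(nm (x - y))\<^sup>2 \<le> d"
    by (rule LIMSEQ_le) (use X(2) less_imp_le in blast)
  have "ip s (x - y) = 0" if s: "s \<in> S" for s
  proof (rule ccontr)
    assume ne: "ip s (x - y) \<noteq> 0"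
    then have s0: "nm s \<noteq> 0" by auto
    \<comment> \<open>The coefficient for which \<open>sc c s\<close> is the projection of
      \<open>x - y\<close> onto the line of \<open>s\<close>; adding it to \<open>y\<close> would
      bring the squared distance below \<open>d\<close>.\<close>
    define c where "c = ip s (x - y) / of_real ((nm s)\<^sup>2)"
    have "y + sc c s \<in> S" using S yS s by (simp add: subspace_add subspace_scale)
    then have "d \<le> (nm ((x - y) - sc c s))\<^sup>2" using lower by (simp add: algebra_simps)
    also have "\<dots> = (nm (x - y))\<^sup>2 + (cmod c * nm s)\<^sup>2 - 2 * Re (ip (x - y) (sc c s))"
      by (simp only: nm_diff_sq nm_scale)
    also have "ip (x - y) (sc c s) = of_real ((cmod c * nm s)\<^sup>2)"
    proof -
      have "ip (x - y) (sc c s) = c * cnj (ip s (x - y))"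
        by (simp only: ip_scale_right ip_commute[of "x - y" s])
      also have "ip s (x - y) = c * of_real ((nm s)\<^sup>2)" using s0 by (simp add: c_def)
      finally have "ip (x - y) (sc c s) = (c * cnj c) * of_real ((nm s)\<^sup>2)" by simp
      then show ?thesis by (simp add: mult_cnj_self power_mult_distrib)
    qed
    finally have "(cmod c * nm s)\<^sup>2 \<le> 0" using yd unfolding Re_complex_of_real by linarith
    then show False using ne s0 by (simp add: c_def)
  qed
  then show ?thesis using that yS by blast
qed

end

section \<open>Bounded symmetric operators\<close>

context complex_hilbert_space
begin

definition sym_op :: "('a \<Rightarrow> 'a) \<Rightarrow> bool" where
  "sym_op S \<longleftrightarrow> (\<forall>x y. S (x + y) = S x + S y) \<and> (\<forall>a x. S (sc a x) = sc a (S x)) \<and>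
     (\<forall>x y. ip (S x) y = ip x (S y))"

lemma sym_op_add: "sym_op S \<Longrightarrow> S (x + y) = S x + S y"
  and sym_op_scale: "sym_op S \<Longrightarrow> S (sc a x) = sc a (S x)"
  and sym_op_ip: "sym_op S \<Longrightarrow> ip (S x) y = ip x (S y)"
  by (auto simp: sym_op_def)

lemma sym_op_zero: "sym_op S \<Longrightarrow> S 0 = 0"
  using sym_op_scale[of S 0 0] by simp

lemma sym_op_minus: "sym_op S \<Longrightarrow> S (- x) = - S x"
  using sym_op_scale[of S "- 1" x] by simp

lemma sym_op_diff: "sym_op S \<Longrightarrow> S (x - y) = S x - S y"
  using sym_op_add[of S x "- y"] by (simp add: sym_op_minus)

lemma sym_op_sum: "sym_op S \<Longrightarrow> S (\<Sum>i\<in>I. f i) = (\<Sum>i\<in>I. S (f i))"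
  by (induction I rule: infinite_finite_induct) (auto simp: sym_op_zero sym_op_add)

lemma sym_op_shift:
  assumes "sym_op S" shows "sym_op (\<lambda>x. S x - sc (of_real r) x)"
  unfolding sym_op_def
  by (auto simp: sym_op_add[OF assms] sym_op_scale[OF assms] sym_op_ip[OF assms]
      scale_right_distrib scale_right_diff_distrib ip_simps algebra_simps)

lemma sym_op_twice:
  assumes "sym_op S" shows "sym_op (\<lambda>x. S (S x))"
  unfolding sym_op_def
  by (auto simp: sym_op_add[OF assms] sym_op_scale[OF assms] sym_op_ip[OF assms])

text \<open>The operator inequality \<open>S\<^sup>2 \<le> c S\<close> for
  \<open>0 \<le> S \<le> c\<close>, from expanding the form of \<open>S\<close> at
  \<open>x - S x / c\<close>. Positivity and the upper bound are asked only at the two vectors that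
  occur, so that it also applies on an invariant subspace.\<close>

lemma nm_sq_le_form:
  assumes S: "sym_op S" and c: "c > 0"
    and pos: "0 \<le> Re (ip (S (x - sc (of_real (1/c)) (S x))) (x - sc (of_real (1/c)) (S x)))"
    and bound: "Re (ip (S (S x)) (S x)) \<le> c * (nm (S x))\<^sup>2"
  shows "(nm (S x))\<^sup>2 \<le> c * Re (ip (S x) x)"
proof -
  define b where "b = (nm (S x))\<^sup>2"
  have 1: "Re (ip (S x) (S x)) = b" by (simp add: b_def nm_sq)
  have 2: "Re (ip (S (S x)) x) = b" by (simp add: b_def nm_sq sym_op_ip[OF S])
  have "0 \<le> Re (ip (S x) x) - 2 * b / c + Re (ip (S (S x)) (S x)) / c\<^sup>2"
    using pos 1 2 by (simp add: sym_op_diff[OF S] sym_op_scale[OF S] ip_simps power2_eq_square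
        algebra_simps)
  also have "\<dots> \<le> Re (ip (S x) x) - 2 * b / c + c * b / c\<^sup>2"
    using bound by (simp add: b_def divide_right_mono)
  also have "\<dots> = Re (ip (S x) x) - b / c"
    using c by (simp add: power2_eq_square field_simps)
  finally have "b / c \<le> Re (ip (S x) x)" by simp
  then show ?thesis using c by (simp add: b_def divide_le_eq mult.commute)
qed

lemma conv_add: "conv X L \<Longrightarrow> conv Y K \<Longrightarrow> conv (\<lambda>n. X n + Y n) (L + K)"
proof (rule Lim_null_comparison[rotated])
  assume "conv X L" "conv Y K"
  then show "(\<lambda>n. nm (X n - L) + nm (Y n - K)) \<longlonglongrightarrow> 0"
    using tendsto_add[of _ 0 _ _ 0] by fastforce
  show "\<forall>\<^sub>F n in sequentially. norm (nm (X n + Y n - (L + K))) \<le> nm (X n - L) + nm (Y n - K)"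
    using nm_triangle[of "X n - L" "Y n - K" for n] by (simp add: algebra_simps)
qed

lemma conv_scale: assumes "conv X L" shows "conv (\<lambda>n. sc a (X n)) (sc a L)"
  by (rule conv_linear_image[OF assms, of "sc a" "cmod a"])
    (auto simp: nm_scale scale_right_diff_distrib)

section \<open>Polynomials of a symmetric operator\<close>

lemma op_poly_eq:
  assumes "degree p \<le> n"
  shows "op_poly sc p T v = (\<Sum>i\<le>n. sc (of_real (coeff p i)) ((T ^^ i) v))"
  unfolding op_poly_def
  by (rule sum.mono_neutral_left) (use assms in \<open>auto simp: coeff_eq_0\<close>)

lemma op_poly_add: "op_poly sc (p + r) T v = op_poly sc p T v + op_poly sc r T v"
proof -
  define n where "n = max (degree p) (degree r)"
  have "degree (p + r) \<le> n" "degree p \<le> n" "degree r \<le> n"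
    by (auto simp: n_def degree_add_le_max)
  then show ?thesis by (simp add: op_poly_eq[of _ n] scale_left_distrib sum.distrib)
qed

lemma op_poly_smult: "op_poly sc (smult a p) T v = sc (of_real a) (op_poly sc p T v)"
  by (simp add: op_poly_eq[of _ "degree p"] scale_sum_right)

lemma op_poly_diff: "op_poly sc (p - r) T v = op_poly sc p T v - op_poly sc r T v"
  using op_poly_add[of "p - r" r T v] by (simp add: algebra_simps)

lemma op_poly_0 [simp]: "op_poly sc 0 T v = 0"
  by (simp add: op_poly_def)

text \<open>Horner's rule; it reduces the algebra of \<open>p(T)\<close> to inductions along
  \<open>pCons\<close>.\<close>

lemma op_poly_pCons:
  assumes "sym_op T"
  shows "op_poly sc (pCons a p) T v = sc (of_real a) v + T (op_poly sc p T v)"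
proof -
  have "op_poly sc (pCons a p) T v =
      (\<Sum>i\<le>Suc (degree p). sc (of_real (coeff (pCons a p) i)) ((T ^^ i) v))"
    by (rule op_poly_eq) (rule degree_pCons_le)
  then show ?thesis
    by (simp add: sum.atMost_Suc_shift op_poly_def sym_op_sum[OF assms] sym_op_scale[OF assms]
        del: sum.atMost_Suc)
qed

lemma op_poly_const: "sym_op T \<Longrightarrow> op_poly sc [:a:] T v = sc (of_real a) v"
  using op_poly_pCons[of T a 0 v] by (simp add: sym_op_zero)

lemma op_poly_mult:
  assumes "sym_op T"
  shows "op_poly sc (p * r) T v = op_poly sc p T (op_poly sc r T v)"
  by (induction p) (auto simp: op_poly_add op_poly_smult op_poly_pCons[OF assms])

lemma sym_op_op_poly:
  assumes "sym_op T" shows "sym_op (op_poly sc p T)"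
proof (induction p)
  case 0
  then show ?case by (simp add: sym_op_def)
next
  case (pCons a p)
  \<comment> \<open>Commutation with \<open>T\<close> is read off from the product of
    \<open>p\<close> with \<open>[:0, 1:]\<close>, taken in either order. The symmetry of
    \<open>T p(T)\<close> depends on it.\<close>
  have comm: "op_poly sc p T (T v) = T (op_poly sc p T v)" for v
  proof -
    have "op_poly sc p T (T v) = op_poly sc (p * [:0, 1:]) T v"
      by (simp add: op_poly_mult[OF assms] op_poly_pCons[OF assms] sym_op_zero[OF assms]
          del: mult_pCons_right)
    then show ?thesis by (simp add: op_poly_pCons[OF assms])
  qed
  show ?case
    unfolding sym_op_def op_poly_pCons[OF assms]
    by (auto simp: sym_op_add[OF assms] sym_op_scale[OF assms] sym_op_ip[OF assms]
        sym_op_add[OF pCons.IH] sym_op_scale[OF pCons.IH] sym_op_ip[OF pCons.IH] comm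
        scale_right_distrib ip_simps mult.commute)
qed

lemma op_poly_eigenvector:
  assumes "sym_op T" "T v = sc (of_real t) v"
  shows "op_poly sc p T v = sc (of_real (poly p t)) v"
  by (induction p) (auto simp: op_poly_pCons[OF assms(1)] sym_op_scale[OF assms(1)] assms(2)
      scale_left_distrib mult.commute)

end

text \<open>Dividing a linear factor out of a polynomial of known sign leaves the sign of the
  quotient open at the root itself; continuity supplies it there.\<close>

lemma poly_nonneg_at_puncture:
  fixes g :: "real poly"
  assumes "a < b" "x0 \<in> {a..b}" "\<And>x. x \<in> {a..b} \<Longrightarrow> x \<noteq> x0 \<Longrightarrow> 0 \<le> poly g x"
  shows "0 \<le> poly g x0"
proof (rule tendsto_lowerbound)
  show "(poly g \<longlongrightarrow> poly g x0) (at x0 within {a..b})"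
    using poly_isCont[of x0 g] unfolding isCont_def by (rule tendsto_within_subset) simp
  show "\<forall>\<^sub>F x in at x0 within {a..b}. 0 \<le> poly g x"
    using assms(3) by (auto simp: eventually_at_filter)
  show "at x0 within {a..b} \<noteq> bot"
    using assms(1,2) by (simp add: trivial_limit_within islimpt_Icc)
qed

text \<open>The common model of the inverses of \<open>A\<close> and of \<open>M\<close>, each in
  its own inner product. The form is assumed nonnegative only; with injectivity this already makes
  it strictly positive, see \<open>T_form_pos\<close>.\<close>

locale positive_operator = complex_hilbert_space sc ip
  for sc :: "complex \<Rightarrow> 'a::ab_group_add \<Rightarrow> 'a" and ip +
  fixes T :: "'a \<Rightarrow> 'a"
  assumes T_sym_op: "sym_op T"
    and T_pos: "0 \<le> Re (ip (T x) x)"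
    and T_inj: "T x = 0 \<Longrightarrow> x = 0"
    and T_bounded: "\<exists>c. \<forall>x. nm (T x) \<le> c * nm x"
begin

lemmas T_add = sym_op_add[OF T_sym_op]
  and T_scale = sym_op_scale[OF T_sym_op]
  and T_sym = sym_op_ip[OF T_sym_op]
  and T_zero = sym_op_zero[OF T_sym_op]
  and T_minus = sym_op_minus[OF T_sym_op]
  and T_diff = sym_op_diff[OF T_sym_op]
  and T_sum = sym_op_sum[OF T_sym_op]

abbreviation form :: "real poly \<Rightarrow> 'a \<Rightarrow> real" where
  "form p v \<equiv> Re (ip (op_poly sc p T v) v)"

lemma form_add: "form (p + r) v = form p v + form r v"
  by (simp add: op_poly_add ip_simps)

lemma form_smult: "form (smult a p) v = a * form p v"
  by (simp add: op_poly_smult ip_simps)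

text \<open>A square factor moves into the vector. This keeps the list of weights in the next
  induction finite: whenever a weight meets a linear factor that it already contains, the resulting
  square disappears.\<close>

lemma form_square: "form (r * r * p) v = form p (op_poly sc r T v)"
proof -
  have "op_poly sc (r * r * p) T v = op_poly sc (r * (p * r)) T v"
    by (simp add: mult.commute mult.left_commute)
  then show ?thesis
    by (simp add: op_poly_mult[OF T_sym_op] sym_op_ip[OF sym_op_op_poly[OF T_sym_op]])
qed

lemma T_form_le:
  assumes "\<And>x. nm (T x) \<le> c * nm x"
  shows "Re (ip (T x) x) \<le> c * (nm x)\<^sup>2"
  using Re_ip_le[of "T x" x] mult_right_mono[OF assms[of x], of "nm x"]
  by (simp add: power2_eq_square)

lemma T_nm_sq_le:
  assumes "c > 0" "\<And>x. nm (T x) \<le> c * nm x"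
  shows "(nm (T x))\<^sup>2 \<le> c * Re (ip (T x) x)"
  using assms by (intro nm_sq_le_form[OF T_sym_op]) (auto intro: T_pos T_form_le)

text \<open>Splitting off the minimum of \<open>p\<close> on \<open>[0, c]\<close> leaves \<open>x g\<close>, \<open>(c - x) g\<close> or \<open>(x - x\<^sub>0)\<^sup>2 g\<close>
  with \<open>g \<ge> 0\<close> on \<open>[0, c]\<close>. The four weights make the induction on the degree go through, and
  replace the representation theorem for polynomials that are nonnegative on an interval.\<close>

lemma form_nonneg_weighted:
  assumes c: "c > 0" and bound: "\<And>x. nm (T x) \<le> c * nm x"
    and "\<And>x. x \<in> {0..c} \<Longrightarrow> 0 \<le> poly p x"
    and "w \<in> {1, [:0, 1:], [:c, - 1:], [:0, 1:] * [:c, - 1:]}"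
  shows "0 \<le> form (w * p) v"
  using assms(3,4)
proof (induction "degree p" arbitrary: p w v rule: less_induct)
  case less
  let ?X = "[:0, 1:] :: real poly" and ?Y = "[:c, - 1:] :: real poly"
  \<comment> \<open>The weights stand for \<open>1\<close>, \<open>T\<close>, \<open>c - T\<close>
    and \<open>T (c - T)\<close>; positivity of the last one is \<open>T_nm_sq_le\<close>.\<close>
  have w0: "0 \<le> form w v" for v
  proof -
    have "form 1 v = (nm v)\<^sup>2"
      using op_poly_const[OF T_sym_op, of 1 v] by (simp add: nm_sq one_pCons)
    moreover have "form ?X v = Re (ip (T v) v)"
      by (simp add: op_poly_pCons[OF T_sym_op] T_zero)
    moreover have "form ?Y v = c * (nm v)\<^sup>2 - Re (ip (T v) v)"
      by (simp add: op_poly_pCons[OF T_sym_op] T_zero T_minus ip_simps nm_sq)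
    moreover have "form (?X * ?Y) v = c * Re (ip (T v) v) - (nm (T v))\<^sup>2"
      by (simp add: op_poly_pCons[OF T_sym_op] T_zero T_minus T_scale T_add ip_simps nm_sq T_sym)
    ultimately show ?thesis
      using less.prems(2) T_pos[of v] T_form_le[OF bound, of v] T_nm_sq_le[OF c bound, of v]
      by (elim insertE) auto
  qed
  show ?case
  proof (cases "degree p = 0")
    case True
    then obtain a where a: "p = [:a:]" by (rule degree_eq_zeroE)
    then have "0 \<le> a" using less.prems(1)[of 0] c by simp
    moreover have "w * p = smult a w" using a by simp
    ultimately show ?thesis using w0[of v] by (simp add: form_smult)
  next
    case False
    have "\<exists>x0\<in>{0..c}. \<forall>y\<in>{0..c}. poly p x0 \<le> poly p y"
      by (rule continuous_attains_inf) (use c in \<open>auto intro: continuous_intros\<close>)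
    then obtain x0 where x0: "x0 \<in> {0..c}" "\<And>y. y \<in> {0..c} \<Longrightarrow> poly p x0 \<le> poly p y" by blast
    define m where "m = poly p x0"
    have m0: "0 \<le> m" using less.prems(1) x0(1) by (simp add: m_def)
    have "poly (p - [:m:]) x0 = 0" by (simp add: m_def)
    then obtain g where g: "p - [:m:] = [:- x0, 1:] * g"
      unfolding poly_eq_0_iff_dvd by (elim dvdE)
    have pm: "p = [:m:] + [:- x0, 1:] * g" using g by (simp add: algebra_simps)
    have pg: "poly p x - m = (x - x0) * poly g x" for x
      using arg_cong[OF g, of "\<lambda>p. poly p x"] by (simp add: algebra_simps)
    have "g \<noteq> 0" using False pm by auto
    then have deg: "degree p = Suc (degree g)"
    proof -
      have "degree ([:- x0, 1:] * g) = Suc (degree g)"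
        using \<open>g \<noteq> 0\<close> by (subst degree_mult_eq) auto
      then show ?thesis using pm by (simp add: degree_add_eq_right)
    qed
    have gsgn: "0 \<le> (x - x0) * poly g x" if "x \<in> {0..c}" for x
      using x0(2)[OF that] pg[of x] by (simp add: m_def)
    have main: "0 \<le> form (w * ([:- x0, 1:] * g)) v"
    proof -
      consider "x0 = 0" | "x0 = c" | "0 < x0" "x0 < c" using x0(1) by fastforce
      then show ?thesis
      proof cases
        case 1
        have "0 \<le> poly g x" if "x \<in> {0..c}" for x
        proof (cases "x = 0")
          case True
          have "0 \<le> poly g 0"
            by (rule poly_nonneg_at_puncture[OF c])
              (use gsgn 1 c in \<open>force simp: zero_le_mult_iff\<close>)+
          then show ?thesis using True by simp
        next
          case False
          then show ?thesis using gsgn[OF that] 1 that by (auto simp: zero_le_mult_iff)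
        qed
        then have IH: "0 \<le> form (w' * g) v'" if "w' \<in> {1, ?X, ?Y, ?X * ?Y}" for w' v'
          using less.hyps[of g w' v'] that deg by auto
        from less.prems(2) show ?thesis
        proof (elim insertE emptyE)
          assume w: "w = 1"
          then show ?thesis using IH[of ?X v] 1 by simp
        next
          assume w: "w = ?X"
          then have "w * ([:- x0, 1:] * g) = ?X * ?X * (1 * g)" using 1 by (simp add: algebra_simps)
          then show ?thesis using IH[of 1] by (simp only: form_square insert_iff simp_thms)
        next
          assume w: "w = ?Y"
          then have "w * ([:- x0, 1:] * g) = (?X * ?Y) * g" using 1 by (simp only: mult_ac) simp
          then show ?thesis using IH[of "?X * ?Y"] by simp
        next
          assume w: "w = ?X * ?Y"
          then have "w * ([:- x0, 1:] * g) = ?X * ?X * (?Y * g)" using 1 by (simp only: mult_ac) simp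
          then show ?thesis using IH[of ?Y] by (simp only: form_square insert_iff simp_thms)
        qed
      next
        case 2
        \<comment> \<open>At the right end point the linear factor \<open>x - c\<close> is negative;
          its sign is moved into the quotient.\<close>
        define h where "h = - g"
        have h: "[:- x0, 1:] * g = ?Y * h" using 2 by (simp add: h_def)
        have hsgn: "0 \<le> (c - x) * poly h x" if "x \<in> {0..c}" for x
          using gsgn[OF that] 2 by (simp add: h_def algebra_simps)
        have "0 \<le> poly h x" if "x \<in> {0..c}" for x
        proof (cases "x = c")
          case True
          have "0 \<le> poly h c"
            by (rule poly_nonneg_at_puncture[OF c])
              (use hsgn c in \<open>force simp: zero_le_mult_iff\<close>)+
          then show ?thesis using True by simp
        next
          case False
          then show ?thesis using hsgn[OF that] that by (auto simp: zero_le_mult_iff)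
        qed
        then have IH: "0 \<le> form (w' * h) v'" if "w' \<in> {1, ?X, ?Y, ?X * ?Y}" for w' v'
          using less.hyps[of h w' v'] that deg by (auto simp: h_def)
        from less.prems(2) show ?thesis unfolding h
        proof (elim insertE emptyE)
          assume w: "w = 1"
          then show "0 \<le> form (w * (?Y * h)) v" using IH[of ?Y v] by simp
        next
          assume w: "w = ?X"
          then have "w * (?Y * h) = (?X * ?Y) * h" by (simp only: mult_ac)
          then show "0 \<le> form (w * (?Y * h)) v" using IH[of "?X * ?Y"] by simp
        next
          assume w: "w = ?Y"
          then have "w * (?Y * h) = ?Y * ?Y * (1 * h)" by (simp only: mult_ac mult_1)
          then show "0 \<le> form (w * (?Y * h)) v" using IH[of 1] by (simp only: form_square insert_iff simp_thms)
        next
          assume w: "w = ?X * ?Y"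
          then have "w * (?Y * h) = ?Y * ?Y * (?X * h)" by (simp only: mult_ac)
          then show "0 \<le> form (w * (?Y * h)) v" using IH[of ?X] by (simp only: form_square insert_iff simp_thms)
        qed
      next
        case 3
        \<comment> \<open>At an interior minimum the quotient \<open>g\<close> is nonnegative to the
          right of \<open>x0\<close> and nonpositive to the left. It therefore vanishes at
          \<open>x0\<close>, which makes \<open>x0\<close> a double root.\<close>
        have right: "0 \<le> poly g x" if "x \<in> {x0..c}" "x \<noteq> x0" for x
          using gsgn[of x] 3 that by (auto simp: zero_le_mult_iff)
        have left: "0 \<le> poly (- g) x" if "x \<in> {0..x0}" "x \<noteq> x0" for x
          using gsgn[of x] 3 that by (auto simp: zero_le_mult_iff)
        have "0 \<le> poly g x0" "0 \<le> poly (- g) x0"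
          using poly_nonneg_at_puncture[OF 3(2) _ right] poly_nonneg_at_puncture[OF 3(1) _ left] 3
          by auto
        then have "poly g x0 = 0" by simp
        then obtain h where h: "g = [:- x0, 1:] * h"
          unfolding poly_eq_0_iff_dvd by (elim dvdE)
        have "h \<noteq> 0" using h \<open>g \<noteq> 0\<close> by auto
        then have "degree g = Suc (degree h)" unfolding h by (subst degree_mult_eq) auto
        have hs: "0 \<le> poly h x" if "x \<in> {0..c}" "x \<noteq> x0" for x
        proof -
          have "0 \<le> (x - x0)\<^sup>2 * poly h x"
            using gsgn[OF that(1)] unfolding h by (simp add: power2_eq_square algebra_simps)
          then show ?thesis using that(2) by (simp add: zero_le_mult_iff)
        qed
        moreover have "0 \<le> poly h x0" by (rule poly_nonneg_at_puncture[OF c x0(1) hs])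
        ultimately have "0 \<le> poly h x" if "x \<in> {0..c}" for x using that by (cases "x = x0") auto
        then have "0 \<le> form (w * h) v'" for v'
          using less.hyps[of h w v'] less.prems(2) deg \<open>degree g = _\<close> by simp
        moreover have "w * ([:- x0, 1:] * g) = [:- x0, 1:] * [:- x0, 1:] * (w * h)"
          unfolding h by (simp only: mult_ac)
        ultimately show ?thesis by (simp only: form_square insert_iff simp_thms)
      qed
    qed
    have "w * p = smult m w + w * ([:- x0, 1:] * g)"
      by (subst pm) (simp add: distrib_left)
    then show ?thesis using main w0[of v] m0 by (simp add: form_add form_smult)
  qed
qed

text \<open>Since \<open>K\<^sup>2 - p\<^sup>2\<close> is nonnegative on \<open>[0, c]\<close>, so
  is its form, which equals \<open>K\<^sup>2 (nm v)\<^sup>2 - (nm (p(T) v))\<^sup>2\<close>. This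
  supremum bound is the estimate that carries the functional calculus.\<close>

lemma nm_op_poly_le:
  assumes c: "c > 0" and bound: "\<And>x. nm (T x) \<le> c * nm x" and K: "0 \<le> K"
    and p: "\<And>x. x \<in> {0..c} \<Longrightarrow> \<bar>poly p x\<bar> \<le> K"
  shows "nm (op_poly sc p T v) \<le> K * nm v"
proof -
  have "0 \<le> form (1 * ([:K\<^sup>2:] - p * p)) v"
  proof (rule form_nonneg_weighted[OF c bound])
    fix x assume "x \<in> {0..c}"
    then have "(poly p x)\<^sup>2 \<le> K\<^sup>2" using power_mono[of "\<bar>poly p x\<bar>" K 2] p[of x] by simp
    then show "0 \<le> poly ([:K\<^sup>2:] - p * p) x" by (simp add: power2_eq_square)
  qed simp
  also have "form (1 * ([:K\<^sup>2:] - p * p)) v = K\<^sup>2 * (nm v)\<^sup>2 - (nm (op_poly sc p T v))\<^sup>2"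
    by (simp add: op_poly_diff op_poly_const[OF T_sym_op] op_poly_mult[OF T_sym_op] ip_simps nm_sq
        sym_op_ip[OF sym_op_op_poly[OF T_sym_op]])
  finally have "(nm (op_poly sc p T v))\<^sup>2 \<le> (K * nm v)\<^sup>2" by (simp add: power_mult_distrib)
  then show ?thesis using K by (meson mult_nonneg_nonneg nm_nonneg power2_le_imp_le)
qed

end

section \<open>Continuous functional calculus\<close>

lemma Weierstrass_poly:
  fixes f :: "real \<Rightarrow> real"
  assumes "continuous_on {a..b} f" "e > 0"
  obtains p :: "real poly" where "\<And>x. x \<in> {a..b} \<Longrightarrow> \<bar>f x - poly p x\<bar> < e"
proof -
  obtain g where g: "real_polynomial_function g" "\<And>x. x \<in> {a..b} \<Longrightarrow> \<bar>f x - g x\<bar> < e"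
    using Stone_Weierstrass_real_polynomial_function[of "{a..b}" f e] assms by blast
  obtain n c where "g = (\<lambda>x. \<Sum>i\<le>n. c i * x ^ i)"
    using g(1) unfolding real_polynomial_function_iff_sum by blast
  then have "g x = poly (\<Sum>i\<le>n. monom (c i) i) x" for x
    by (simp add: poly_sum poly_monom)
  then show ?thesis using g(2) that by metis
qed

context positive_operator
begin

lemma T_bound_pos:
  fixes v :: 'a
  assumes "v \<noteq> 0" "\<And>x. nm (T x) \<le> c * nm x" shows "c > 0"
proof -
  have "0 < nm (T v)" using T_inj assms(1) nm_pos_iff by blast
  then have "0 < c * nm v" using assms(2)[of v] by linarith
  then show ?thesis using nm_nonneg[of v] zero_less_mult_pos2 assms(1) nm_pos_iff by blast
qed

text \<open>Polynomials converging to \<open>f\<close> uniformly on \<open>[0, c]\<close> are Cauchy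
  in operator norm by \<open>nm_op_poly_le\<close>. Continuity is required on the whole half line
  because \<open>c\<close> is chosen inside the proof.\<close>

lemma fun_calc_exists:
  assumes f: "continuous_on {0..} f"
  shows "\<exists>B. is_fun_calc sc ip T f B"
proof -
  obtain c0 where c0: "\<And>x. nm (T x) \<le> c0 * nm x" using T_bounded by blast
  define c where "c = max c0 1"
  have c: "c > 0" and bound: "nm (T x) \<le> c * nm x" for x
    using c0[of x] mult_right_mono[of c0 c "nm x"] by (auto simp: c_def)
  have fc: "continuous_on {0..c} f" by (rule continuous_on_subset[OF f]) auto
  define a :: "nat \<Rightarrow> real" where "a n = inverse (real (Suc n))" for n
  have a: "a \<longlonglongrightarrow> 0" "a n > 0" for n
    unfolding a_def by (rule LIMSEQ_inverse_real_of_nat) simp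
  have "\<exists>p :: real poly. \<forall>x\<in>{0..c}. \<bar>f x - poly p x\<bar> < a n" for n
    using Weierstrass_poly[OF fc a(2), of n] by metis
  then obtain p :: "nat \<Rightarrow> real poly" where p: "\<And>n x. x \<in> {0..c} \<Longrightarrow> \<bar>f x - poly (p n) x\<bar> < a n"
    by metis
  have cauchy: "nm (op_poly sc (p m) T v - op_poly sc (p n) T v) \<le> (a m + a n) * nm v" for m n v
    unfolding op_poly_diff[symmetric]
  proof (rule nm_op_poly_le[OF c bound])
    show "0 \<le> a m + a n" using a(2)[of m] a(2)[of n] by linarith
    fix x assume "x \<in> {0..c}"
    then show "\<bar>poly (p m - p n) x\<bar> \<le> a m + a n" using p[of x m] p[of x n] by auto
  qed
  have "\<exists>L. conv (\<lambda>n. op_poly sc (p n) T v) L" for v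
  proof -
    have "(\<lambda>n. a n * nm v) \<longlonglongrightarrow> 0" using tendsto_mult_right[OF a(1), of "nm v"] by simp
    then show ?thesis
      using Cauchy_conv[of "\<lambda>n. op_poly sc (p n) T v" "\<lambda>n. a n * nm v"] cauchy[of _ v]
      unfolding distrib_right by blast
  qed
  then obtain B where B: "\<And>v. conv (\<lambda>n. op_poly sc (p n) T v) (B v)" by metis
  \<comment> \<open>\<open>B\<close> is defined vector by vector; letting \<open>m\<close> tend to
    infinity in the Cauchy estimate recovers an error bound that is uniform in
    \<open>v\<close>.\<close>
  have close: "nm (op_poly sc (p n) T v - B v) \<le> a n * nm v" for n v
  proof (rule LIMSEQ_le)
    show "(\<lambda>m. nm (op_poly sc (p m) T v - op_poly sc (p n) T v)) \<longlonglongrightarrow> nm (op_poly sc (p n) T v - B v)"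
      using conv_dist[OF B, of v "op_poly sc (p n) T v"] by (simp only: nm_minus_commute[of "B v"])
    show "(\<lambda>m. (a m + a n) * nm v) \<longlonglongrightarrow> a n * nm v"
      using tendsto_mult_right[OF tendsto_add[OF a(1) tendsto_const], of "a n" "nm v"] by simp
  qed (use cauchy in blast)
  have small: "\<forall>\<^sub>F n in sequentially. a n < e" if "e > 0" for e
    using order_tendstoD(2)[OF a(1) that] .
  have "is_fun_calc sc ip T f B"
    unfolding is_fun_calc_def
  proof (intro exI[of _ c] exI[of _ p] conjI allI impI)
    show "uniform_limit {0..c} (\<lambda>n. poly (p n)) f sequentially"
      unfolding uniform_limit_iff dist_real_def
    proof (intro allI impI)
      fix e :: real assume "e > 0"
      from small[OF this] show "\<forall>\<^sub>F n in sequentially. \<forall>x\<in>{0..c}. \<bar>poly (p n) x - f x\<bar> < e"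
      proof eventually_elim
        case (elim n)
        then show ?case using p[of _ n] by (force simp: abs_minus_commute)
      qed
    qed
    fix e :: real assume "e > 0"
    from small[OF this]
    show "\<forall>\<^sub>F n in sequentially. \<forall>v. nm (op_poly sc (p n) T v - B v) \<le> e * nm v"
      by eventually_elim (meson close less_imp_le mult_right_mono nm_nonneg order_trans)
  qed (use c bound in auto)
  then show ?thesis by blast
qed

lemma fun_calc_unique:
  assumes "is_fun_calc sc ip T f B" "is_fun_calc sc ip T f B'"
  shows "B = B'"
proof
  fix v
  show "B v = B' v"
  proof (cases "v = 0")
    case False
    obtain c p where 1: "\<And>v. nm (T v) \<le> c * nm v"
        "uniform_limit {0..c} (\<lambda>n. poly (p n)) f sequentially"
        "\<And>e. e > 0 \<Longrightarrow> \<forall>\<^sub>F n in sequentially. \<forall>v. nm (op_poly sc (p n) T v - B v) \<le> e * nm v"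
      using assms(1) unfolding is_fun_calc_def by blast
    obtain c' p' where 2: "\<And>v. nm (T v) \<le> c' * nm v"
        "uniform_limit {0..c'} (\<lambda>n. poly (p' n)) f sequentially"
        "\<And>e. e > 0 \<Longrightarrow> \<forall>\<^sub>F n in sequentially. \<forall>v. nm (op_poly sc (p' n) T v - B' v) \<le> e * nm v"
      using assms(2) unfolding is_fun_calc_def by blast
    \<comment> \<open>The two witnesses may live on different intervals. On the shorter one both
      approximations are valid, and its length still bounds the norm of \<open>T\<close>.\<close>
    define d where "d = min c c'"
    have d: "d > 0" using T_bound_pos[OF False] 1(1) 2(1) by (simp add: d_def)
    have dT: "nm (T v) \<le> d * nm v" for v using 1(1) 2(1) by (simp add: d_def min_def)
    have "nm (B v - B' v) \<le> e" if e: "e > 0" for e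
    proof -
      \<comment> \<open>The error budget: \<open>2 r\<close> for the difference of the two
        polynomials on \<open>[0, d]\<close>, and one \<open>r\<close> each for approximating
        \<open>B\<close> and \<open>B'\<close>.\<close>
      define r where "r = e / (4 * nm v)"
      have nv: "nm v > 0" using False nm_pos_iff by blast
      then have r: "r > 0" using e by (simp add: r_def)
      have "\<forall>\<^sub>F n in sequentially. nm (B v - B' v) \<le> e"
        using uniform_limitD[OF 1(2) r] uniform_limitD[OF 2(2) r] 1(3)[OF r] 2(3)[OF r]
      proof eventually_elim
        case (elim n)
        have "\<bar>poly (p n - p' n) x\<bar> \<le> 2 * r" if "x \<in> {0..d}" for x
        proof -
          have "x \<in> {0..c}" "x \<in> {0..c'}" using that by (auto simp: d_def)
          then have "\<bar>poly (p n) x - f x\<bar> < r" "\<bar>poly (p' n) x - f x\<bar> < r"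
            using elim(1,2) by (auto simp: dist_real_def)
          then show ?thesis by auto
        qed
        then have "nm (op_poly sc (p n - p' n) T v) \<le> 2 * r * nm v"
          using r by (intro nm_op_poly_le[OF d dT]) auto
        moreover have "nm (B v - op_poly sc (p n) T v) \<le> r * nm v"
          using elim(3) nm_minus_commute by metis
        moreover have "nm (op_poly sc (p' n) T v - B' v) \<le> r * nm v" using elim(4) by blast
        moreover have "nm (B v - B' v) \<le> nm (B v - op_poly sc (p n) T v) +
            (nm (op_poly sc (p n) T v - op_poly sc (p' n) T v) + nm (op_poly sc (p' n) T v - B' v))"
          using nm_triangle_mid[of "B v" "B' v" "op_poly sc (p n) T v"]
            nm_triangle_mid[of "op_poly sc (p n) T v" "B' v" "op_poly sc (p' n) T v"] by linarith
        ultimately have "nm (B v - B' v) \<le> 4 * (r * nm v)" by (simp add: op_poly_diff)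
        then show ?case using nv False by (simp add: r_def)
      qed
      then show ?thesis by simp
    qed
    then have "nm (B v - B' v) \<le> 0" using field_le_epsilon[of "nm (B v - B' v)" 0] by simp
    then have "nm (B v - B' v) = 0" using nm_nonneg[of "B v - B' v"] by linarith
    then show ?thesis by simp
  next
    case True
    \<comment> \<open>The approximation bound at the zero vector has right-hand side 0, for any
      single polynomial in the sequence.\<close>
    have "B 0 = 0" if "is_fun_calc sc ip T f B" for B :: "'a \<Rightarrow> 'a"
    proof -
      obtain p where "\<And>e. e > 0 \<Longrightarrow>
          \<forall>\<^sub>F n in sequentially. \<forall>v. nm (op_poly sc (p n) T v - B v) \<le> e * nm v"
        using \<open>is_fun_calc sc ip T f B\<close> unfolding is_fun_calc_def by blast
      from this[of 1] have "\<exists>n. \<forall>v. nm (op_poly sc (p n) T v - B v) \<le> 1 * nm v"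
        by (intro eventually_happens'[OF sequentially_bot]) simp
      then obtain n where "nm (op_poly sc (p n) T 0 - B 0) \<le> 1 * nm 0" by blast
      then show ?thesis using sym_op_zero[OF sym_op_op_poly[OF T_sym_op]] by simp
    qed
    from this[OF assms(1)] this[OF assms(2)] show ?thesis using True by simp
  qed
qed

lemma fun_calc_pointwise:
  assumes "is_fun_calc sc ip T f B"
  obtains p c where "\<And>v. nm (T v) \<le> c * nm v"
    "\<And>x. x \<in> {0..c} \<Longrightarrow> (\<lambda>n. poly (p n) x) \<longlonglongrightarrow> f x"
    "\<And>v. conv (\<lambda>n. op_poly sc (p n) T v) (B v)"
proof -
  obtain c p where 1: "\<And>v. nm (T v) \<le> c * nm v"
      "uniform_limit {0..c} (\<lambda>n. poly (p n)) f sequentially"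
      "\<And>e. e > 0 \<Longrightarrow> \<forall>\<^sub>F n in sequentially. \<forall>v. nm (op_poly sc (p n) T v - B v) \<le> e * nm v"
    using assms unfolding is_fun_calc_def by blast
  have "conv (\<lambda>n. op_poly sc (p n) T v) (B v)" for v
  proof (rule tendstoI)
    fix e :: real assume "e > 0"
    define r where "r = e / (nm v + 1)"
    have v1: "nm v + 1 > 0" by (simp add: add_nonneg_pos)
    then have r: "r > 0" using \<open>e > 0\<close> by (simp add: r_def)
    have "r * nm v < e"
      using \<open>e > 0\<close> v1 by (simp add: r_def pos_divide_less_eq mult_strict_left_mono)
    then show "\<forall>\<^sub>F n in sequentially. dist (nm (op_poly sc (p n) T v - B v)) 0 < e"
      using 1(3)[OF r] by (auto elim!: eventually_mono simp: dist_real_def intro: le_less_trans)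
  qed
  then show ?thesis using that 1(1) tendsto_uniform_limitI[OF 1(2)] by blast
qed

lemma fun_calc_sym_op:
  assumes "is_fun_calc sc ip T f B"
  shows "sym_op B"
proof -
  obtain p where p: "\<And>v. conv (\<lambda>n. op_poly sc (p n) T v) (B v)"
    using fun_calc_pointwise[OF assms] by metis
  note S = sym_op_op_poly[OF T_sym_op]
  show ?thesis unfolding sym_op_def
  proof (intro conjI allI)
    fix x y
    show "B (x + y) = B x + B y"
      by (rule conv_unique[OF p]) (use conv_add[OF p p] in \<open>simp add: sym_op_add[OF S]\<close>)
    show "B (sc a x) = sc a (B x)" for a
      by (rule conv_unique[OF p]) (use conv_scale[OF p] in \<open>simp add: sym_op_scale[OF S]\<close>)
    have "(\<lambda>n. cnj (ip y (op_poly sc (p n) T x))) \<longlonglongrightarrow> cnj (ip y (B x))"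
      by (intro tendsto_cnj conv_ip p)
    then have "(\<lambda>n. ip x (op_poly sc (p n) T y)) \<longlonglongrightarrow> ip (B x) y"
      by (simp flip: ip_commute add: sym_op_ip[OF S])
    then show "ip (B x) y = ip x (B y)"
      using conv_ip[OF p, of x y] LIMSEQ_unique by blast
  qed
qed

text \<open>On an eigenvector \<open>p(T)\<close> acts as the number \<open>p(t)\<close>, and a
  nonzero eigenvector forces \<open>t\<close> into \<open>[0, c]\<close>, where the polynomials
  converge to \<open>f\<close>. Powers of \<open>A\<close> and of \<open>M\<close> are computed in
  this way.\<close>

lemma fun_calc_eigenvector:
  assumes "is_fun_calc sc ip T f B" and v: "T v = sc (of_real t) v" and t: "0 \<le> t"
  shows "B v = sc (of_real (f t)) v"
proof (cases "v = 0")
  case True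
  then show ?thesis using sym_op_zero[OF fun_calc_sym_op[OF assms(1)]] by simp
next
  case False
  obtain p c where p: "\<And>v. nm (T v) \<le> c * nm v"
    "\<And>x. x \<in> {0..c} \<Longrightarrow> (\<lambda>n. poly (p n) x) \<longlonglongrightarrow> f x"
    "\<And>v. conv (\<lambda>n. op_poly sc (p n) T v) (B v)"
    using fun_calc_pointwise[OF assms(1)] by metis
  have "t * nm v \<le> c * nm v" using p(1)[of v] t by (simp add: v nm_scale)
  then have "t \<in> {0..c}" using t False nm_pos_iff[of v] by simp
  then have "(\<lambda>n. poly (p n) t) \<longlonglongrightarrow> f t" by (rule p(2))
  then have "(\<lambda>n. (poly (p n) t - f t)) \<longlonglongrightarrow> 0" by (rule LIM_zero)
  then have "(\<lambda>n. \<bar>poly (p n) t - f t\<bar> * nm v) \<longlonglongrightarrow> 0"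
    using tendsto_mult_right[OF tendsto_rabs, of _ 0 sequentially "nm v"] by simp
  moreover have "nm (op_poly sc (p n) T v - sc (of_real (f t)) v) = \<bar>poly (p n) t - f t\<bar> * nm v" for n
    by (simp add: op_poly_eigenvector[OF T_sym_op v] nm_scale flip: scale_left_diff_distrib of_real_diff)
  ultimately have "conv (\<lambda>n. op_poly sc (p n) T v) (sc (of_real (f t)) v)" by simp
  then show ?thesis by (rule conv_unique[OF p(3)])
qed

lemma bounded_power_fun_calc:
  assumes "s > 0"
  shows "is_fun_calc sc ip T (\<lambda>x. x powr s) (bounded_power sc ip T s)"
proof -
  have "continuous_on {0..} (\<lambda>x::real. x powr s)"
    using assms by (intro continuous_on_powr') (auto intro: continuous_intros)
  then have "\<exists>!B. is_fun_calc sc ip T (\<lambda>x. x powr s) B"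
    using fun_calc_exists fun_calc_unique by blast
  then show ?thesis unfolding bounded_power_def by (rule theI')
qed

lemmas bounded_power_sym_op = fun_calc_sym_op[OF bounded_power_fun_calc]
  and bounded_power_eigenvector = fun_calc_eigenvector[OF bounded_power_fun_calc]

end

section \<open>The inverse of a positive definite selfadjoint operator\<close>

context complex_hilbert_space
begin

text \<open>Positivity gives a lower bound, hence injectivity and a closed range. A vector
  orthogonal to the range belongs to the domain of the adjoint with image 0, so by selfadjointness
  to the kernel of \<open>A\<close>, which is trivial.\<close>

lemma selfadjoint_bij:
  assumes sa: "selfadjoint_operator sc ip D A" and pd: "positive_definite_operator ip D A"
  shows "bij_betw A D UNIV"
    and "\<exists>\<alpha>>0. \<forall>x\<in>D. \<alpha> * nm x \<le> nm (A x)"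
proof -
  have D: "subspace D" and A_add: "\<And>u v. u \<in> D \<Longrightarrow> v \<in> D \<Longrightarrow> A (u + v) = A u + A v"
    and A_scale: "\<And>c u. u \<in> D \<Longrightarrow> A (sc c u) = sc c (A u)"
    and graph: "adjoint_graph ip D A = {(v, A v) | v. v \<in> D}"
    using sa unfolding selfadjoint_operator_def linear_operator_def by auto
  \<comment> \<open>The half of selfadjointness that goes beyond symmetry: whatever satisfies the
    adjoint relation is already in the graph of \<open>A\<close>.\<close>
  have graphI: "v \<in> D \<and> w = A v" if "\<And>u. u \<in> D \<Longrightarrow> ip (A u) v = ip u w" for v w
  proof -
    have "(v, w) \<in> adjoint_graph ip D A" using that by (simp add: adjoint_graph_def)
    then show ?thesis unfolding graph by auto
  qed
  have sym: "ip (A u) v = ip u (A v)" if "u \<in> D" "v \<in> D" for u v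
  proof -
    have "(v, A v) \<in> adjoint_graph ip D A" unfolding graph using that by auto
    then show ?thesis using that by (simp add: adjoint_graph_def)
  qed
  obtain \<alpha> where \<alpha>: "\<alpha> > 0" "\<And>u. u \<in> D \<Longrightarrow> \<alpha> * (nm u)\<^sup>2 \<le> Re (ip (A u) u)"
    using pd unfolding positive_definite_operator_def by auto
  have below: "\<alpha> * nm u \<le> nm (A u)" if "u \<in> D" for u
  proof (cases "u = 0")
    case False
    have "\<alpha> * nm u * nm u \<le> nm (A u) * nm u"
      using \<alpha>(2)[OF that] Re_ip_le[of "A u" u] by (simp add: power2_eq_square)
    then show ?thesis using False nm_pos_iff[of u] by simp
  qed simp
  then show "\<exists>\<alpha>>0. \<forall>x\<in>D. \<alpha> * nm x \<le> nm (A x)" using \<alpha>(1) by blast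
  have A_diff: "A (u - v) = A u - A v" if "u \<in> D" "v \<in> D" for u v
    using A_add[of "u - v" v] that subspace_diff[OF D] by (simp add: eq_diff_eq)
  have inj: "inj_on A D"
  proof (rule inj_onI)
    fix u v assume uv: "u \<in> D" "v \<in> D" "A u = A v"
    have "\<alpha> * nm (u - v) \<le> nm (A (u - v))" by (rule below) (simp add: subspace_diff[OF D] uv)
    then have "\<alpha> * nm (u - v) \<le> 0" by (simp add: A_diff uv)
    then have "nm (u - v) = 0" using \<alpha>(1) nm_nonneg[of "u - v"] by (simp add: mult_le_0_iff)
    then show "u = v" by simp
  qed
  have range_subspace: "subspace (A ` D)"
    unfolding subspace_def
  proof (intro conjI ballI allI)
    show "0 \<in> A ` D" using A_scale[of 0 0] subspace_0[OF D] by (auto intro!: image_eqI[of _ _ 0])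
    fix x assume x: "x \<in> A ` D"
    then show "sc c x \<in> A ` D" for c
    proof -
      obtain v where v: "v \<in> D" "x = A v" using x by blast
      have "A (sc c v) \<in> A ` D" using v(1) by (intro imageI subspace_scale[OF D])
      then show ?thesis using v A_scale by simp
    qed
    fix y assume "y \<in> A ` D"
    with x obtain v w where v: "v \<in> D" "x = A v" "w \<in> D" "y = A w" by blast
    then have "A (v + w) \<in> A ` D" by (intro imageI subspace_add[OF D])
    then show "x + y \<in> A ` D" using v A_add by simp
  qed
  have range_closed: "L \<in> A ` D" if X: "\<forall>n. X n \<in> A ` D" and L: "conv X L" for X L
  proof -
    have "\<exists>w. w \<in> D \<and> X n = A w" for n using X by blast
    then obtain w where w: "\<And>n. w n \<in> D" "\<And>n. X n = A (w n)" by metis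
    have "nm (w m - w n) \<le> nm (X m - L) / \<alpha> + nm (X n - L) / \<alpha>" for m n
    proof -
      have "\<alpha> * nm (w m - w n) \<le> nm (X m - X n)"
        using below[of "w m - w n"] w by (simp add: A_diff subspace_diff[OF D])
      also have "\<dots> \<le> nm (X m - L) + nm (X n - L)"
        using nm_triangle_mid[of "X m" "X n" L] nm_minus_commute[of L] by simp
      finally show ?thesis using \<alpha>(1) by (simp add: field_simps)
    qed
    moreover have "(\<lambda>n. nm (X n - L) / \<alpha>) \<longlonglongrightarrow> 0"
      using tendsto_divide[OF L tendsto_const, of \<alpha>] \<alpha>(1) by simp
    ultimately obtain w0 where w0: "conv w w0" by (rule Cauchy_conv)
    \<comment> \<open>The limit pair \<open>(w0, L)\<close> satisfies the adjoint relation, so that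
      closedness of the graph comes from \<open>graphI\<close>.\<close>
    have "ip (A u) w0 = ip u L" if "u \<in> D" for u
    proof (rule LIMSEQ_unique)
      show "(\<lambda>n. ip (A u) (w n)) \<longlonglongrightarrow> ip (A u) w0" using w0 by (rule conv_ip)
      show "(\<lambda>n. ip (A u) (w n)) \<longlonglongrightarrow> ip u L"
        using conv_ip[OF L, of u] sym[OF that] w by simp
    qed
    then show ?thesis using graphI by blast
  qed
  have "x \<in> A ` D" for x
  proof -
    obtain y where y: "y \<in> A ` D" "\<And>s. s \<in> A ` D \<Longrightarrow> ip s (x - y) = 0"
      using orthogonal_decomposition[OF range_subspace] range_closed by metis
    have "ip (A u) (x - y) = ip u 0" if "u \<in> D" for u using y(2)[of "A u"] that by simp
    then have "x - y \<in> D \<and> 0 = A (x - y)" by (rule graphI)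
    then have "\<alpha> * nm (x - y) \<le> 0" using below[of "x - y"] by simp
    then have "nm (x - y) = 0" using \<alpha>(1) nm_nonneg[of "x - y"] by (simp add: mult_le_0_iff)
    then show ?thesis using y(1) by simp
  qed
  then show "bij_betw A D UNIV" using inj by (auto simp: bij_betw_def)
qed

lemma selfadjoint_inverse:
  assumes sa: "selfadjoint_operator sc ip D A" and pd: "positive_definite_operator ip D A"
  shows "positive_operator sc ip (op_inverse D A)"
    and "op_inverse D A x \<in> D" and "A (op_inverse D A x) = x"
    and "u \<in> D \<Longrightarrow> op_inverse D A (A u) = u"
proof -
  let ?T = "op_inverse D A"
  note bij = selfadjoint_bij(1)[OF sa pd]
  show T_D: "?T x \<in> D" for x using bij by (metis UNIV_I bij_betw_def inv_into_into)
  show A_T: "A (?T x) = x" for x using bij by (metis UNIV_I bij_betw_def f_inv_into_f)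
  show T_A: "?T (A u) = u" if "u \<in> D" for u
    using bij that by (simp add: bij_betw_def)
  have D: "subspace D" and A_add: "\<And>u v. u \<in> D \<Longrightarrow> v \<in> D \<Longrightarrow> A (u + v) = A u + A v"
    and A_scale: "\<And>c u. u \<in> D \<Longrightarrow> A (sc c u) = sc c (A u)"
    and graph: "adjoint_graph ip D A = {(v, A v) | v. v \<in> D}"
    using sa unfolding selfadjoint_operator_def linear_operator_def by auto
  have sym: "ip (A u) v = ip u (A v)" if "u \<in> D" "v \<in> D" for u v
  proof -
    have "(v, A v) \<in> adjoint_graph ip D A" unfolding graph using that by auto
    then show ?thesis using that by (simp add: adjoint_graph_def)
  qed
  obtain \<beta> where \<beta>: "\<beta> > 0" "\<And>u. u \<in> D \<Longrightarrow> \<beta> * (nm u)\<^sup>2 \<le> Re (ip (A u) u)"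
    using pd unfolding positive_definite_operator_def by auto
  obtain \<alpha> where \<alpha>: "\<alpha> > 0" "\<And>u. u \<in> D \<Longrightarrow> \<alpha> * nm u \<le> nm (A u)"
    using selfadjoint_bij(2)[OF sa pd] by blast
  show "positive_operator sc ip ?T"
  proof
    show "sym_op ?T"
      unfolding sym_op_def
    proof (intro conjI allI)
      fix x y
      show "?T (x + y) = ?T x + ?T y"
        using T_A[of "?T x + ?T y"] subspace_add[OF D T_D T_D] by (simp add: A_add T_D A_T)
      show "?T (sc a x) = sc a (?T x)" for a
        using T_A[of "sc a (?T x)"] subspace_scale[OF D T_D] by (simp add: A_scale T_D A_T)
      show "ip (?T x) y = ip x (?T y)" using sym[OF T_D T_D, of x y] by (simp add: A_T)
    qed
    show "0 \<le> Re (ip (?T x) x)" for x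
    proof -
      have "0 \<le> \<beta> * (nm (?T x))\<^sup>2" using \<beta>(1) by simp
      also have "\<dots> \<le> Re (ip x (?T x))" using \<beta>(2)[OF T_D, of x] by (simp add: A_T)
      finally show ?thesis by (simp add: Re_ip_commute)
    qed
    show "x = 0" if "?T x = 0" for x
      using that A_T[of x] A_scale[OF T_D, of 0 x] by simp
    show "\<exists>c. \<forall>x. nm (?T x) \<le> c * nm x"
      using \<alpha>(2)[OF T_D] \<alpha>(1) by (intro exI[of _ "1 / \<alpha>"]) (simp add: A_T field_simps)
  qed
qed

lemma eigenspace_iff_inverse:
  assumes sa: "selfadjoint_operator sc ip D A" and pd: "positive_definite_operator ip D A"
    and s: "s \<noteq> 0"
  shows "u \<in> eigenspace sc D A (of_real s) \<longleftrightarrow> op_inverse D A u = sc (of_real (1 / s)) u"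
proof -
  interpret positive_operator sc ip "op_inverse D A" by (rule selfadjoint_inverse(1)[OF sa pd])
  show ?thesis
  proof
    assume "u \<in> eigenspace sc D A (of_real s)"
    then have "op_inverse D A (sc (of_real s) u) = u"
      using selfadjoint_inverse(4)[OF sa pd, of u] by (simp add: eigenspace_def)
    then have "sc (of_real (1 / s)) (sc (of_real s) (op_inverse D A u)) = sc (of_real (1 / s)) u"
      by (simp only: T_scale)
    then show "op_inverse D A u = sc (of_real (1 / s)) u" using s by simp
  next
    assume "op_inverse D A u = sc (of_real (1 / s)) u"
    then have "op_inverse D A (sc (of_real s) u) = u" using s by (simp add: T_scale)
    then show "u \<in> eigenspace sc D A (of_real s)"
      using selfadjoint_inverse(2,3)[OF sa pd, of "sc (of_real s) u"] by (simp add: eigenspace_def)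
  qed
qed

end

section \<open>Eigenvector bases\<close>

context complex_hilbert_space
begin

lemma ip_span_zero:
  assumes "x \<in> span S" "\<And>s. s \<in> S \<Longrightarrow> ip s v = 0" shows "ip x v = 0"
  using assms(1)
proof (induction rule: span_induct_alt)
  case (step c s y)
  then show ?case using assms(2) by (simp add: ip_simps)
qed simp

end

text \<open>Totality is put as the absence of a nonzero orthogonal vector, the form in which
  compactness delivers it; convergence of expansions is derived in
  \<open>trunc_conv\<close>.\<close>

locale orthonormal_basis = complex_hilbert_space sc ip
  for sc :: "complex \<Rightarrow> 'a::ab_group_add \<Rightarrow> 'a" and ip +
  fixes q :: "nat \<Rightarrow> 'a"
  assumes orthonormal: "orthonormal_on {1..} q"
    and total: "(\<And>k. 1 \<le> k \<Longrightarrow> ip (q k) v = 0) \<Longrightarrow> v = 0"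
begin

definition trunc :: "nat \<Rightarrow> 'a \<Rightarrow> 'a" where
  "trunc n x = (\<Sum>k=1..n. sc (ip (q k) x) (q k))"

lemma trunc_zero: "trunc n 0 = 0"
  by (simp add: trunc_def)

lemma trunc_add: "trunc n (x + y) = trunc n x + trunc n y"
  by (simp add: trunc_def ip_add_right scale_left_distrib sum.distrib)

lemma trunc_scale: "trunc n (sc a x) = sc a (trunc n x)"
  by (simp add: trunc_def ip_scale_right scale_sum_right)

lemma trunc_diff: "trunc n (x - y) = trunc n x - trunc n y"
  by (simp add: trunc_def ip_diff_right scale_left_diff_distrib sum_subtractf)

lemma trunc_sum: "trunc n (\<Sum>i\<in>I. f i) = (\<Sum>i\<in>I. trunc n (f i))"
  by (induction I rule: infinite_finite_induct) (auto simp: trunc_add trunc_zero)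

lemma trunc_id: "trunc n (\<Sum>k=1..n. sc (a k) (q k)) = (\<Sum>k=1..n. sc (a k) (q k))"
  unfolding trunc_def
  by (rule sum.cong) (auto simp: ip_orthonormal_sum[OF orthonormal])

lemma ip_trunc:
  assumes "1 \<le> k" shows "ip (q k) (trunc n x) = (if k \<le> n then ip (q k) x else 0)"
  unfolding trunc_def using assms by (subst ip_orthonormal_sum[OF orthonormal]) auto

lemma nm_trunc_sq: "(nm (trunc n x))\<^sup>2 = (\<Sum>k=1..n. (cmod (ip (q k) x))\<^sup>2)"
  unfolding trunc_def by (rule nm_orthonormal_sum[OF orthonormal]) auto

lemma trunc_Pythagoras: "(nm x)\<^sup>2 = (nm (trunc n x))\<^sup>2 + (nm (x - trunc n x))\<^sup>2"
proof -
  have "ip (trunc n x) (x - trunc n x) =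
      (\<Sum>k=1..n. cnj (ip (q k) x) * ip (q k) (x - trunc n x))"
    by (subst trunc_def) (simp only: ip_sum_left ip_scale_left)
  also have "\<dots> = 0"
    by (rule sum.neutral) (simp add: ip_diff_right ip_trunc)
  finally have "ip (trunc n x) (x - trunc n x) = 0" .
  then show ?thesis using nm_add_sq[of "trunc n x" "x - trunc n x"] by simp
qed

lemma nm_trunc_le: "nm (trunc n x) \<le> nm x"
  using trunc_Pythagoras[of x n] by (intro power2_le_imp_le[OF _ nm_nonneg]) simp

text \<open>Applied with the factor \<open>mu (n + 1) powr \<tau>\<close>, this becomes the inverse
  inequality between the norms of \<open>D(M\<^sup>\<tau>)\<close> and \<open>G\<^sub>0\<close> on
  the span of the first \<open>n\<close> trial vectors.\<close>

lemma nm_trunc_mono: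
  assumes dom: "\<And>k. k \<in> {1..n} \<Longrightarrow> cmod (ip (q k) x) \<le> \<kappa> * cmod (ip (q k) z)" and \<kappa>: "0 \<le> \<kappa>"
  shows "nm (trunc n x) \<le> \<kappa> * nm z"
proof -
  have "(nm (trunc n x))\<^sup>2 \<le> (\<Sum>k=1..n. (\<kappa> * cmod (ip (q k) z))\<^sup>2)"
    unfolding nm_trunc_sq by (intro sum_mono power_mono dom) auto
  also have "\<dots> = (\<kappa> * nm (trunc n z))\<^sup>2"
    by (simp only: power_mult_distrib nm_trunc_sq sum_distrib_left)
  finally have "nm (trunc n x) \<le> \<kappa> * nm (trunc n z)" by (rule power2_le_imp_le) (simp add: \<kappa>)
  also have "\<dots> \<le> \<kappa> * nm z" by (intro mult_left_mono nm_trunc_le \<kappa>)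
  finally show ?thesis .
qed

lemma trunc_diff_sq:
  assumes "n \<le> m"
  shows "(nm (trunc m x - trunc n x))\<^sup>2 = (\<Sum>k=n+1..m. (cmod (ip (q k) x))\<^sup>2)"
proof -
  obtain p where m: "m = n + p" using le_Suc_ex[OF assms] by blast
  have "trunc m x - trunc n x = (\<Sum>k=n+1..m. sc (ip (q k) x) (q k))"
    unfolding trunc_def m by (subst sum.ub_add_nat) auto
  then show ?thesis using nm_orthonormal_sum[OF orthonormal, of "{n+1..m}"] by auto
qed

text \<open>Bessel's inequality makes the truncations Cauchy; their limit has the coefficients of
  \<open>x\<close>, so totality identifies it with \<open>x\<close>.\<close>

lemma trunc_conv: "conv (\<lambda>n. trunc n x) x"
proof -
  define s where "s n = (\<Sum>k=1..n. (cmod (ip (q k) x))\<^sup>2)" for n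
  have s_diff: "(nm (trunc m x - trunc n x))\<^sup>2 = s m - s n" if "n \<le> m" for m n
  proof -
    show ?thesis
      using sum.ub_add_nat[of 1 n "\<lambda>k. (cmod (ip (q k) x))\<^sup>2" "m - n"] that
      unfolding trunc_diff_sq[OF that] s_def by simp
  qed
  have "incseq s" by (rule incseq_SucI) (simp add: s_def)
  moreover have "s n \<le> (nm x)\<^sup>2" for n
    unfolding s_def nm_trunc_sq[symmetric] by (intro power_mono nm_trunc_le nm_nonneg)
  ultimately obtain S where S: "s \<longlonglongrightarrow> S" "\<And>n. s n \<le> S"
    by (metis incseq_convergent)
  have "nm (trunc m x - trunc n x) \<le> sqrt (S - s m) + sqrt (S - s n)" if "n \<le> m" for m n
  proof -
    have "nm (trunc m x - trunc n x) = sqrt (s m - s n)"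
      unfolding s_diff[OF that, symmetric] by simp
    also have "\<dots> \<le> sqrt (S - s n)" using S(2)[of m] by simp
    also have "\<dots> \<le> sqrt (S - s m) + sqrt (S - s n)" using S(2)[of m] by simp
    finally show ?thesis .
  qed
  then have "nm (trunc m x - trunc n x) \<le> sqrt (S - s m) + sqrt (S - s n)" for m n
    by (metis add.commute nle_le nm_minus_commute)
  moreover have "(\<lambda>n. sqrt (S - s n)) \<longlonglongrightarrow> 0"
    using tendsto_real_sqrt[OF tendsto_diff[OF tendsto_const S(1)], of S] by simp
  ultimately obtain y where y: "conv (\<lambda>n. trunc n x) y" by (rule Cauchy_conv)
  have "ip (q k) (y - x) = 0" if k: "1 \<le> k" for k
  proof -
    have "\<forall>\<^sub>F n in sequentially. ip (q k) (trunc n x) = ip (q k) x"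
      using eventually_ge_at_top[of k] by eventually_elim (simp add: ip_trunc[OF k])
    then have "(\<lambda>n. ip (q k) (trunc n x)) \<longlonglongrightarrow> ip (q k) x" by (rule tendsto_eventually)
    then show ?thesis using conv_ip[OF y, of "q k"] LIMSEQ_unique by (auto simp: ip_diff_right)
  qed
  then have "y = x" using total[of "y - x"] by simp
  then show ?thesis using y by simp
qed

lemma trunc_error_tendsto_0: "(\<lambda>n. nm (x - trunc n x)) \<longlonglongrightarrow> 0"
  using trunc_conv[of x] by (simp only: nm_minus_commute[of x])

text \<open>The counterpart of \<open>nm_trunc_mono\<close> for tails, obtained by comparing finite
  blocks of coefficients and passing to the limit. It converts smoothness, a decay of coefficients,
  into a rate.\<close>

lemma trunc_error_mono:
  assumes dom: "\<And>k. n < k \<Longrightarrow> cmod (ip (q k) x) \<le> \<kappa> * cmod (ip (q k) z)" and \<kappa>: "0 \<le> \<kappa>"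
  shows "nm (x - trunc n x) \<le> \<kappa> * nm (z - trunc n z)"
proof (rule LIMSEQ_le)
  show "(\<lambda>m. nm (trunc m x - trunc n x)) \<longlonglongrightarrow> nm (x - trunc n x)"
    using trunc_conv by (rule conv_dist)
  show "(\<lambda>m. \<kappa> * nm (trunc m z - trunc n z)) \<longlonglongrightarrow> \<kappa> * nm (z - trunc n z)"
    using conv_dist[OF trunc_conv] by (intro tendsto_mult_left)
  have "nm (trunc m x - trunc n x) \<le> \<kappa> * nm (trunc m z - trunc n z)" if "n \<le> m" for m
  proof (rule power2_le_imp_le)
    have "(\<Sum>k=n+1..m. (cmod (ip (q k) x))\<^sup>2) \<le> (\<Sum>k=n+1..m. \<kappa>\<^sup>2 * (cmod (ip (q k) z))\<^sup>2)"
    proof (rule sum_mono)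
      fix k assume "k \<in> {n+1..m}"
      then have "(cmod (ip (q k) x))\<^sup>2 \<le> (\<kappa> * cmod (ip (q k) z))\<^sup>2"
        using dom[of k] by (intro power_mono) auto
      then show "(cmod (ip (q k) x))\<^sup>2 \<le> \<kappa>\<^sup>2 * (cmod (ip (q k) z))\<^sup>2" by (simp add: power_mult_distrib)
    qed
    then show "(nm (trunc m x - trunc n x))\<^sup>2 \<le> (\<kappa> * nm (trunc m z - trunc n z))\<^sup>2"
      by (simp only: trunc_diff_sq[OF that] power_mult_distrib sum_distrib_left)
  qed (simp add: \<kappa>)
  then show "\<exists>N. \<forall>m\<ge>N. nm (trunc m x - trunc n x) \<le> \<kappa> * nm (trunc m z - trunc n z)" by blast
qed

end

section \<open>Completeness of the eigenvectors of a compact positive operator\<close>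

context positive_operator
begin

lemma T_form_pos: assumes "x \<noteq> 0" shows "0 < Re (ip (T x) x)"
proof -
  obtain c where c: "\<And>x. nm (T x) \<le> c * nm x" using T_bounded by blast
  have "c > 0" using T_bound_pos[OF assms c] .
  have "T x \<noteq> 0" using T_inj assms by blast
  then have "0 < (nm (T x))\<^sup>2" using nm_pos_iff[of "T x"] by simp
  also have "\<dots> \<le> c * Re (ip (T x) x)" by (rule T_nm_sq_le[OF \<open>c > 0\<close> c])
  finally show ?thesis using \<open>c > 0\<close> by (simp add: zero_less_mult_iff)
qed

lemma form_sup:
  assumes scale: "\<And>a x. x \<in> W \<Longrightarrow> sc a x \<in> W" and "x0 \<in> W" "x0 \<noteq> 0"
  obtains m where "\<And>x. x \<in> W \<Longrightarrow> Re (ip (T x) x) \<le> m * (nm x)\<^sup>2"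
    and "\<And>e. e > 0 \<Longrightarrow> \<exists>x\<in>W. nm x = 1 \<and> m - e < Re (ip (T x) x)"
proof -
  obtain c where c: "\<And>x. nm (T x) \<le> c * nm x" using T_bounded by blast
  define R where "R = (\<lambda>x. Re (ip (T x) x)) ` {x \<in> W. nm x = 1}"
  have "Re (ip (T x) x) \<le> c" if "nm x = 1" for x
    using T_form_le[OF c, of x] that by simp
  then have bdd: "bdd_above R" unfolding R_def by (intro bdd_aboveI[of _ c]) auto
  have normalized: "nm (sc (of_real (1 / nm x)) x) = 1"
    and form_normalized: "Re (ip (T (sc (of_real (1 / nm x)) x)) (sc (of_real (1 / nm x)) x)) =
      Re (ip (T x) x) / (nm x)\<^sup>2" if "x \<noteq> 0" for x
    using that by (auto simp: nm_scale T_scale ip_simps power2_eq_square norm_divide)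
  have upper: "Re (ip (T x) x) \<le> Sup R * (nm x)\<^sup>2" if "x \<in> W" for x
  proof (cases "x = 0")
    case False
    have "Re (ip (T x) x) / (nm x)\<^sup>2 \<in> R"
      using scale[OF that] normalized[OF False] form_normalized[OF False] unfolding R_def
      by (metis (mono_tags, lifting) image_eqI mem_Collect_eq)
    then have "Re (ip (T x) x) / (nm x)\<^sup>2 \<le> Sup R" by (rule cSup_upper[OF _ bdd])
    then show ?thesis using False by (simp add: pos_divide_le_eq nm_pos_iff)
  qed (simp add: T_zero)
  have "R \<noteq> {}" using scale[OF assms(2)] normalized[OF assms(3)] unfolding R_def by blast
  then have "\<exists>x\<in>W. nm x = 1 \<and> Sup R - e < Re (ip (T x) x)" if "e > 0" for e
    using less_cSupD[of R "Sup R - e"] that by (auto simp: R_def)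
  with upper show ?thesis using that by blast
qed

text \<open>Otherwise the form of \<open>T\<close>, restricted to the orthogonal complement of the
  eigenvectors, attains its maximum on the unit sphere, at a further eigenvector.\<close>

lemma compact_eigenvectors_total:
  assumes compact: "compact_operator ip T"
    and eig: "\<And>k. 1 \<le> k \<Longrightarrow> T (q k) = sc (of_real (t k)) (q k)"
    and full: "\<And>m y. 0 < m \<Longrightarrow> T y = sc (of_real m) y \<Longrightarrow> y \<in> span (q ` {1..})"
    and v: "\<And>k. 1 \<le> k \<Longrightarrow> ip (q k) v = 0"
  shows "v = 0"
proof (rule ccontr)
  assume v0: "v \<noteq> 0"
  define W where "W = {x. \<forall>k\<ge>1. ip (q k) x = 0}"
  have T_W: "T x \<in> W" if "x \<in> W" for x
    using that eig by (auto simp: W_def ip_scale_left simp flip: T_sym)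
  have scale_W: "sc a x \<in> W" if "x \<in> W" for a x
    using that by (auto simp: W_def ip_scale_right)
  obtain c where c: "\<And>x. nm (T x) \<le> c * nm x" using T_bounded by blast
  have vW: "v \<in> W" using v by (simp add: W_def)
  obtain m where upper: "\<And>x. x \<in> W \<Longrightarrow> Re (ip (T x) x) \<le> m * (nm x)\<^sup>2"
    and sup: "\<And>e. e > 0 \<Longrightarrow> \<exists>x\<in>W. nm x = 1 \<and> m - e < Re (ip (T x) x)"
    using form_sup[of W, OF scale_W vW v0] by blast
  have "0 < m * (nm v)\<^sup>2" using T_form_pos[OF v0] upper[OF vW] by linarith
  then have m: "m > 0" by (simp add: zero_less_mult_iff)
  have "\<exists>x. x \<in> W \<and> nm x = 1 \<and> m - inverse (real (Suc n)) < Re (ip (T x) x)" for n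
    using sup[of "inverse (real (Suc n))"] by auto
  then obtain X where X: "\<And>n. X n \<in> W" "\<And>n. nm (X n) = 1"
      "\<And>n. m - inverse (real (Suc n)) < Re (ip (T (X n)) (X n))"
    by metis
  obtain r L where r: "strict_mono r" and L: "conv (\<lambda>n. T (X (r n))) L"
    using compact X(2) unfolding compact_operator_def by (metis order_refl)
  let ?mX = "\<lambda>n. sc (of_real m) (X (r n))"
  \<comment> \<open>On the invariant set \<open>W\<close> the form of \<open>T\<close> lies between
    0 and \<open>m\<close> times the squared norm, hence \<open>T\<^sup>2 \<le> m T\<close> there. A
    maximizing sequence of unit vectors is thus one of approximate eigenvectors.\<close>
  have "nm (T x - sc (of_real m) x) \<le> sqrt (m * (m - Re (ip (T x) x)))" if "x \<in> W" "nm x = 1" for x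
  proof (rule real_le_rsqrt)
    have "(nm (T x))\<^sup>2 \<le> m * Re (ip (T x) x)"
      using m upper[OF T_W[OF that(1)]] by (intro nm_sq_le_form[OF T_sym_op]) (auto intro: T_pos)
    then show "(nm (T x - sc (of_real m) x))\<^sup>2 \<le> m * (m - Re (ip (T x) x))"
      using m that(2) unfolding nm_diff_sq
      by (simp add: nm_scale ip_scale_right power2_eq_square algebra_simps)
  qed
  moreover have "m * (m - Re (ip (T (X n)) (X n))) \<le> m * inverse (real (Suc n))" for n
    using X(3)[of n] m by (intro mult_left_mono) auto
  ultimately have bound: "nm (T (X n) - sc (of_real m) (X n)) \<le> sqrt (m * inverse (real (Suc n)))" for n
    using X(1,2) by (meson order_trans real_sqrt_le_mono)
  have "(\<lambda>n. sqrt (m * inverse (real (Suc n)))) \<longlonglongrightarrow> 0"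
    using tendsto_real_sqrt[OF tendsto_mult_left[OF LIMSEQ_inverse_real_of_nat, of m]] by simp
  then have "conv (\<lambda>n. T (X n) - sc (of_real m) (X n)) 0"
    by (rule Lim_null_comparison[rotated]) (use bound in \<open>simp add: always_eventually\<close>)
  \<comment> \<open>Writing \<open>m X = T X - (T X - m X)\<close>, convergence of the images and of
    the residuals gives convergence of the maximizing subsequence, scaled by
    \<open>m\<close>.\<close>
  then have "conv (\<lambda>n. T (X (r n)) + sc (- 1) (T (X (r n)) - ?mX n)) (L + sc (- 1) 0)"
    by (intro conv_add conv_scale L conv_subseq[OF _ r, of "\<lambda>n. T (X n) - sc (of_real m) (X n)"])
  then have mX: "conv ?mX L" by simp
  have "conv (\<lambda>n. T (?mX n)) (T L)" by (rule conv_linear_image[OF mX c T_diff])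
  moreover have "conv (\<lambda>n. sc (of_real m) (T (X (r n)))) (sc (of_real m) L)"
    by (rule conv_scale[OF L])
  ultimately have "T L = sc (of_real m) L" using conv_unique by (simp add: T_scale)
  then have "L \<in> span (q ` {1..})" by (rule full[OF m])
  moreover have "ip s L = 0" if "s \<in> q ` {1..}" for s
    using conv_ip[OF mX, of s] X(1) that LIMSEQ_unique[OF tendsto_const, of 0]
    by (auto simp: ip_scale_right W_def)
  ultimately have "ip L L = 0" by (rule ip_span_zero)
  then have "L = 0" by (simp add: ip_self)
  moreover have "(\<lambda>n. nm (?mX n)) \<longlonglongrightarrow> nm L" using mX by (rule conv_nm)
  ultimately have "(\<lambda>n. m) \<longlonglongrightarrow> 0" using m X(2) by (simp add: nm_scale)
  then show False using m LIMSEQ_unique[OF tendsto_const] by force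
qed

end

section \<open>Isolated points of the spectrum\<close>

context complex_hilbert_space
begin

lemma sym_op_shift_minus:
  assumes "sym_op S" shows "sym_op (\<lambda>x. sc (of_real r) x - S x)"
  unfolding sym_op_def
  by (auto simp: sym_op_add[OF assms] sym_op_scale[OF assms] sym_op_ip[OF assms]
      scale_right_distrib scale_right_diff_distrib ip_simps algebra_simps)

text \<open>If \<open>d = inf \<parallel>S x\<parallel>\<^sup>2 / \<parallel>x\<parallel>\<^sup>2\<close> then \<open>S\<^sup>2 - d\<close> is not bounded below, hence neither are both of
  \<open>S \<plusminus> \<surd>d\<close>.\<close>

lemma bounded_below_of_gap:
  assumes S: "sym_op S" and bound: "\<And>x. nm (S x) \<le> C * nm x"
    and gap: "\<And>r. \<bar>r\<bar> < h \<Longrightarrow> \<exists>\<kappa>>0. \<forall>x. \<kappa> * nm x \<le> nm (S x - sc (of_real r) x)"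
  shows "h * nm v \<le> nm (S v)"
proof (rule ccontr)
  assume nle: "\<not> h * nm v \<le> nm (S v)"
  then have v0: "v \<noteq> 0" using sym_op_zero[OF S] by auto
  define B where "B = max C 1"
  have B: "B > 0" "nm (S x) \<le> B * nm x" for x
    using bound[of x] mult_right_mono[of C B "nm x"] by (auto simp: B_def)
  define R where "R = (\<lambda>x. (nm (S x))\<^sup>2) ` {x. nm x = 1}"
  define d where "d = Inf R"
  have bdd: "bdd_below R" unfolding R_def by (rule bdd_belowI2[of _ 0]) simp
  have normalized: "nm (sc (of_real (1 / nm x)) x) = 1"
      "(nm (S (sc (of_real (1 / nm x)) x)))\<^sup>2 = (nm (S x))\<^sup>2 / (nm x)\<^sup>2" if "x \<noteq> 0" for x
    using that by (auto simp: nm_scale sym_op_scale[OF S] norm_divide power_divide)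
  have R: "(nm (S x))\<^sup>2 / (nm x)\<^sup>2 \<in> R" if "x \<noteq> 0" for x
    using normalized[OF that] unfolding R_def by (metis (mono_tags, lifting) image_eqI mem_Collect_eq)
  have lower: "d * (nm x)\<^sup>2 \<le> (nm (S x))\<^sup>2" for x
  proof (cases "x = 0")
    case False
    have "d \<le> (nm (S x))\<^sup>2 / (nm x)\<^sup>2" unfolding d_def by (rule cInf_lower[OF R[OF False] bdd])
    then show ?thesis using False by (simp add: pos_le_divide_eq nm_pos_iff)
  qed simp
  have d0: "0 \<le> d" unfolding d_def by (rule cInf_greatest) (use R[OF v0] in \<open>auto simp: R_def\<close>)
  define r where "r = sqrt d"
  have rd: "r * r = d" "0 \<le> r" using d0 by (auto simp: r_def)
  have "r * nm v \<le> nm (S v)"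
    by (rule power2_le_imp_le) (use lower[of v] rd in \<open>auto simp: power2_eq_square mult_ac\<close>)
  then have "r * nm v < h * nm v" using nle by linarith
  then have "r < h" using v0 nm_pos_iff[of v] by (simp add: mult_less_cancel_right)
  \<comment> \<open>Failure of the claim at \<open>v\<close> forces \<open>r < h\<close>, so the
    hypothesis covers both \<open>r\<close> and \<open>- r\<close>.\<close>
  then obtain \<kappa>1 \<kappa>2 where \<kappa>: "\<kappa>1 > 0" "\<And>x. \<kappa>1 * nm x \<le> nm (S x - sc (of_real r) x)"
      "\<kappa>2 > 0" "\<And>x. \<kappa>2 * nm x \<le> nm (S x - sc (of_real (- r)) x)"
    using gap[of r] gap[of "- r"] rd(2) by auto
  \<comment> \<open>\<open>K = (S + r) (S - r)\<close> is bounded below as a composition of two such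
    operators, while its form is nonnegative by the choice of \<open>d\<close>. By
    \<open>nm_sq_le_form\<close> that form is then bounded below as well.\<close>
  define K where "K x = S (S x) - sc (of_real d) x" for x
  have K: "sym_op K" unfolding K_def by (intro sym_op_shift sym_op_twice S)
  have K_form: "Re (ip (K x) x) = (nm (S x))\<^sup>2 - d * (nm x)\<^sup>2" for x
    by (simp add: K_def ip_simps sym_op_ip[OF S] nm_sq)
  have K_below: "\<kappa>2 * \<kappa>1 * nm x \<le> nm (K x)" for x
  proof -
    define y where "y = S x - sc (of_real r) x"
    have "K x = S y - sc (of_real (- r)) y"
      by (simp add: K_def y_def sym_op_diff[OF S] sym_op_scale[OF S] scale_right_diff_distrib
          flip: rd(1))
    moreover have "\<kappa>2 * (\<kappa>1 * nm x) \<le> \<kappa>2 * nm y" using \<kappa>(2)[of x] \<kappa>(3) by (simp add: y_def)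
    ultimately show ?thesis using \<kappa>(4)[of y] by simp
  qed
  have K_sq: "(nm (K x))\<^sup>2 \<le> B\<^sup>2 * Re (ip (K x) x)" for x
  proof (rule nm_sq_le_form[OF K])
    show "0 < B\<^sup>2" using B(1) by simp
    show "0 \<le> Re (ip (K y) y)" for y using lower[of y] by (simp add: K_form)
    have "(nm (S y))\<^sup>2 \<le> (B * nm y)\<^sup>2" for y using B(2)[of y] by (intro power_mono) auto
    then show "Re (ip (K y) y) \<le> B\<^sup>2 * (nm y)\<^sup>2" for y
      unfolding K_form using d0 by (smt (verit) power_mult_distrib mult_nonneg_nonneg zero_le_power2)
  qed
  \<comment> \<open>The amount by which the lower bound of \<open>K\<close> raises the infimum above
    \<open>d\<close>, a contradiction.\<close>
  define \<epsilon> where "\<epsilon> = (\<kappa>2 * \<kappa>1 / B)\<^sup>2"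
  have "\<epsilon> > 0" using \<kappa>(1,3) B(1) by (simp add: \<epsilon>_def)
  have "d + \<epsilon> \<le> (nm (S x))\<^sup>2" if "nm x = 1" for x
  proof -
    have "(\<kappa>2 * \<kappa>1)\<^sup>2 \<le> (nm (K x))\<^sup>2" using K_below[of x] that \<kappa>(1,3) by (intro power_mono) auto
    also have "\<dots> \<le> B\<^sup>2 * ((nm (S x))\<^sup>2 - d)" using K_sq[of x] that by (simp add: K_form)
    finally have "(\<kappa>2 * \<kappa>1)\<^sup>2 / B\<^sup>2 \<le> (nm (S x))\<^sup>2 - d" using B(1) by (simp add: divide_le_eq mult.commute)
    then show ?thesis by (simp add: \<epsilon>_def power_divide)
  qed
  then have "d + \<epsilon> \<le> Inf R" by (intro cInf_greatest) (use R[OF v0] in \<open>auto simp: R_def\<close>)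
  then show False using \<open>\<epsilon> > 0\<close> by (simp add: d_def)
qed

text \<open>The iterates \<open>x\<^sub>n = (I - N / c)\<^sup>n x\<close> tend to a null vector of \<open>N\<close>, hence to 0. Along them the
  form of \<open>N\<close> decays geometrically, and its sum controls the total loss of \<open>\<parallel>x\<^sub>n\<parallel>\<^sup>2\<close>.\<close>

lemma form_gap_of_injective:
  assumes N: "sym_op N" and W: "subspace W" "\<And>X L. \<forall>n. X n \<in> W \<Longrightarrow> conv X L \<Longrightarrow> L \<in> W"
      "\<And>x. x \<in> W \<Longrightarrow> N x \<in> W"
    and c: "c > 0" "\<And>x. nm (N x) \<le> c * nm x"
    and pos: "\<And>x. x \<in> W \<Longrightarrow> 0 \<le> Re (ip (N x) x)"
    and \<delta>: "\<delta> > 0" "\<And>x. x \<in> W \<Longrightarrow> \<delta> * Re (ip (N x) x) \<le> (nm (N x))\<^sup>2"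
    and inj: "\<And>x. x \<in> W \<Longrightarrow> N x = 0 \<Longrightarrow> x = 0"
    and x: "x \<in> W"
  shows "\<delta> * (nm x)\<^sup>2 \<le> 2 * Re (ip (N x) x)"
proof (cases "x = 0")
  case False
  define F where "F y = Re (ip (N y) y)" for y
  define S where "S y = y - sc (of_real (1/c)) (N y)" for y
  define X where "X n = (S ^^ n) x" for n
  have S_W: "S y \<in> W" if "y \<in> W" for y
    unfolding S_def using W(1,3) that by (intro subspace_diff subspace_scale)
  have X_W: "X n \<in> W" for n by (induction n) (auto simp: X_def x S_W)
  have N_le: "F y \<le> c * (nm y)\<^sup>2" for y
    using Re_ip_le[of "N y" y] mult_right_mono[OF c(2)[of y], of "nm y"]
    by (simp add: F_def power2_eq_square)
  have N_sq: "(nm (N y))\<^sup>2 \<le> c * F y" if "y \<in> W" for y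
    unfolding F_def
    by (rule nm_sq_le_form[OF N c(1)])
      (use that pos S_W[OF that] N_le[of "N y"] in \<open>auto simp: S_def F_def\<close>)
  have F0: "0 \<le> F y" if "y \<in> W" for y using pos[OF that] by (simp add: F_def)
  have Fx: "F x > 0"
  proof (rule ccontr)
    assume "\<not> F x > 0"
    then have "(nm (N x))\<^sup>2 \<le> 0" using N_sq[OF x] F0[OF x] by simp
    then show False using inj[OF x] False by simp
  qed
  \<comment> \<open>The decay factor of the form under one step of the iteration. It is nonnegative
    because \<open>\<delta> \<le> c\<close>, which is read off at \<open>x\<close>, where the form
    is positive.\<close>
  define \<rho> where "\<rho> = 1 - \<delta> / c"
  have "\<delta> * F x \<le> c * F x" using \<delta>(2)[OF x] N_sq[OF x] by (simp add: F_def)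
  then have \<rho>: "0 \<le> \<rho>" "\<rho> < 1" using Fx c(1) \<delta>(1) by (auto simp: \<rho>_def)
  have F_S: "F (S y) \<le> \<rho> * F y" if "y \<in> W" for y
  proof -
    have "F (S y) = F y - 2 * (nm (N y))\<^sup>2 / c + F (N y) / c\<^sup>2"
      unfolding F_def S_def nm_sq using Re_ip_commute[of "N y" "N y"]
      by (simp add: sym_op_diff[OF N] sym_op_scale[OF N] ip_simps sym_op_ip[OF N]
          power2_eq_square algebra_simps)
    also have "F (N y) / c\<^sup>2 \<le> c * (nm (N y))\<^sup>2 / c\<^sup>2" by (intro divide_right_mono N_le) simp
    also have "c * (nm (N y))\<^sup>2 / c\<^sup>2 = (nm (N y))\<^sup>2 / c" using c(1) by (simp add: power2_eq_square)
    finally have "F (S y) \<le> F y - (nm (N y))\<^sup>2 / c" by simp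
    also have "\<dots> \<le> F y - \<delta> * F y / c"
      using \<delta>(2)[OF that] c(1) by (simp add: F_def divide_right_mono)
    finally show ?thesis by (simp add: \<rho>_def algebra_simps)
  qed
  have F_X: "F (X n) \<le> \<rho> ^ n * F x" for n
  proof (induction n)
    case (Suc n)
    have "F (X (Suc n)) \<le> \<rho> * F (X n)" using F_S[OF X_W] by (simp add: X_def)
    also have "\<dots> \<le> \<rho> * (\<rho> ^ n * F x)" using Suc \<rho>(1) by (rule mult_left_mono)
    finally show ?case by simp
  qed (simp add: X_def)
  have X_sq: "(nm x)\<^sup>2 - (2/c) * (\<Sum>i<n. F (X i)) \<le> (nm (X n))\<^sup>2" for n
  proof (induction n)
    case (Suc n)
    have "(nm (S y))\<^sup>2 \<ge> (nm y)\<^sup>2 - (2/c) * F y" for y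
      unfolding S_def nm_diff_sq F_def ip_scale_right using Re_ip_commute[of y "N y"] by simp
    from this[of "X n"] Suc show ?case by (simp add: X_def algebra_simps)
  qed (simp add: X_def)
  \<comment> \<open>The geometric series contributes \<open>1 / (1 - \<rho>) = c / \<delta>\<close>,
    and the loss per step is at most \<open>2 / c\<close> times the form; hence the factor
    \<open>2 / \<delta>\<close>.\<close>
  have lower: "(nm x)\<^sup>2 - (2/\<delta>) * F x \<le> (nm (X n))\<^sup>2" for n
  proof -
    have "(\<Sum>i<n. F (X i)) \<le> (\<Sum>i<n. \<rho> ^ i * F x)" by (intro sum_mono F_X)
    also have "\<dots> = (\<Sum>i<n. \<rho> ^ i) * F x" by (simp add: sum_distrib_right)
    also have "(\<Sum>i<n. \<rho> ^ i) \<le> 1 / (1 - \<rho>)"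
      using \<rho> by (simp add: sum_gp_strict divide_right_mono)
    finally have "(\<Sum>i<n. F (X i)) \<le> 1 / (1 - \<rho>) * F x" using Fx by (simp add: mult_right_mono)
    then have "(2/c) * (\<Sum>i<n. F (X i)) \<le> (2/c) * (1 / (1 - \<rho>) * F x)"
      using c(1) by (intro mult_left_mono) auto
    also have "\<dots> = (2/\<delta>) * F x" using c(1) \<delta>(1) by (simp add: \<rho>_def)
    finally show ?thesis using X_sq[of n] by linarith
  qed
  \<comment> \<open>The increments are multiples of \<open>N (X n)\<close>, whose squared norm is at
    most \<open>c\<close> times the form. They decay like \<open>sqrt \<rho> ^ n\<close>, so the
    iterates converge without any compactness.\<close>
  have lim: "(\<lambda>n. (nm (X n))\<^sup>2) \<longlonglongrightarrow> 0"
  proof -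
    define K where "K = sqrt (c * F x)"
    define q where "q = sqrt \<rho>"
    have q: "0 \<le> q" "q < 1" using \<rho> by (auto simp: q_def)
    have N_X: "nm (N (X n)) \<le> K * q ^ n" for n
    proof -
      have "(nm (N (X n)))\<^sup>2 \<le> c * (\<rho> ^ n * F x)"
        using N_sq[OF X_W, of n] mult_left_mono[OF F_X, of c n] c(1) by linarith
      then have "nm (N (X n)) \<le> sqrt (c * (\<rho> ^ n * F x))" by (rule real_le_rsqrt)
      then show ?thesis by (simp add: K_def q_def real_sqrt_mult real_sqrt_power mult_ac)
    qed
    have step: "nm (X (Suc n) - X n) \<le> K / c * q ^ n" for n
      using N_X[of n] c(1) by (simp add: X_def S_def nm_scale norm_divide divide_right_mono)
    have K: "0 \<le> K" using c(1) Fx by (simp add: K_def)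
    have tail: "nm (X (n + k) - X n) \<le> K / c * (q ^ n / (1 - q))" for n k
    proof -
      have "nm (X (n + k) - X n) \<le> (\<Sum>i<k. K / c * q ^ (n + i))"
      proof (induction k)
        case (Suc k)
        then show ?case
          using nm_triangle_mid[of "X (n + Suc k)" "X n" "X (n + k)"] step[of "n + k"] by simp
      qed simp
      also have "\<dots> = K / c * (q ^ n * (\<Sum>i<k. q ^ i))" by (simp add: sum_distrib_left power_add)
      also have "\<dots> \<le> K / c * (q ^ n * (1 / (1 - q)))"
        using q K c(1) by (intro mult_left_mono) (auto simp: sum_gp_strict divide_right_mono)
      finally show ?thesis by simp
    qed
    define a where "a n = K / c * (q ^ n / (1 - q))" for n
    have a: "a \<longlonglongrightarrow> 0" unfolding a_def
      using tendsto_mult_left[OF tendsto_divide[OF LIMSEQ_realpow_zero[OF q] tendsto_const], of "1 - q" "K / c"] q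
      by simp
    have a0: "0 \<le> a n" for n using q K c(1) by (simp add: a_def)
    have "nm (X m - X n) \<le> a m + a n" for m n
    proof (cases "n \<le> m")
      case True
      then show ?thesis using tail[of n "m - n"] a0[of m] by (simp add: a_def)
    next
      case False
      then show ?thesis
        using tail[of m "n - m"] a0[of n] nm_minus_commute[of "X m"] by (simp add: a_def)
    qed
    then obtain L where L: "conv X L" using a by (rule Cauchy_conv)
    have "L \<in> W" using X_W L by (intro W(2)) auto
    have "(\<lambda>n. nm (N (X n))) \<longlonglongrightarrow> nm (N L)"
      by (intro conv_nm conv_linear_image[OF L c(2)] sym_op_diff[OF N])
    moreover have "(\<lambda>n. nm (N (X n))) \<longlonglongrightarrow> 0"
    proof (rule Lim_null_comparison)
      show "(\<lambda>n. K * q ^ n) \<longlonglongrightarrow> 0"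
        using tendsto_mult_left[OF LIMSEQ_realpow_zero[OF q], of K] by simp
    qed (use N_X in simp)
    ultimately have "nm (N L) = 0" by (rule LIMSEQ_unique)
    then have "L = 0" using inj[OF \<open>L \<in> W\<close>] by simp
    then show ?thesis using tendsto_power[OF L, of 2] by simp
  qed
  have "(nm x)\<^sup>2 - (2/\<delta>) * F x \<le> 0"
    by (rule tendsto_lowerbound[OF lim always_eventually]) (use lower in auto)
  then show ?thesis using \<delta>(1) by (simp add: F_def field_simps)
qed (simp add: sym_op_zero[OF N])

end

context positive_operator
begin

text \<open>Let \<open>m\<close> be the supremum of the form on the unit sphere of \<open>W\<close>,
  and suppose \<open>\<theta> \<le> m\<close>. Then \<open>T - m\<close> is not bounded below, so
  the points just left of \<open>m\<close> are free of spectrum. That yields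
  \<open>\<delta> N \<le> N\<^sup>2\<close> for \<open>N = m - T\<close>. As \<open>N\<close> is
  injective on \<open>W\<close>, its form is at least \<open>\<delta> / 2\<close> there, against the
  choice of \<open>m\<close>.\<close>

lemma form_less_on_complement:
  assumes eig: "\<And>i. i \<in> I \<Longrightarrow> T (u i) = sc (of_real (t i)) (u i)"
    and W: "W = {x. \<forall>i\<in>I. ip (u i) x = 0}"
    and \<theta>: "\<theta> > 0"
    and isolated: "\<And>m. \<theta> \<le> m \<Longrightarrow>
      \<not> (\<exists>\<kappa>>0. \<forall>x. \<kappa> * nm x \<le> nm (T x - sc (of_real m) x)) \<Longrightarrow>
      \<exists>\<delta>>0. \<forall>s. m - \<delta> < s \<and> s < m \<longrightarrow> (\<exists>\<kappa>>0. \<forall>x. \<kappa> * nm x \<le> nm (T x - sc (of_real s) x))"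
    and eigenvectors: "\<And>m y. \<theta> \<le> m \<Longrightarrow> T y = sc (of_real m) y \<Longrightarrow> y \<in> span (u ` I)"
  shows "\<exists>\<theta>'<\<theta>. \<forall>x\<in>W. Re (ip (T x) x) \<le> \<theta>' * (nm x)\<^sup>2"
proof (cases "\<exists>x0\<in>W. x0 \<noteq> 0")
  case False
  \<comment> \<open>On a trivial complement any number below \<open>\<theta>\<close> serves.\<close>
  then show ?thesis by (intro exI[of _ "\<theta> - 1"]) (auto simp: T_zero)
next
  case True
  then obtain x0 where x0: "x0 \<in> W" "x0 \<noteq> 0" by blast
  have W_subspace: "subspace W"
    unfolding subspace_def W by (auto simp: ip_simps)
  have W_closed: "L \<in> W" if "\<forall>n. X n \<in> W" "conv X L" for X L
  proof -
    have "ip (u i) L = 0" if "i \<in> I" for i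
      using conv_ip[OF \<open>conv X L\<close>, of "u i"] \<open>\<forall>n. X n \<in> W\<close> that LIMSEQ_unique[OF tendsto_const, of 0]
      by (auto simp: W)
    then show ?thesis by (simp add: W)
  qed
  have T_W: "T x \<in> W" if "x \<in> W" for x
    using that eig by (auto simp: W ip_scale_left simp flip: T_sym)
  obtain m where upper: "\<And>x. x \<in> W \<Longrightarrow> Re (ip (T x) x) \<le> m * (nm x)\<^sup>2"
    and sup: "\<And>e. e > 0 \<Longrightarrow> \<exists>x\<in>W. nm x = 1 \<and> m - e < Re (ip (T x) x)"
    using form_sup[of W, OF subspace_scale[OF W_subspace] x0] by blast
  have not_upper: False if "e > 0" "\<And>x. x \<in> W \<Longrightarrow> Re (ip (T x) x) \<le> (m - e) * (nm x)\<^sup>2" for e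
    using sup[OF that(1)] that(2) by fastforce
  show ?thesis
  proof (cases "m < \<theta>")
    case True
    then show ?thesis using upper by blast
  next
    case False
    then have m: "\<theta> \<le> m" "0 < m" using \<theta> by auto
    define N where "N x = sc (of_real m) x - T x" for x
    have N: "sym_op N" unfolding N_def by (rule sym_op_shift_minus[OF T_sym_op])
    obtain c0 where c0: "\<And>x. nm (T x) \<le> c0 * nm x" using T_bounded by blast
    have c0_pos: "c0 > 0" using T_bound_pos[OF x0(2) c0] .
    define c where "c = m + c0"
    have c: "c > 0" "nm (N x) \<le> c * nm x" for x
      using m c0_pos c0[of x] nm_triangle_diff[of "sc (of_real m) x" "T x"]
      by (auto simp: c_def N_def nm_scale algebra_simps)
    have N_form: "Re (ip (N x) x) = m * (nm x)\<^sup>2 - Re (ip (T x) x)" for x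
      by (simp add: N_def ip_simps nm_sq)
    have N_pos: "0 \<le> Re (ip (N x) x)" if "x \<in> W" for x using upper[OF that] by (simp add: N_form)
    have N_W: "N x \<in> W" if "x \<in> W" for x
      unfolding N_def using W_subspace T_W that by (intro subspace_diff subspace_scale)
    have N_le: "Re (ip (N x) x) \<le> c * (nm x)\<^sup>2" for x
      using Re_ip_le[of "N x" x] mult_right_mono[OF c(2)[of x], of "nm x"]
      by (simp add: power2_eq_square)
    have N_T: "nm (N x) = nm (T x - sc (of_real m) x)" for x
      unfolding N_def by (rule nm_minus_commute)
    have N_sq: "(nm (N x))\<^sup>2 \<le> c * Re (ip (N x) x)" if "x \<in> W" for x
      by (rule nm_sq_le_form[OF N c(1)])
        (use that N_W N_le W_subspace in \<open>auto intro!: N_pos subspace_diff subspace_scale\<close>)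
    have "\<not> (\<exists>\<kappa>>0. \<forall>x. \<kappa> * nm x \<le> nm (T x - sc (of_real m) x))"
    proof
      assume "\<exists>\<kappa>>0. \<forall>x. \<kappa> * nm x \<le> nm (T x - sc (of_real m) x)"
      then obtain \<kappa> where \<kappa>: "\<kappa> > 0" "\<And>x. \<kappa> * nm x \<le> nm (N x)" using N_T by auto
      have "Re (ip (T x) x) \<le> (m - \<kappa>\<^sup>2 / c) * (nm x)\<^sup>2" if "x \<in> W" for x
      proof -
        have "(\<kappa> * nm x)\<^sup>2 \<le> (nm (N x))\<^sup>2" using \<kappa> by (intro power_mono) auto
        then have "\<kappa>\<^sup>2 * (nm x)\<^sup>2 \<le> c * Re (ip (N x) x)"
          using N_sq[OF that] by (simp add: power_mult_distrib)
        then have "\<kappa>\<^sup>2 * (nm x)\<^sup>2 / c \<le> Re (ip (N x) x)" using c(1) by (simp add: divide_le_eq mult.commute)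
        then show ?thesis by (simp add: N_form algebra_simps)
      qed
      then show False using not_upper[of "\<kappa>\<^sup>2 / c"] \<kappa>(1) c(1) by simp
    qed
    from isolated[OF m(1) this] obtain \<delta> where \<delta>: "\<delta> > 0"
      and gap: "\<And>s. m - \<delta> < s \<Longrightarrow> s < m \<Longrightarrow>
        \<exists>\<kappa>>0. \<forall>x. \<kappa> * nm x \<le> nm (T x - sc (of_real s) x)"
      by blast
    \<comment> \<open>\<open>m - h\<close> is the centre of the free interval
      \<open>(m - \<delta>, m)\<close> and \<open>h\<close> its radius. Expanding
      \<open>(nm ((h - N) x))\<^sup>2 \<ge> (h * nm x)\<^sup>2\<close> leaves exactly
      \<open>N\<^sup>2 - 2 h N \<ge> 0\<close>.\<close>
    define h where "h = \<delta> / 2"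
    have N_gap: "\<delta> * Re (ip (N x) x) \<le> (nm (N x))\<^sup>2" for x
    proof -
      define S where "S x = T x - sc (of_real (m - h)) x" for x
      have S: "sym_op S" unfolding S_def by (rule sym_op_shift[OF T_sym_op])
      have S_N: "S x = sc (of_real h) x - N x" for x
        by (simp add: S_def N_def scale_left_diff_distrib)
      have "h * nm x \<le> nm (S x)"
      proof (rule bounded_below_of_gap[OF S])
        show "nm (S x) \<le> (h + c) * nm x" for x
          using c(2)[of x] nm_triangle_diff[of "sc (of_real h) x" "N x"] \<delta>
          by (simp add: S_N nm_scale h_def algebra_simps)
        fix r :: real assume "\<bar>r\<bar> < h"
        moreover have "S x - sc (of_real r) x = T x - sc (of_real (m - h + r)) x" for x
          by (simp add: S_def scale_left_diff_distrib scale_left_distrib algebra_simps)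
        ultimately show "\<exists>\<kappa>>0. \<forall>x. \<kappa> * nm x \<le> nm (S x - sc (of_real r) x)"
          using gap[of "m - h + r"] by (simp add: h_def)
      qed
      then have "(h * nm x)\<^sup>2 \<le> (nm (S x))\<^sup>2" using \<delta> by (intro power_mono) (auto simp: h_def)
      also have "\<dots> = (h * nm x)\<^sup>2 + (nm (N x))\<^sup>2 - \<delta> * Re (ip (N x) x)"
        using Re_ip_commute[of x "N x"] \<delta>
        unfolding S_N nm_diff_sq by (simp add: nm_scale ip_scale_left h_def)
      finally show ?thesis by simp
    qed
    have N_inj: "x = 0" if "x \<in> W" "N x = 0" for x
    proof -
      have "x \<in> span (u ` I)" using that(2) by (intro eigenvectors[OF m(1)]) (simp add: N_def)
      then have "ip x x = 0" by (rule ip_span_zero) (use that(1) in \<open>auto simp: W\<close>)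
      then show ?thesis by (simp add: ip_self)
    qed
    have form_gap: "\<delta> * (nm x)\<^sup>2 \<le> 2 * Re (ip (N x) x)" if "x \<in> W" for x
      by (rule form_gap_of_injective[OF N W_subspace W_closed N_W c N_pos \<delta> N_gap N_inj that])
    have "Re (ip (T x) x) \<le> (m - \<delta> / 2) * (nm x)\<^sup>2" if "x \<in> W" for x
      using form_gap[OF that] unfolding N_form by (simp add: left_diff_distrib)
    then show ?thesis using not_upper[of "\<delta> / 2"] \<delta> by simp
  qed
qed

end

section \<open>From the spectrum of \<open>A\<close> to a gap for its inverse\<close>

context complex_hilbert_space
begin

text \<open>From the factorization \<open>T - 1/s = - (1/s) (A - s) T\<close>. The constant arises
  by estimating \<open>T x\<close> through the resolvent bound and recovering \<open>x / s\<close>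
  as \<open>T x - (T x - x / s)\<close>.\<close>

lemma resolvent_bounded_below:
  assumes sa: "selfadjoint_operator sc ip D A" and pd: "positive_definite_operator ip D A"
    and s: "s > 0" "of_real s \<in> resolvent_set sc ip D A"
  shows "\<exists>\<kappa>>0. \<forall>x. \<kappa> * nm x \<le> nm (op_inverse D A x - sc (of_real (1 / s)) x)"
proof -
  let ?T = "op_inverse D A"
  obtain C0 where C0: "\<And>u. u \<in> D \<Longrightarrow> nm u \<le> C0 * nm (A u - sc (of_real s) u)"
    using s(2) unfolding resolvent_set_def by auto
  define C where "C = max C0 0"
  define \<kappa> where "\<kappa> = 1 / s / (C * s + 1)"
  have C: "0 \<le> C" "nm u \<le> C * nm (A u - sc (of_real s) u)" if "u \<in> D" for u
    using C0[OF that] mult_right_mono[of C0 C "nm (A u - sc (of_real s) u)"] by (auto simp: C_def)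
  have "\<kappa> * nm x \<le> nm (?T x - sc (of_real (1 / s)) x)" for x
  proof -
    let ?y = "?T x - sc (of_real (1 / s)) x"
    have "nm (?T x) \<le> C * nm (A (?T x) - sc (of_real s) (?T x))"
      by (rule C) (rule selfadjoint_inverse(2)[OF sa pd])
    also have "A (?T x) - sc (of_real s) (?T x) = sc (of_real (- s)) ?y"
      using s(1) by (simp add: selfadjoint_inverse(3)[OF sa pd] scale_right_diff_distrib)
    finally have 1: "nm (?T x) \<le> C * (s * nm ?y)" using s(1) by (simp add: nm_scale)
    have "1 / s * nm x = nm (sc (of_real (1 / s)) x)" using s(1) by (simp add: nm_scale norm_divide)
    also have "\<dots> \<le> nm (?T x) + nm ?y" using nm_triangle_diff[of "?T x" ?y] by simp
    finally have "1 / s * nm x \<le> (C * s + 1) * nm ?y" using 1 by (simp add: algebra_simps)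
    moreover have "C * s + 1 > 0" using s(1) by (simp add: C_def add_nonneg_pos)
    ultimately have "1 / s * nm x / (C * s + 1) \<le> nm ?y" by (simp only: pos_divide_le_eq mult.commute)
    then show ?thesis by (simp add: \<kappa>_def)
  qed
  moreover have "\<kappa> > 0" using s(1) by (simp add: \<kappa>_def C_def add_nonneg_pos)
  ultimately show ?thesis by blast
qed

text \<open>Points \<open>m \<ge> 1 / lam l\<close> of the spectrum of the inverse correspond to
  points \<open>1 / m \<le> lam l\<close> of the spectrum of \<open>A\<close>, which lie below the
  essential spectrum and are therefore isolated. Their eigenvectors belong to the span of
  \<open>u 1, ..., u l\<close> since every later eigenvalue in the list exceeds
  \<open>lam l\<close>.\<close>

lemma lower_eigensystem_gap:
  assumes sa: "selfadjoint_operator sc ip D A" and pd: "positive_definite_operator ip D A"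
    and eig: "lower_eigensystem sc ip D A N lam u"
    and l: "1 \<le> l" "enat l \<le> N" and l_full: "\<And>i. l < i \<Longrightarrow> enat i \<le> N \<Longrightarrow> lam l < lam i"
  shows "\<exists>\<theta>'<1 / lam l. \<forall>x. (\<forall>i\<in>{1..l}. ip (u i) x = 0) \<longrightarrow>
    Re (ip (op_inverse D A x) x) \<le> \<theta>' * (nm x)\<^sup>2"
proof -
  let ?T = "op_inverse D A"
  interpret T: positive_operator sc ip ?T by (rule selfadjoint_inverse(1)[OF sa pd])
  have J: "enat i \<le> N" if "i \<le> l" for i using l(2) that by (meson enat_ord_simps(1) order_trans)
  have lam_pos: "0 < lam i" and lam_ess: "ereal (lam i) < ess_bottom sc ip D A"
    and u: "u i \<in> D" "A (u i) = sc (of_real (lam i)) (u i)" if "i \<in> {1..l}" for i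
    using eig J that unfolding lower_eigensystem_def eigenspace_def Let_def by auto
  have eigenspace: "eigenspace sc D A z = span {u i | i. 1 \<le> i \<and> enat i \<le> N \<and> of_real (lam i) = z}"
    if "ereal (Re z) < ess_bottom sc ip D A" for z
    using eig that unfolding lower_eigensystem_def Let_def by (auto simp: conj_assoc)
  have lam_l: "0 < lam l" "ereal (lam l) < ess_bottom sc ip D A" using lam_pos lam_ess l(1) by auto
  have T_u: "?T (u i) = sc (of_real (1 / lam i)) (u i)" if "i \<in> {1..l}" for i
    using eigenspace_iff_inverse[OF sa pd, of "lam i" "u i"] lam_pos[OF that] u[OF that]
    by (simp add: eigenspace_def)
  have below_ess: "ereal (1 / m) < ess_bottom sc ip D A" if "1 / lam l \<le> m" for m
  proof -
    have "m > 0" using that lam_l(1) by (meson divide_pos_pos less_le_trans zero_less_one)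
    then have "1 / m \<le> lam l" using that lam_l(1) by (simp add: field_simps)
    then show ?thesis using lam_l(2) by (meson ereal_less_eq(3) le_less_trans)
  qed
  have "\<exists>\<theta>'<1 / lam l. \<forall>x\<in>{x. \<forall>i\<in>{1..l}. ip (u i) x = 0}. Re (ip (?T x) x) \<le> \<theta>' * (nm x)\<^sup>2"
  proof (rule T.form_less_on_complement[OF T_u refl])
    show "0 < 1 / lam l" using lam_l(1) by simp
  next
    fix m assume m: "1 / lam l \<le> m"
      and nb: "\<not> (\<exists>\<kappa>>0. \<forall>x. \<kappa> * nm x \<le> nm (?T x - sc (of_real m) x))"
    have m0: "m > 0" using m lam_l(1) by (meson divide_pos_pos less_le_trans zero_less_one)
    define z where "z = complex_of_real (1 / m)"
    have "z \<in> op_spectrum sc ip D A"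
      using resolvent_bounded_below[OF sa pd, of "1 / m"] nb m0
      unfolding op_spectrum_def z_def by auto
    moreover have "z \<notin> essential_spectrum sc ip D A"
    proof
      assume "z \<in> essential_spectrum sc ip D A"
      then have "ess_bottom sc ip D A \<le> ereal (Re z)" unfolding ess_bottom_def by (rule INF_lower)
      then show False using below_ess[OF m] by (simp add: z_def)
    qed
    ultimately have "z isolated_in op_spectrum sc ip D A"
      by (simp add: essential_spectrum_def discrete_spectrum_def)
    then obtain O1 where O1: "open O1" "O1 \<inter> op_spectrum sc ip D A = {z}"
      unfolding isolated_in_def by blast
    have "(\<lambda>s. complex_of_real (1 / s)) \<midarrow>m\<rightarrow> z"
      unfolding z_def using m0 by (intro tendsto_intros) auto
    moreover have "z \<in> O1" using O1(2) by blast
    ultimately have "\<forall>\<^sub>F s in at m. complex_of_real (1 / s) \<in> O1" using O1(1) topological_tendstoD by blast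
    then obtain d where d: "d > 0" "\<And>s. s \<noteq> m \<Longrightarrow> dist s m < d \<Longrightarrow> complex_of_real (1 / s) \<in> O1"
      unfolding eventually_at by auto
    \<comment> \<open>The bound by \<open>m\<close> keeps \<open>s\<close> positive, so that
      \<open>1 / s\<close> is meaningful.\<close>
    define \<delta> where "\<delta> = min d m"
    have "\<exists>\<kappa>>0. \<forall>x. \<kappa> * nm x \<le> nm (?T x - sc (of_real s) x)" if "m - \<delta> < s" "s < m" for s
    proof -
      have s: "s > 0" "dist s m < d" using that by (auto simp: \<delta>_def dist_real_def)
      then have "complex_of_real (1 / s) \<in> O1" using d(2) that by simp
      moreover have "complex_of_real (1 / s) \<noteq> z"
        unfolding z_def of_real_eq_iff using that s m0 by simp
      ultimately have "complex_of_real (1 / s) \<in> resolvent_set sc ip D A"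
        using O1(2) unfolding op_spectrum_def by blast
      then show ?thesis using resolvent_bounded_below[OF sa pd, of "1 / s"] s by simp
    qed
    moreover have "\<delta> > 0" using d(1) m0 by (simp add: \<delta>_def)
    ultimately show "\<exists>\<delta>>0. \<forall>s. m - \<delta> < s \<and> s < m \<longrightarrow>
        (\<exists>\<kappa>>0. \<forall>x. \<kappa> * nm x \<le> nm (?T x - sc (of_real s) x))" by blast
  next
    fix m y assume m: "1 / lam l \<le> m" and y: "?T y = sc (of_real m) y"
    have m0: "m > 0" using m lam_l(1) by (meson divide_pos_pos less_le_trans zero_less_one)
    have "y \<in> eigenspace sc D A (of_real (1 / m))"
      using eigenspace_iff_inverse[OF sa pd, of "1 / m"] y m0 by simp
    also have "\<dots> = span {u i | i. 1 \<le> i \<and> enat i \<le> N \<and> complex_of_real (lam i) = of_real (1 / m)}"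
      using below_ess[OF m] by (intro eigenspace) simp
    also have "\<dots> \<subseteq> span (u ` {1..l})"
    proof (rule span_mono, safe)
      fix i assume i: "1 \<le> i" "enat i \<le> N" "complex_of_real (lam i) = of_real (1 / m)"
      have "lam i = 1 / m" using i(3) by (simp only: of_real_eq_iff)
      also have "\<dots> \<le> lam l" using m m0 lam_l(1) by (simp add: field_simps)
      finally have "i \<le> l" using l_full[of i] i(2) by fastforce
      then show "u i \<in> u ` {1..l}" using i(1) by auto
    qed
    finally show "y \<in> span (u ` {1..l})" .
  qed
  then show ?thesis by simp
qed

end

section \<open>Ritz approximation of the largest eigenvalues of a positive operator\<close>

text \<open>Gaussian elimination, one equation and one pivot unknown at a time. It provides the
  dimension counts of the min-max arguments and of the basis property of the Ritz vectors.\<close>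

lemma homogeneous_system_solvable:
  fixes a :: "'i \<Rightarrow> 'k \<Rightarrow> complex"
  assumes "finite I" "finite K" "card I < card K"
  shows "\<exists>b. (\<exists>k\<in>K. b k \<noteq> 0) \<and> (\<forall>i\<in>I. (\<Sum>k\<in>K. a i k * b k) = 0)"
  using assms
proof (induction I arbitrary: K a rule: finite_induct)
  case empty
  then have "K \<noteq> {}" by auto
  then show ?case by (intro exI[of _ "\<lambda>_. 1"]) auto
next
  case (insert i0 I)
  show ?case
  proof (cases "\<forall>k\<in>K. a i0 k = 0")
    case True
    obtain b where "\<exists>k\<in>K. b k \<noteq> 0" "\<forall>i\<in>I. (\<Sum>k\<in>K. a i k * b k) = 0"
      using insert.IH[of K a] insert.prems insert.hyps by auto
    then show ?thesis using True by (intro exI[of _ b]) auto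
  next
    case False
    then obtain k0 where k0: "k0 \<in> K" "a i0 k0 \<noteq> 0" by blast
    define a' where "a' i k = a i k - a i k0 * a i0 k / a i0 k0" for i k
    have "card I < card (K - {k0})" using insert.prems insert.hyps k0(1) by simp
    then obtain b' where b': "\<exists>k\<in>K - {k0}. b' k \<noteq> 0"
        "\<forall>i\<in>I. (\<Sum>k\<in>K - {k0}. a' i k * b' k) = 0"
      using insert.IH[of "K - {k0}" a'] insert.prems by auto
    define c where "c = (\<Sum>k\<in>K - {k0}. a i0 k * b' k)"
    define b where "b k = (if k = k0 then - c / a i0 k0 else b' k)" for k
    have split: "(\<Sum>k\<in>K. a i k * b k) = - a i k0 * c / a i0 k0 + (\<Sum>k\<in>K - {k0}. a i k * b' k)" for i
      using sum.remove[OF insert.prems(1) k0(1), of "\<lambda>k. a i k * b k"] by (simp add: b_def)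
    have "(\<Sum>k\<in>K. a i k * b k) = 0" if "i \<in> insert i0 I" for i
    proof (cases "i = i0")
      case True
      then show ?thesis using k0(2) unfolding split by (simp add: c_def)
    next
      case False
      then have "0 = (\<Sum>k\<in>K - {k0}. a' i k * b' k)" using b'(2) that by simp
      also have "\<dots> = (\<Sum>k\<in>K - {k0}. a i k * b' k) - a i k0 / a i0 k0 * c"
        unfolding c_def sum_distrib_left sum_subtractf[symmetric]
        by (rule sum.cong) (auto simp: a'_def algebra_simps)
      finally show ?thesis unfolding split by simp
    qed
    moreover have "\<exists>k\<in>K. b k \<noteq> 0" using b'(1) by (auto simp: b_def)
    ultimately show ?thesis by blast
  qed
qed

context complex_hilbert_space
begin

lemma orthonormal_sum_eq_0_iff:
  assumes "orthonormal_on I e" "finite I"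
  shows "(\<Sum>k\<in>I. sc (a k) (e k)) = 0 \<longleftrightarrow> (\<forall>k\<in>I. a k = 0)"
proof
  assume "(\<Sum>k\<in>I. sc (a k) (e k)) = 0"
  then have "(\<Sum>k\<in>I. (cmod (a k))\<^sup>2) = 0"
    using nm_orthonormal_sum[OF assms order_refl, of a] by simp
  then show "\<forall>k\<in>I. a k = 0" using assms(2) by (simp add: sum_nonneg_eq_0_iff)
qed simp

end

section \<open>Error bounds for Ritz values and Ritz vectors\<close>

context positive_operator
begin

text \<open>Only the matrix of \<open>T\<close> compressed to the system has to be diagonal, so
  eigenvectors and Ritz vectors are covered alike.\<close>

lemma form_orthonormal_sum:
  assumes "orthonormal_on K e" "finite K"
    and diag: "\<And>i k. i \<in> K \<Longrightarrow> k \<in> K \<Longrightarrow> ip (e i) (T (e k)) = (if i = k then of_real (\<nu> k) else 0)"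
  shows "Re (ip (T (\<Sum>k\<in>K. sc (b k) (e k))) (\<Sum>k\<in>K. sc (b k) (e k))) = (\<Sum>k\<in>K. \<nu> k * (cmod (b k))\<^sup>2)"
proof -
  let ?x = "\<Sum>k\<in>K. sc (b k) (e k)"
  have "ip (e i) (T ?x) = b i * of_real (\<nu> i)" if "i \<in> K" for i
  proof -
    have "ip (e i) (T ?x) = (\<Sum>k\<in>K. if i = k then b i * of_real (\<nu> i) else 0)"
      unfolding T_sum ip_sum_right T_scale ip_scale_right
      by (rule sum.cong) (use diag[OF that] in auto)
    then show ?thesis using that assms(2) by simp
  qed
  then have "ip ?x (T ?x) = (\<Sum>i\<in>K. cnj (b i) * (b i * of_real (\<nu> i)))"
    unfolding ip_sum_left ip_scale_left by (intro sum.cong) auto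
  also have "\<dots> = (\<Sum>i\<in>K. of_real (\<nu> i * (cmod (b i))\<^sup>2))"
    using mult_cnj_self by (intro sum.cong) (auto simp: mult_ac)
  finally show ?thesis unfolding T_sym by (simp flip: of_real_sum)
qed

lemma eigen_decomposition:
  fixes x :: 'a
  assumes u: "orthonormal_on I u" "finite I"
    and eig: "\<forall>i\<in>I. T (u i) = sc (of_real (\<theta> i)) (u i)"
  defines "r \<equiv> x - (\<Sum>i\<in>I. sc (ip (u i) x) (u i))"
  shows "\<And>i. i \<in> I \<Longrightarrow> ip (u i) r = 0"
    and "(nm x)\<^sup>2 = (\<Sum>i\<in>I. (cmod (ip (u i) x))\<^sup>2) + (nm r)\<^sup>2"
    and "Re (ip (T x) x) = (\<Sum>i\<in>I. \<theta> i * (cmod (ip (u i) x))\<^sup>2) + Re (ip (T r) r)"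
proof -
  define s where "s = (\<Sum>i\<in>I. sc (ip (u i) x) (u i))"
  have x: "x = s + r" by (simp add: r_def s_def)
  show r: "ip (u i) r = 0" if "i \<in> I" for i
    unfolding r_def ip_diff_right using ip_orthonormal_sum[OF u order_refl that] that by simp
  have "ip s r = 0" unfolding s_def ip_sum_left ip_scale_left by (rule sum.neutral) (simp add: r)
  then have "(nm x)\<^sup>2 = (nm s)\<^sup>2 + (nm r)\<^sup>2" by (subst x) (simp add: nm_add_sq)
  also have "(nm s)\<^sup>2 = (\<Sum>i\<in>I. (cmod (ip (u i) x))\<^sup>2)"
    unfolding s_def by (rule nm_orthonormal_sum[OF u order_refl])
  finally show "(nm x)\<^sup>2 = (\<Sum>i\<in>I. (cmod (ip (u i) x))\<^sup>2) + (nm r)\<^sup>2" .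
  have Tsr: "ip (T s) r = 0"
    unfolding s_def T_sum T_scale ip_sum_left ip_scale_left
    by (rule sum.neutral) (simp add: eig ip_scale_left r)
  then have "ip (T r) s = 0" by (metis T_sym complex_cnj_zero ip_commute)
  with Tsr have "Re (ip (T x) x) = Re (ip (T s) s) + Re (ip (T r) r)"
    by (subst (1 2) x) (simp add: T_add ip_simps)
  also have "Re (ip (T s) s) = (\<Sum>i\<in>I. \<theta> i * (cmod (ip (u i) x))\<^sup>2)"
    unfolding s_def by (rule form_orthonormal_sum[OF u])
      (use u(1) eig in \<open>auto simp: orthonormal_on_def ip_scale_right\<close>)
  finally show "Re (ip (T x) x) = (\<Sum>i\<in>I. \<theta> i * (cmod (ip (u i) x))\<^sup>2) + Re (ip (T r) r)" .
qed

text \<open>Rayleigh--Ritz pairs of \<open>T\<close> normalized in \<open>H\<^sub>0\<close>. The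
  expansion clause says that the \<open>e k\<close> form a basis of \<open>V\<close>, and the clause
  after it is the Galerkin condition. The values decrease, being reciprocals of the
  \<open>Lam n k\<close>.\<close>

definition ritz_pairs :: "'a set \<Rightarrow> nat \<Rightarrow> (nat \<Rightarrow> real) \<Rightarrow> (nat \<Rightarrow> 'a) \<Rightarrow> bool" where
  "ritz_pairs V n \<nu> e \<longleftrightarrow> subspace V \<and> (\<forall>k\<in>{1..n}. e k \<in> V) \<and> orthonormal_on {1..n} e \<and>
     (\<forall>x\<in>V. x = (\<Sum>k=1..n. sc (ip (e k) x) (e k))) \<and>
     (\<forall>k\<in>{1..n}. \<forall>x\<in>V. ip x (T (e k)) = of_real (\<nu> k) * ip x (e k)) \<and>
     (\<forall>i\<in>{1..n}. \<forall>j\<in>{1..n}. i \<le> j \<longrightarrow> \<nu> j \<le> \<nu> i)"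

lemma ritz_pairs_diag:
  assumes "ritz_pairs V n \<nu> e" "i \<in> {1..n}" "k \<in> {1..n}"
  shows "ip (e i) (T (e k)) = (if i = k then of_real (\<nu> k) else 0)"
  using assms unfolding ritz_pairs_def orthonormal_on_def by simp

text \<open>Min-max: the span of the first \<open>j\<close> Ritz vectors, where the form is at least
  \<open>\<nu> j\<close>, contains a nonzero vector orthogonal to the \<open>j - 1\<close> vectors
  \<open>u 1, ..., u (j - 1)\<close>.\<close>

lemma ritz_value_le:
  assumes R: "ritz_pairs V n \<nu> e" and j: "j \<in> {1..n}"
    and bound: "\<And>x. (\<And>i. i \<in> {1..<j} \<Longrightarrow> ip (u i) x = 0) \<Longrightarrow> Re (ip (T x) x) \<le> \<theta> * (nm x)\<^sup>2"
  shows "\<nu> j \<le> \<theta>"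
proof -
  have "card {1..<j} < card {1..j}" using j by auto
  then obtain b where b: "\<exists>k\<in>{1..j}. b k \<noteq> 0"
      "\<forall>i\<in>{1..<j}. (\<Sum>k=1..j. ip (u i) (e k) * b k) = 0"
    using homogeneous_system_solvable[OF finite_atLeastLessThan finite_atLeastAtMost,
        where a = "\<lambda>i k. ip (u i) (e k)"] by blast
  define y where "y = (\<Sum>k=1..j. sc (b k) (e k))"
  have sub: "{1..j} \<subseteq> {1..n}" using j by auto
  then have e: "orthonormal_on {1..j} e"
    using R orthonormal_on_subset unfolding ritz_pairs_def by blast
  have y0: "y \<noteq> 0" unfolding y_def using orthonormal_sum_eq_0_iff[OF e] b(1) by auto
  have "\<nu> j * (nm y)\<^sup>2 = (\<Sum>k=1..j. \<nu> j * (cmod (b k))\<^sup>2)"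
    unfolding y_def nm_orthonormal_sum[OF e finite_atLeastAtMost order_refl] by (rule sum_distrib_left)
  also have "\<dots> \<le> (\<Sum>k=1..j. \<nu> k * (cmod (b k))\<^sup>2)"
    using R j unfolding ritz_pairs_def by (intro sum_mono mult_right_mono) auto
  also have "\<dots> = Re (ip (T y) y)"
    unfolding y_def using ritz_pairs_diag[OF R] sub
    by (intro form_orthonormal_sum[OF e, symmetric]) (auto simp: subset_iff)
  also have "\<dots> \<le> \<theta> * (nm y)\<^sup>2"
    by (rule bound) (use b(2) in \<open>simp add: y_def ip_sum_right ip_scale_right mult.commute\<close>)
  finally show ?thesis using y0 nm_pos_iff[of y] by (simp add: mult_le_cancel_right)
qed

text \<open>Min-max in the other direction: some nontrivial combination \<open>y\<close> of
  \<open>p 1, ..., p j\<close> is orthogonal to the first \<open>j - 1\<close> Ritz vectors, so its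
  form is at most \<open>\<nu> j\<close>. It is compared with the same combination \<open>x\<close>
  of the eigenvectors, where the form is at least \<open>\<theta> j\<close>.\<close>

lemma ritz_value_ge:
  assumes R: "ritz_pairs V n \<nu> e" and j: "j \<in> {1..n}"
    and c: "\<And>x. nm (T x) \<le> c * nm x"
    and u: "orthonormal_on {1..j} u"
    and eig: "\<And>i. i \<in> {1..j} \<Longrightarrow> T (u i) = sc (of_real (\<theta> i)) (u i)" "\<And>i. i \<in> {1..j} \<Longrightarrow> \<theta> j \<le> \<theta> i"
    and p: "\<And>i. i \<in> {1..j} \<Longrightarrow> p i \<in> V" "\<And>i. i \<in> {1..j} \<Longrightarrow> nm (u i - p i) \<le> \<epsilon>"
    and \<epsilon>: "0 \<le> \<epsilon>" "j * \<epsilon> \<le> 1"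
  shows "\<theta> j \<le> \<nu> j + 5 * c * j * \<epsilon>"
proof -
  have V: "subspace V" and e: "orthonormal_on {1..n} e"
    and expand: "\<And>x. x \<in> V \<Longrightarrow> x = (\<Sum>k=1..n. sc (ip (e k) x) (e k))"
    and anti: "\<And>i k. i \<in> {1..n} \<Longrightarrow> k \<in> {1..n} \<Longrightarrow> i \<le> k \<Longrightarrow> \<nu> k \<le> \<nu> i"
    using R unfolding ritz_pairs_def by blast+
  have ej: "nm (e j) = 1" by (rule nm_orthonormal[OF e j])
  have \<nu>_form: "\<nu> j = Re (ip (T (e j)) (e j))" using ritz_pairs_diag[OF R j j] by (simp add: T_sym)
  have \<nu>: "0 \<le> \<nu> j" "\<nu> j \<le> c"
    using T_pos[of "e j"] T_form_le[OF c, of "e j"] ej by (auto simp: \<nu>_form)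
  have c0: "0 \<le> c" using \<nu> by linarith
  have "card {1..<j} < card {1..j}" using j by auto
  then obtain b where b: "\<exists>i\<in>{1..j}. b i \<noteq> 0"
      "\<forall>k\<in>{1..<j}. (\<Sum>i=1..j. ip (e k) (p i) * b i) = 0"
    using homogeneous_system_solvable[OF finite_atLeastLessThan finite_atLeastAtMost,
        where a = "\<lambda>k i. ip (e k) (p i)"] by blast
  define x where "x = (\<Sum>i=1..j. sc (b i) (u i))"
  define y where "y = (\<Sum>i=1..j. sc (b i) (p i))"
  define d where "d = x - y"
  have x_sq: "(nm x)\<^sup>2 = (\<Sum>i=1..j. (cmod (b i))\<^sup>2)"
    unfolding x_def by (rule nm_orthonormal_sum[OF u]) auto
  have x0: "x \<noteq> 0" unfolding x_def using orthonormal_sum_eq_0_iff[OF u] b(1) by auto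
  have y: "y \<in> V" unfolding y_def using V p(1) by (intro subspace_sum subspace_scale) auto
  have d: "nm d \<le> j * \<epsilon> * nm x"
  proof -
    have "d = (\<Sum>i=1..j. sc (b i) (u i - p i))"
      by (simp add: d_def x_def y_def scale_right_diff_distrib sum_subtractf)
    then have "nm d \<le> (\<Sum>i=1..j. cmod (b i) * nm (u i - p i))"
      using nm_sum_le[of "\<lambda>i. sc (b i) (u i - p i)" "{1..j}"] by (simp add: nm_scale)
    also have "\<dots> \<le> (\<Sum>i=1..j. nm x * \<epsilon>)"
    proof (intro sum_mono mult_mono p(2))
      fix i assume "i \<in> {1..j}"
      then have "(cmod (b i))\<^sup>2 \<le> (nm x)\<^sup>2" unfolding x_sq by (intro member_le_sum) auto
      then show "cmod (b i) \<le> nm x" by (rule power2_le_imp_le) simp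
    qed auto
    finally show ?thesis by (simp add: mult_ac)
  qed
  have form_y: "Re (ip (T y) y) \<le> \<nu> j * (nm y)\<^sup>2"
  proof -
    have zero: "ip (e k) y = 0" if "k \<in> {1..<j}" for k
      using b(2) that by (simp add: y_def ip_sum_right ip_scale_right mult.commute)
    have "Re (ip (T y) y) = (\<Sum>k=1..n. \<nu> k * (cmod (ip (e k) y))\<^sup>2)"
      using form_orthonormal_sum[OF e finite_atLeastAtMost ritz_pairs_diag[OF R], of "\<lambda>k. ip (e k) y"]
      unfolding expand[OF y, symmetric] by blast
    also have "\<dots> \<le> (\<Sum>k=1..n. \<nu> j * (cmod (ip (e k) y))\<^sup>2)"
    proof (rule sum_mono)
      fix k assume k: "k \<in> {1..n}"
      show "\<nu> k * (cmod (ip (e k) y))\<^sup>2 \<le> \<nu> j * (cmod (ip (e k) y))\<^sup>2"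
      proof (cases "k < j")
        case True
        then show ?thesis using zero[of k] k by simp
      next
        case False
        then show ?thesis using anti[OF j k] by (intro mult_right_mono) auto
      qed
    qed
    also have "\<dots> = \<nu> j * (nm y)\<^sup>2"
      using nm_orthonormal_sum[OF e finite_atLeastAtMost order_refl, of "\<lambda>k. ip (e k) y"]
      unfolding expand[OF y, symmetric] by (simp add: sum_distrib_left)
    finally show ?thesis .
  qed
  have form_x: "\<theta> j * (nm x)\<^sup>2 \<le> Re (ip (T x) x)"
  proof -
    have "Re (ip (T x) x) = (\<Sum>i=1..j. \<theta> i * (cmod (b i))\<^sup>2)"
      unfolding x_def by (rule form_orthonormal_sum[OF u])
        (use u eig(1) in \<open>auto simp: orthonormal_on_def ip_scale_right\<close>)
    then show ?thesis unfolding x_sq sum_distrib_left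
      using eig(2) by (auto intro!: sum_mono mult_right_mono)
  qed
  \<comment> \<open>The quadratic term \<open>(T d, d)\<close> has a favourable sign and is dropped;
    only the cross term has to be estimated.\<close>
  have "Re (ip (T y) y) = Re (ip (T x) x) - 2 * Re (ip (T x) d) + Re (ip (T d) d)"
  proof -
    have "y = x - d" by (simp add: d_def)
    moreover have "Re (ip (T d) x) = Re (ip (T x) d)" by (metis Re_ip_commute T_sym)
    ultimately show ?thesis by (simp add: T_diff ip_simps)
  qed
  moreover have "Re (ip (T x) d) \<le> c * nm x * nm d"
    using Re_ip_le[of "T x" d] mult_right_mono[OF c[of x], of "nm d"] by simp
  ultimately have "\<theta> j * (nm x)\<^sup>2 \<le> \<nu> j * (nm y)\<^sup>2 + 2 * c * nm x * nm d"
    using form_x form_y T_pos[of d] by linarith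
  also have "\<dots> \<le> \<nu> j * ((1 + j * \<epsilon>) * nm x)\<^sup>2 + 2 * c * nm x * (j * \<epsilon> * nm x)"
  proof (intro add_mono mult_left_mono power_mono d)
    show "nm y \<le> (1 + j * \<epsilon>) * nm x"
      using nm_triangle_diff[of x d] d by (simp add: d_def algebra_simps)
  qed (use \<nu> c0 in auto)
  also have "\<dots> = (\<nu> j * (1 + j * \<epsilon>)\<^sup>2 + 2 * c * (j * \<epsilon>)) * (nm x)\<^sup>2"
    by (simp add: power2_eq_square algebra_simps)
  finally have "\<theta> j \<le> \<nu> j * (1 + j * \<epsilon>)\<^sup>2 + 2 * c * (j * \<epsilon>)"
    using x0 nm_pos_iff[of x] by (simp add: mult_le_cancel_right)
  \<comment> \<open>The constant 5 consists of 2 from the cross term and 3 from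
    \<open>(1 + t)\<^sup>2 \<le> 1 + 3 t\<close> for \<open>0 \<le> t \<le> 1\<close>.\<close>
  moreover have "\<nu> j * (1 + j * \<epsilon>)\<^sup>2 \<le> \<nu> j + 3 * c * (j * \<epsilon>)"
  proof -
    define t where "t = j * \<epsilon>"
    have t: "0 \<le> t" "t \<le> 1" using \<epsilon> by (auto simp: t_def)
    have "(1 + t)\<^sup>2 \<le> 1 + 3 * t"
      using mult_left_mono[OF t(2) t(1)] by (simp add: power2_eq_square algebra_simps)
    then have "\<nu> j * (1 + t)\<^sup>2 \<le> \<nu> j * (1 + 3 * t)" using \<nu>(1) by (rule mult_left_mono)
    moreover have "\<nu> j * (3 * t) \<le> c * (3 * t)" using \<nu>(2) t by (intro mult_right_mono) auto
    ultimately show ?thesis unfolding t_def[symmetric] by (simp add: algebra_simps)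
  qed
  ultimately show ?thesis by (simp add: algebra_simps)
qed

text \<open>The residual \<open>\<rho> = T e - \<nu> e\<close> is orthogonal to \<open>V\<close>, so that its inner product with an
  eigenvector of \<open>T\<close> only sees the part of the eigenvector outside \<open>V\<close>.\<close>

lemma ritz_vector_error:
  assumes V: "e \<in> V" "nm e = 1" "\<And>x. x \<in> V \<Longrightarrow> ip x (T e) = of_real \<nu> * ip x e"
    and c: "\<And>x. nm (T x) \<le> c * nm x"
    and u: "orthonormal_on {1..l} u"
    and eig: "\<And>i. i \<in> {1..l} \<Longrightarrow> T (u i) = sc (of_real (\<theta> i)) (u i)"
    and g: "g > 0" "\<And>i. i \<in> {1..l} \<Longrightarrow> \<theta> i \<noteq> t \<Longrightarrow> g \<le> \<bar>\<theta> i - \<nu>\<bar>"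
    and gap: "\<And>x. (\<And>i. i \<in> {1..l} \<Longrightarrow> ip (u i) x = 0) \<Longrightarrow> Re (ip (T x) x) \<le> (\<nu> - g) * (nm x)\<^sup>2"
    and p: "\<And>i. i \<in> {1..l} \<Longrightarrow> p i \<in> V" "\<And>i. i \<in> {1..l} \<Longrightarrow> nm (u i - p i) \<le> \<epsilon>" and \<epsilon>: "0 \<le> \<epsilon>"
  shows "nm (e - (\<Sum>i\<in>{i\<in>{1..l}. \<theta> i = t}. sc (ip (u i) e) (u i))) \<le> (3 * real l * c / g + real l) * \<epsilon>"
proof -
  define a where "a i = ip (u i) e" for i
  define r where "r = e - (\<Sum>i=1..l. sc (a i) (u i))"
  define \<rho> where "\<rho> = T e - sc (of_real \<nu>) e"
  have \<rho>V: "ip x \<rho> = 0" if "x \<in> V" for x by (simp add: \<rho>_def ip_simps V(3)[OF that])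
  have \<nu>_form: "\<nu> = Re (ip (T e) e)"
    using V(3)[OF V(1)] V(2) by (simp add: T_sym ip_self)
  have \<nu>: "0 \<le> \<nu>" "\<nu> \<le> c"
    using T_pos[of e] T_form_le[OF c, of e] V(2) by (auto simp: \<nu>_form)
  have c0: "0 \<le> c" using \<nu> by linarith
  have \<theta>: "0 \<le> \<theta> i" "\<theta> i \<le> c" if "i \<in> {1..l}" for i
    using T_pos[of "u i"] T_form_le[OF c, of "u i"] nm_orthonormal[OF u that]
    by (auto simp: eig[OF that] ip_scale_left ip_self)
  have a: "cmod (a i) \<le> 1" if "i \<in> {1..l}" for i
    using Cauchy_Schwarz[of "u i" e] nm_orthonormal[OF u that] V(2) by (simp add: a_def)
  have u\<rho>: "cmod (ip (u i) \<rho>) \<le> \<epsilon> * nm \<rho>" if "i \<in> {1..l}" for i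
  proof -
    have "ip (u i) \<rho> = ip (u i - p i) \<rho>" by (simp add: ip_diff_left \<rho>V p(1)[OF that])
    also have "cmod \<dots> \<le> nm (u i - p i) * nm \<rho>" by (rule Cauchy_Schwarz)
    also have "\<dots> \<le> \<epsilon> * nm \<rho>" by (intro mult_right_mono p(2)[OF that]) simp
    finally show ?thesis .
  qed
  have u\<rho>_eq: "ip (u i) \<rho> = of_real (\<theta> i - \<nu>) * a i" if "i \<in> {1..l}" for i
  proof -
    have "ip (u i) (T e) = of_real (\<theta> i) * a i" by (simp flip: T_sym add: eig[OF that] ip_scale_left a_def)
    then show ?thesis by (simp add: \<rho>_def ip_simps a_def left_diff_distrib)
  qed
  have r: "ip (u i) r = 0" if "i \<in> {1..l}" for i
    unfolding r_def a_def
    by (rule eigen_decomposition(1)[OF u finite_atLeastAtMost _ that, where \<theta> = \<theta>]) (use eig in blast)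
  have e_eq: "e = (\<Sum>i=1..l. sc (a i) (u i)) + r" by (simp add: r_def)
  have Te: "T e = (\<Sum>i=1..l. sc (a i * of_real (\<theta> i)) (u i)) + T r"
    unfolding arg_cong[OF e_eq, of T] T_add T_sum T_scale
    by (intro arg_cong2[of _ _ _ _ "(+)"] sum.cong) (simp_all add: eig)
  \<comment> \<open>As the residual is orthogonal to \<open>e\<close>, its squared norm is its inner
    product with \<open>T e\<close>. There the eigenvector components contribute order
    \<open>\<epsilon>\<close> and the remainder contributes \<open>c * nm r\<close>.\<close>
  have \<rho>_le: "nm \<rho> \<le> c * (l * \<epsilon> + nm r)"
  proof -
    have "ip \<rho> \<rho> = ip \<rho> (T e) - of_real \<nu> * ip \<rho> e" by (subst (2) \<rho>_def) (simp add: ip_simps)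
    also have "ip \<rho> e = 0" using \<rho>V[OF V(1)] ip_commute[of \<rho> e] by simp
    finally have "(nm \<rho>)\<^sup>2 = Re (ip \<rho> (T e))" by (simp add: nm_sq)
    also have "\<dots> \<le> cmod (ip \<rho> (T e))" by (rule complex_Re_le_cmod)
    also have "ip \<rho> (T e) = (\<Sum>i=1..l. a i * of_real (\<theta> i) * ip \<rho> (u i)) + ip \<rho> (T r)"
      unfolding Te by (simp add: ip_add_right ip_sum_right ip_scale_right)
    also have "cmod \<dots> \<le> (\<Sum>i=1..l. cmod (a i * of_real (\<theta> i) * ip \<rho> (u i))) + cmod (ip \<rho> (T r))"
      by (intro order_trans[OF norm_triangle_ineq] add_mono norm_sum order_refl)
    also have "\<dots> \<le> (\<Sum>i=1..l. 1 * c * (\<epsilon> * nm \<rho>)) + nm \<rho> * (c * nm r)"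
    proof (intro add_mono sum_mono)
      fix i assume i: "i \<in> {1..l}"
      show "cmod (a i * of_real (\<theta> i) * ip \<rho> (u i)) \<le> 1 * c * (\<epsilon> * nm \<rho>)"
        unfolding norm_mult using a[OF i] \<theta>[OF i] u\<rho>[OF i] cmod_ip_commute[of \<rho> "u i"] c0
        by (intro mult_mono) auto
    next
      show "cmod (ip \<rho> (T r)) \<le> nm \<rho> * (c * nm r)"
        using Cauchy_Schwarz[of \<rho> "T r"] mult_left_mono[OF c[of r], of "nm \<rho>"] by simp
    qed
    finally have "nm \<rho> * nm \<rho> \<le> (c * (l * \<epsilon> + nm r)) * nm \<rho>"
      by (simp add: power2_eq_square algebra_simps)
    then show ?thesis
      using \<epsilon> c0 by (cases "nm \<rho> = 0") (auto simp: mult_le_cancel_right nm_pos_iff)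
  qed
  \<comment> \<open>The real part of \<open>ip r \<rho>\<close> is evaluated twice: through
    \<open>r = e - (\<Sum>i. a i u i)\<close> it is of order \<open>\<epsilon> * nm \<rho>\<close>,
    and through the action of \<open>T\<close> on \<open>r\<close> it is at most
    \<open>- g * (nm r)\<^sup>2\<close>.\<close>
  have r_le: "nm r \<le> (l * c / g + l) * \<epsilon>"
  proof -
    have "ip r \<rho> = - (\<Sum>i=1..l. cnj (a i) * ip (u i) \<rho>)"
      using \<rho>V[OF V(1)] by (simp add: r_def ip_diff_left ip_sum_left ip_scale_left)
    then have "- Re (ip r \<rho>) \<le> cmod (\<Sum>i=1..l. cnj (a i) * ip (u i) \<rho>)"
      using complex_Re_le_cmod[of "\<Sum>i=1..l. cnj (a i) * ip (u i) \<rho>"] by simp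
    also have "\<dots> \<le> (\<Sum>i=1..l. cmod (cnj (a i) * ip (u i) \<rho>))" by (rule norm_sum)
    also have "\<dots> \<le> (\<Sum>i=1..l. 1 * (\<epsilon> * nm \<rho>))"
      unfolding norm_mult complex_mod_cnj by (intro sum_mono mult_mono a u\<rho>) auto
    also have "\<dots> = l * \<epsilon> * nm \<rho>" by simp
    finally have 1: "- Re (ip r \<rho>) \<le> l * \<epsilon> * nm \<rho>" .
    have "ip r (u i) = 0" if "i \<in> {1..l}" for i using r[OF that] ip_commute[of r "u i"] by simp
    then have "ip r (T e) = ip r (T r)" "ip r ((\<Sum>i=1..l. sc (a i) (u i)) + r) = ip r r"
      unfolding Te by (simp_all add: ip_add_right ip_sum_right ip_scale_right)
    then have "ip r (T e) = ip r (T r)" "ip r e = ip r r" unfolding e_eq[symmetric] by blast+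
    then have "Re (ip r \<rho>) = Re (ip (T r) r) - \<nu> * (nm r)\<^sup>2"
      by (simp add: \<rho>_def ip_simps T_sym nm_sq)
    then have "g * (nm r)\<^sup>2 \<le> l * \<epsilon> * nm \<rho>" using gap[of r] r 1 by (simp add: algebra_simps)
    also have "\<dots> \<le> l * \<epsilon> * (c * (l * \<epsilon> + nm r))" using \<epsilon> by (intro mult_left_mono \<rho>_le) auto
    finally have 2: "(nm r)\<^sup>2 \<le> l * c / g * \<epsilon> * (l * \<epsilon> + nm r)" using g(1) by (simp add: field_simps)
    \<comment> \<open>It remains to solve
      \<open>R\<^sup>2 \<le> X \<epsilon> (l \<epsilon> + R)\<close> for \<open>R = nm r\<close>;
      the inequality fails as soon as \<open>R > (X + l) \<epsilon>\<close>.\<close>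
    define X where "X = l * c / g"
    have X: "0 \<le> X" using c0 g(1) by (simp add: X_def)
    show ?thesis
    proof (rule ccontr)
      assume "\<not> ?thesis"
      then have gt: "(X + l) * \<epsilon> < nm r" by (simp add: X_def)
      have nn: "0 \<le> (X + l) * \<epsilon>" using X \<epsilon> by simp
      have "X * \<epsilon> * (l * \<epsilon> + nm r) \<le> ((X + l) * \<epsilon>) * nm r"
      proof -
        have "X * \<epsilon> * l * \<epsilon> \<le> l * \<epsilon> * ((X + l) * \<epsilon>)" using X \<epsilon> by (simp add: algebra_simps)
        also have "\<dots> \<le> l * \<epsilon> * nm r" using gt \<epsilon> by (intro mult_left_mono) auto
        finally show ?thesis by (simp add: algebra_simps)
      qed
      also have "\<dots> < nm r * nm r" using gt nn by (intro mult_strict_right_mono) auto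
      finally show False using 2 by (simp add: X_def power2_eq_square)
    qed
  qed
  have \<rho>2: "nm \<rho> \<le> 2 * c"
    using nm_triangle_diff[of "T e" "sc (of_real \<nu>) e"] c[of e] V(2) \<nu> by (simp add: \<rho>_def nm_scale)
  \<comment> \<open>Components along the other eigenvalues: \<open>(\<theta> i - \<nu>) a i\<close>
    is the inner product of \<open>u i\<close> with the residual, and the first factor is at least
    \<open>g\<close> in modulus.\<close>
  have a_small: "cmod (a i) \<le> 2 * c / g * \<epsilon>" if "i \<in> {1..l}" "\<theta> i \<noteq> t" for i
  proof -
    have "g * cmod (a i) \<le> \<bar>\<theta> i - \<nu>\<bar> * cmod (a i)" using g(2)[OF that] by (intro mult_right_mono) auto
    also have "\<dots> = cmod (ip (u i) \<rho>)" unfolding u\<rho>_eq[OF that(1)] norm_mult norm_of_real ..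
    also have "\<dots> \<le> \<epsilon> * (2 * c)"
      using u\<rho>[OF that(1)] mult_left_mono[OF \<rho>2 \<epsilon>] by linarith
    finally show ?thesis using g(1) by (simp add: field_simps)
  qed
  have "e - (\<Sum>i\<in>{i\<in>{1..l}. \<theta> i = t}. sc (a i) (u i)) =
      (\<Sum>i\<in>{i\<in>{1..l}. \<theta> i \<noteq> t}. sc (a i) (u i)) + r"
  proof -
    have "(\<Sum>i=1..l. sc (a i) (u i)) = (\<Sum>i\<in>{i\<in>{1..l}. \<theta> i = t}. sc (a i) (u i)) +
        (\<Sum>i\<in>{i\<in>{1..l}. \<theta> i \<noteq> t}. sc (a i) (u i))"
      by (subst sum.union_disjoint[symmetric]) (auto intro!: sum.cong)
    then show ?thesis by (simp add: r_def algebra_simps)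
  qed
  also have "nm \<dots> \<le> (\<Sum>i\<in>{i\<in>{1..l}. \<theta> i \<noteq> t}. nm (sc (a i) (u i))) + nm r"
    by (intro order_trans[OF nm_triangle] add_mono nm_sum_le order_refl)
  also have "(\<Sum>i\<in>{i\<in>{1..l}. \<theta> i \<noteq> t}. nm (sc (a i) (u i))) \<le> (\<Sum>i\<in>{i\<in>{1..l}. \<theta> i \<noteq> t}. 2 * c / g * \<epsilon>)"
    using a_small nm_orthonormal[OF u] by (intro sum_mono) (auto simp: nm_scale)
  also have "\<dots> \<le> l * (2 * c / g * \<epsilon>)"
  proof -
    have "card {i\<in>{1..l}. \<theta> i \<noteq> t} \<le> l"
      by (rule order_trans[OF card_mono[of "{1..l}"]]) auto
    then show ?thesis
      unfolding sum_constant using c0 g(1) \<epsilon> by (intro mult_right_mono) auto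
  qed
  finally have "nm (e - (\<Sum>i\<in>{i\<in>{1..l}. \<theta> i = t}. sc (a i) (u i))) \<le>
      l * (2 * c / g * \<epsilon>) + (l * c / g + l) * \<epsilon>" using r_le by simp
  also have "\<dots> = (3 * l * c / g + l) * \<epsilon>" using g(1) by (simp add: field_simps)
  finally show ?thesis unfolding a_def by simp
qed

text \<open>\<open>\<epsilon>0\<close> and \<open>K\<close> are quantified before the trial space,
  so the bound can be used along all \<open>n\<close>. On the eigenspace
  \<open>\<theta> j * (nm v)\<^sup>2\<close> is the squared norm of
  \<open>H\<^sub>-\<^sub>1\<^sub>/\<^sub>2\<close>, and the factor \<open>1 / sqrt (\<nu> j)\<close>
  turns the unit vector \<open>e j\<close> into the Ritz vector with that normalization.\<close>

lemma ritz_approximation: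
  assumes l: "1 \<le> l" and u: "orthonormal_on {1..l} u"
    and eigen: "\<forall>i\<in>{1..l}. T (u i) = sc (of_real (\<theta> i)) (u i)"
    and decreasing: "\<forall>i\<in>{1..l}. \<forall>j\<in>{1..l}. i \<le> j \<longrightarrow> \<theta> j \<le> \<theta> i"
    and pos: "\<theta> l > 0"
    and gap: "\<theta>' < \<theta> l"
      "\<forall>x. (\<forall>i\<in>{1..l}. ip (u i) x = 0) \<longrightarrow> Re (ip (T x) x) \<le> \<theta>' * (nm x)\<^sup>2"
  obtains \<epsilon>0 K where "0 < \<epsilon>0"
    "\<forall>V n \<nu> e \<epsilon> j. ritz_pairs V n \<nu> e \<longrightarrow> l \<le> n \<longrightarrow> 0 \<le> \<epsilon> \<longrightarrow> \<epsilon> \<le> \<epsilon>0 \<longrightarrow>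
      (\<forall>i\<in>{1..l}. \<exists>p\<in>V. nm (u i - p) \<le> \<epsilon>) \<longrightarrow> j \<in> {1..l} \<longrightarrow>
      (\<exists>b. \<theta> j * (nm (\<Sum>i\<in>{i\<in>{1..l}. \<theta> i = \<theta> j}. sc (b i) (u i)))\<^sup>2 = 1 \<and>
        nm ((\<Sum>i\<in>{i\<in>{1..l}. \<theta> i = \<theta> j}. sc (b i) (u i)) - sc (of_real (1 / sqrt (\<nu> j))) (e j)) \<le> K * \<epsilon>)"
proof -
  have l_mem: "l \<in> {1..l}" using l by simp
  have eig: "T (u i) = sc (of_real (\<theta> i)) (u i)" if "i \<in> {1..l}" for i
    using eigen that by blast
  have anti: "\<theta> j \<le> \<theta> i" if "i \<in> {1..l}" "j \<in> {1..l}" "i \<le> j" for i j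
    using decreasing that by blast
  obtain c0 where c0: "\<And>x. nm (T x) \<le> c0 * nm x" using T_bounded by blast
  define c where "c = max c0 0"
  have c: "0 \<le> c" "nm (T x) \<le> c * nm x" for x
    using c0[of x] mult_right_mono[of c0 c "nm x"] by (auto simp: c_def)
  \<comment> \<open>All distances that must survive: to the rest of the spectrum, to zero, and
    between distinct eigenvalues. With \<open>g\<close> half the least of them, a shift of
    \<open>\<theta> j\<close> to \<open>\<nu> j\<close> by at most \<open>g\<close> still leaves a
    separation of \<open>g\<close>.\<close>
  define G where "G = insert (\<theta> l - \<theta>') (insert (\<theta> l)
    {\<bar>\<theta> i - \<theta> j\<bar> | i j. i \<in> {1..l} \<and> j \<in> {1..l} \<and> \<theta> i \<noteq> \<theta> j})"
  have "{\<bar>\<theta> i - \<theta> j\<bar> | i j. i \<in> {1..l} \<and> j \<in> {1..l} \<and> \<theta> i \<noteq> \<theta> j} \<subseteq>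
      (\<lambda>(i, j). \<bar>\<theta> i - \<theta> j\<bar>) ` ({1..l} \<times> {1..l})" by auto
  then have "finite {\<bar>\<theta> i - \<theta> j\<bar> | i j. i \<in> {1..l} \<and> j \<in> {1..l} \<and> \<theta> i \<noteq> \<theta> j}"
    by (rule finite_subset) simp
  then have G: "finite G" unfolding G_def by (simp only: finite_insert)
  define g where "g = Min G / 2"
  have "\<forall>x\<in>G. 0 < x" using gap(1) pos by (auto simp: G_def)
  then have g: "g > 0" using G by (auto simp: g_def G_def)
  have gG: "2 * g \<le> x" if "x \<in> G" for x using Min_le[OF G that] by (simp add: g_def)
  have g1: "2 * g \<le> \<theta> l - \<theta>'" "2 * g \<le> \<theta> l" by (auto intro!: gG simp: G_def)
  have g2: "2 * g \<le> \<bar>\<theta> i - \<theta> j\<bar>" if "i \<in> {1..l}" "j \<in> {1..l}" "\<theta> i \<noteq> \<theta> j" for i j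
    by (rule gG) (use that in \<open>auto simp: G_def\<close>)
  \<comment> \<open>\<open>K1\<close> is the constant of \<open>ritz_vector_error\<close>, and
    \<open>K2\<close> bounds that of \<open>ritz_value_ge\<close> for all \<open>j\<close> up to
    \<open>l\<close>; \<open>K\<close> adds the cost of the normalizations. The three terms of
    \<open>\<epsilon>0\<close> give \<open>l * \<epsilon> \<le> 1\<close>,
    \<open>K2 * \<epsilon> \<le> g\<close> and \<open>K1 * \<epsilon> \<le> 1 / 2\<close>.\<close>
  define K1 where "K1 = 3 * real l * c / g + real l"
  define K2 where "K2 = 5 * c * real l"
  define K where "K = 2 * K1 / sqrt g + K2 / (g * sqrt g)"
  define \<epsilon>0 where "\<epsilon>0 = min (1 / l) (min (g / (K2 + 1)) (1 / (2 * (K1 + 1))))"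
  have K12: "0 \<le> K1" "0 \<le> K2" using c g by (auto simp: K1_def K2_def)
  have \<epsilon>0: "0 < \<epsilon>0" using g l K12 by (simp add: \<epsilon>0_def)
  have key: "\<exists>b. \<theta> j * (nm (\<Sum>i\<in>{i\<in>{1..l}. \<theta> i = \<theta> j}. sc (b i) (u i)))\<^sup>2 = 1 \<and>
      nm ((\<Sum>i\<in>{i\<in>{1..l}. \<theta> i = \<theta> j}. sc (b i) (u i)) - sc (of_real (1 / sqrt (\<nu> j))) (e j)) \<le> K * \<epsilon>"
    if R: "ritz_pairs V n \<nu> e" and n: "l \<le> n" and \<epsilon>: "0 \<le> \<epsilon>" "\<epsilon> \<le> \<epsilon>0"
      and close: "\<forall>i\<in>{1..l}. \<exists>p\<in>V. nm (u i - p) \<le> \<epsilon>" and j: "j \<in> {1..l}" for V n \<nu> e \<epsilon> j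
  proof -
    obtain p where p: "\<And>i. i \<in> {1..l} \<Longrightarrow> p i \<in> V" "\<And>i. i \<in> {1..l} \<Longrightarrow> nm (u i - p i) \<le> \<epsilon>"
      using close by metis
    have jn: "j \<in> {1..n}" using j n by auto
    have sub: "{1..j} \<subseteq> {1..l}" using j by auto
    have small: "l * \<epsilon> \<le> 1" "K2 * \<epsilon> \<le> g" "K1 * \<epsilon> \<le> 1 / 2"
    proof -
      show "l * \<epsilon> \<le> 1" using \<epsilon> l by (simp add: \<epsilon>0_def field_simps)
      have "(K2 + 1) * \<epsilon> \<le> g" using \<epsilon> K12 by (simp add: \<epsilon>0_def pos_le_divide_eq mult.commute)
      then show "K2 * \<epsilon> \<le> g" using \<epsilon>(1) by (simp add: algebra_simps)
      have "\<epsilon> * (2 * (K1 + 1)) \<le> 1" using \<epsilon> K12 pos_le_divide_eq[of "2 * (K1 + 1)" \<epsilon> 1] by (simp add: \<epsilon>0_def)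
      then show "K1 * \<epsilon> \<le> 1 / 2" using \<epsilon>(1) by (simp add: algebra_simps)
    qed
    have \<theta>l: "\<theta> l \<le> \<theta> j" using anti[OF j l_mem] j by simp
    have upper: "\<nu> j \<le> \<theta> j"
    proof (rule ritz_value_le[OF R jn])
      fix x assume x: "\<And>i. i \<in> {1..<j} \<Longrightarrow> ip (u i) x = 0"
      \<comment> \<open>On this complement the components from index \<open>j\<close> on carry
        \<open>\<theta> i \<le> \<theta> j\<close>, and the part outside all the \<open>u i\<close>
        carries \<open>\<theta>' < \<theta> l \<le> \<theta> j\<close>.\<close>
      define r where "r = x - (\<Sum>i=1..l. sc (ip (u i) x) (u i))"
      note dec = eigen_decomposition[OF u finite_atLeastAtMost eigen, where x = x, folded r_def]
      have "\<theta> i * (cmod (ip (u i) x))\<^sup>2 \<le> \<theta> j * (cmod (ip (u i) x))\<^sup>2" if "i \<in> {1..l}" for i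
        using x[of i] anti[OF j that] that by (cases "i < j") (auto intro: mult_right_mono)
      then have "(\<Sum>i=1..l. \<theta> i * (cmod (ip (u i) x))\<^sup>2) \<le> \<theta> j * (\<Sum>i=1..l. (cmod (ip (u i) x))\<^sup>2)"
        unfolding sum_distrib_left by (rule sum_mono)
      moreover have "Re (ip (T r) r) \<le> \<theta>' * (nm r)\<^sup>2" using gap(2) dec(1) by blast
      moreover have "\<theta>' * (nm r)\<^sup>2 \<le> \<theta> j * (nm r)\<^sup>2" using gap(1) \<theta>l by (intro mult_right_mono) auto
      ultimately show "Re (ip (T x) x) \<le> \<theta> j * (nm x)\<^sup>2" unfolding dec(2,3) distrib_left by linarith
    qed
    have lower: "\<theta> j \<le> \<nu> j + K2 * \<epsilon>"
    proof -
      have "j * \<epsilon> \<le> l * \<epsilon>" using j \<epsilon> by (intro mult_right_mono) auto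
      then have "\<theta> j \<le> \<nu> j + 5 * c * j * \<epsilon>"
        using sub small j \<epsilon>(1) by (intro ritz_value_ge[OF R jn c(2) orthonormal_on_subset[OF u sub] eig anti p]) auto
      also have "5 * c * j * \<epsilon> \<le> K2 * \<epsilon>"
        unfolding K2_def using j c(1) \<epsilon>(1) by (intro mult_right_mono mult_left_mono) auto
      finally show ?thesis by simp
    qed
    have \<nu>g: "g \<le> \<nu> j" using lower small(2) g1(2) \<theta>l by linarith
    define f where "f = (\<Sum>i\<in>{i\<in>{1..l}. \<theta> i = \<theta> j}. sc (ip (u i) (e j)) (u i))"
    have ej: "e j \<in> V" "nm (e j) = 1"
      using R jn nm_orthonormal unfolding ritz_pairs_def by blast+
    have ef: "nm (e j - f) \<le> K1 * \<epsilon>"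
      unfolding f_def K1_def
    proof (rule ritz_vector_error[OF ej _ c(2) u eig g])
      show "ip x (T (e j)) = of_real (\<nu> j) * ip x (e j)" if "x \<in> V" for x
        using R jn that unfolding ritz_pairs_def by blast
      show "g \<le> \<bar>\<theta> i - \<nu> j\<bar>" if "i \<in> {1..l}" "\<theta> i \<noteq> \<theta> j" for i
        using g2[OF that(1) j that(2)] upper lower small(2) by linarith
      show "Re (ip (T x) x) \<le> (\<nu> j - g) * (nm x)\<^sup>2" if "\<And>i. i \<in> {1..l} \<Longrightarrow> ip (u i) x = 0" for x
      proof -
        have "\<theta>' * (nm x)\<^sup>2 \<le> (\<nu> j - g) * (nm x)\<^sup>2"
          using lower small(2) g1(1) \<theta>l by (intro mult_right_mono) auto
        then show ?thesis using gap(2) that by fastforce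
      qed
    qed (use p \<epsilon> in auto)
    define F where "F = nm f"
    have F: "\<bar>F - 1\<bar> \<le> K1 * \<epsilon>"
      using nm_reverse_triangle[of "e j" f] ef ej(2) by (simp add: F_def abs_minus_commute)
    then have F0: "F > 0" using small(3) by linarith
    have \<theta>j: "g \<le> \<theta> j" "\<theta> j > 0" using g1(2) \<theta>l g by linarith+
    define s where "s = sqrt (\<theta> j)"
    define s' where "s' = sqrt (\<nu> j)"
    have s: "s > 0" "s' > 0" "s\<^sup>2 = \<theta> j" "s'\<^sup>2 = \<nu> j" "sqrt g \<le> s" "sqrt g \<le> s'" "s' \<le> s"
      using \<theta>j \<nu>g g upper by (auto simp: s_def s'_def)
    \<comment> \<open>The projection \<open>f\<close>, rescaled from norm \<open>F\<close> to norm
      \<open>1 / sqrt (\<theta> j)\<close>.\<close>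
    define v where "v = sc (of_real (1 / (s * F))) f"
    have v: "v = (\<Sum>i\<in>{i\<in>{1..l}. \<theta> i = \<theta> j}. sc (of_real (1 / (s * F)) * ip (u i) (e j)) (u i))"
      by (simp add: v_def f_def scale_sum_right)
    have nv: "\<theta> j * (nm v)\<^sup>2 = 1"
      using s(1) F0 by (simp add: v_def nm_scale norm_mult norm_divide power_divide power_mult_distrib
          flip: F_def s(3))
    \<comment> \<open>Two errors are separated: replacing the normalized projection by
      \<open>e j\<close> at the same scale, and changing the scale from \<open>\<theta> j\<close> to
      \<open>\<nu> j\<close>.\<close>
    have "nm (v - sc (of_real (1 / s')) (e j)) \<le> K * \<epsilon>"
    proof -
      have 1: "nm (v - sc (of_real (1 / s)) (e j)) \<le> 2 * K1 / sqrt g * \<epsilon>"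
      proof -
        have "v - sc (of_real (1 / s)) (e j) =
            sc (of_real (1 / s)) (sc (of_real (1 / F - 1)) f + (f - e j))"
          using s(1) by (simp add: v_def scale_right_distrib scale_right_diff_distrib
              scale_left_diff_distrib right_diff_distrib)
        then have "nm (v - sc (of_real (1 / s)) (e j)) =
            1 / s * nm (sc (of_real (1 / F - 1)) f + (f - e j))"
          using s(1) by (simp only: nm_scale norm_of_real) simp
        also have "\<dots> \<le> 1 / s * (K1 * \<epsilon> + K1 * \<epsilon>)"
        proof (intro mult_left_mono order_trans[OF nm_triangle] add_mono)
          have "nm (sc (of_real (1 / F - 1)) f) = \<bar>1 / F - 1\<bar> * F"
            by (simp only: nm_scale norm_of_real F_def)
          also have "\<dots> = \<bar>(1 / F - 1) * F\<bar>" using F0 by (simp add: abs_mult)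
          also have "\<dots> = \<bar>F - 1\<bar>" using F0 by (simp add: left_diff_distrib)
          finally show "nm (sc (of_real (1 / F - 1)) f) \<le> K1 * \<epsilon>" using F by simp
          show "nm (f - e j) \<le> K1 * \<epsilon>" using ef by (simp add: nm_minus_commute)
        qed (use s in auto)
        also have "\<dots> \<le> 1 / sqrt g * (K1 * \<epsilon> + K1 * \<epsilon>)"
          using s g K12 \<epsilon>(1) by (intro mult_right_mono divide_left_mono) auto
        finally show ?thesis by simp
      qed
      have 2: "nm (sc (of_real (1 / s)) (e j) - sc (of_real (1 / s')) (e j)) \<le> K2 / (g * sqrt g) * \<epsilon>"
      proof -
        have "nm (sc (of_real (1 / s)) (e j) - sc (of_real (1 / s')) (e j)) = \<bar>1 / s - 1 / s'\<bar>"
          by (simp only: scale_left_diff_distrib[symmetric] of_real_diff[symmetric] nm_scale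
              norm_of_real ej(2) mult_1_right)
        also have "\<dots> = (s - s') / (s * s')" using s by (simp add: field_simps)
        also have "\<dots> \<le> (K2 * \<epsilon> / s) / (s * s')"
        proof (rule divide_right_mono)
          have "(s - s') * s \<le> (s - s') * (s + s')" using s by (intro mult_left_mono) auto
          also have "\<dots> = \<theta> j - \<nu> j" by (simp flip: s(3,4) add: power2_eq_square algebra_simps)
          finally show "s - s' \<le> K2 * \<epsilon> / s" using s lower by (simp add: pos_le_divide_eq)
        qed (use s in auto)
        also have "\<dots> = K2 * \<epsilon> / (\<theta> j * s')" using s by (simp flip: s(3) add: power2_eq_square)
        also have "\<dots> \<le> K2 * \<epsilon> / (g * sqrt g)"
          using s \<theta>j g K12 \<epsilon>(1) by (intro divide_left_mono mult_mono) auto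
        finally show ?thesis by simp
      qed
      show ?thesis
        using nm_triangle_mid[of v "sc (of_real (1 / s')) (e j)" "sc (of_real (1 / s)) (e j)"] 1 2
        unfolding K_def distrib_right by linarith
    qed
    then show ?thesis
      using nv unfolding s'_def
      by (intro exI[of _ "\<lambda>i. of_real (1 / (s * F)) * ip (u i) (e j)"]) (simp only: v[symmetric] simp_thms)
  qed
  show ?thesis by (rule that[of \<epsilon>0 K, OF \<epsilon>0]) (intro allI impI, rule key)
qed

end

section \<open>The dual harmonic Ritz method\<close>

context complex_hilbert_space
begin

text \<open>Tested against \<open>V\<close>, the matrix pencil reads
  \<open>w i = L i * T (w i)\<close>; division by \<open>sqrt (L i)\<close> makes the
  \<open>w i\<close> orthonormal in \<open>H\<^sub>0\<close>. Positivity of \<open>L i\<close> holds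
  because the normalization in \<open>H\<^sub>-\<^sub>1\<^sub>/\<^sub>2\<close> excludes
  \<open>w i = 0\<close>.\<close>

lemma dual_harmonic_ritz_pairs:
  assumes sa: "selfadjoint_operator sc ip D A" and pd: "positive_definite_operator ip D A"
    and R: "dual_harmonic_ritz sc ip D A q n L w"
  defines "V \<equiv> range (\<lambda>x :: nat \<Rightarrow> complex. \<Sum>k=1..n. sc (x k) (q k))"
  shows "i \<in> {1..n} \<Longrightarrow> 0 < L i"
    and "positive_operator.ritz_pairs sc ip (op_inverse D A) V n (\<lambda>i. 1 / L i)
      (\<lambda>i. sc (of_real (1 / sqrt (L i))) (w i))"
proof -
  let ?T = "op_inverse D A"
  interpret positive_operator sc ip ?T by (rule selfadjoint_inverse(1)[OF sa pd])
  define e where "e i = sc (of_real (1 / sqrt (L i))) (w i)" for i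
  have L_mono: "L i \<le> L j" if "i \<in> {1..n}" "j \<in> {1..n}" "i \<le> j" for i j
    using R that unfolding dual_harmonic_ritz_def by blast
  have w_ip: "ip (w i) (w j) = (if i = j then of_real (L i) else 0)"
    and w_power: "power_ip sc ip D A (- 1 / 2) (w i) (w j) = (if i = j then 1 else 0)"
    if "i \<in> {1..n}" "j \<in> {1..n}" for i j
    using R that unfolding dual_harmonic_ritz_def by blast+
  have L_pos: "0 < L i" if "i \<in> {1..n}" for i
  proof -
    have "(nm (w i))\<^sup>2 = L i" using w_ip[OF that that] by (simp add: nm_sq)
    moreover have "w i \<noteq> 0"
    proof
      assume "w i = 0"
      moreover have "bounded_power sc ip ?T (1 / 2) 0 = 0"
        by (rule sym_op_zero[OF bounded_power_sym_op]) simp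
      ultimately show False using w_power[OF that that] by (simp add: power_ip_def op_power_def)
    qed
    ultimately show ?thesis using nm_pos_iff[of "w i"] by (metis zero_less_power)
  qed
  then show "i \<in> {1..n} \<Longrightarrow> 0 < L i" .
  have V: "subspace V"
    unfolding subspace_def
  proof (intro conjI ballI allI)
    show "0 \<in> V" unfolding V_def by (rule range_eqI[of _ _ "\<lambda>_. 0"]) simp
    fix x assume "x \<in> V"
    then obtain a where a: "x = (\<Sum>k=1..n. sc (a k) (q k))" unfolding V_def by blast
    show "sc c x \<in> V" for c
      unfolding V_def a by (rule range_eqI[of _ _ "\<lambda>k. c * a k"]) (simp add: scale_sum_right)
    fix y assume "y \<in> V"
    then obtain b where b: "y = (\<Sum>k=1..n. sc (b k) (q k))" unfolding V_def by blast
    show "x + y \<in> V"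
      unfolding V_def a b
      by (rule range_eqI[of _ _ "\<lambda>k. a k + b k"]) (simp add: scale_left_distrib sum.distrib)
  qed
  have galerkin: "w i \<in> V \<and> (\<forall>x\<in>V. ip x (w i) = of_real (L i) * ip x (?T (w i)))" if i: "i \<in> {1..n}" for i
  proof -
    obtain x where x: "w i = (\<Sum>k=1..n. sc (x k) (q k))"
      "\<And>r. r \<in> {1..n} \<Longrightarrow> (\<Sum>k=1..n. ip (q r) (q k) * x k) =
        of_real (L i) * (\<Sum>k=1..n. ip (?T (q r)) (q k) * x k)"
      using R i unfolding dual_harmonic_ritz_def by blast
    have "ip (q r) (w i) = of_real (L i) * ip (?T (q r)) (w i)" if "r \<in> {1..n}" for r
      using x(2)[OF that] unfolding x(1) ip_sum_right ip_scale_right by (simp add: mult.commute)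
    then have "ip (\<Sum>k=1..n. sc (a k) (q k)) (w i) =
        of_real (L i) * ip (\<Sum>k=1..n. sc (a k) (q k)) (?T (w i))" for a
      unfolding ip_sum_left ip_scale_left sum_distrib_left
      by (intro sum.cong refl) (simp add: T_sym)
    moreover have "w i \<in> V" unfolding V_def x(1) by (rule rangeI)
    ultimately show ?thesis unfolding V_def by blast
  qed
  have e_V: "e k \<in> V" if "k \<in> {1..n}" for k
    unfolding e_def using galerkin[OF that] V subspace_scale by blast
  have e: "orthonormal_on {1..n} e"
    unfolding orthonormal_on_def
  proof (intro ballI)
    fix i j assume ij: "i \<in> {1..n}" "j \<in> {1..n}"
    have "ip (e i) (e j) = of_real (1 / sqrt (L i) * (1 / sqrt (L j))) * ip (w i) (w j)"
      by (simp add: e_def ip_scale_left ip_scale_right)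
    also have "\<dots> = (if i = j then 1 else 0)"
    proof (cases "i = j")
      case True
      have "1 / sqrt (L i) * (1 / sqrt (L i)) * L i = 1" using L_pos[OF ij(1)] by simp
      then show ?thesis unfolding w_ip[OF ij] using True by (simp only: of_real_mult[symmetric]) simp
    qed (simp add: w_ip[OF ij])
    finally show "ip (e i) (e j) = (if i = j then 1 else 0)" .
  qed
  have T_e: "ip x (?T (e k)) = of_real (1 / L k) * ip x (e k)" if "k \<in> {1..n}" "x \<in> V" for k x
  proof -
    have "ip x (w k) = of_real (L k) * ip x (?T (w k))" using galerkin that by blast
    then have "ip x (?T (w k)) = of_real (1 / L k) * ip x (w k)" using L_pos[OF that(1)] by simp
    then show ?thesis by (simp add: e_def T_scale ip_scale_right)
  qed
  have expand: "x = (\<Sum>k=1..n. sc (ip (e k) x) (e k))" if x: "x \<in> V" for x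
  proof -
    define d where "d = x - (\<Sum>k=1..n. sc (ip (e k) x) (e k))"
    have d_V: "d \<in> V" unfolding d_def using V x e_V by (intro subspace_diff subspace_sum subspace_scale)
    have e_d: "ip (e k) d = 0" if "k \<in> {1..n}" for k
      unfolding d_def ip_diff_right using ip_orthonormal_sum[OF e finite_atLeastAtMost order_refl that] that
      by simp
    \<comment> \<open>Index 0 carries the remainder \<open>d\<close>. These \<open>n + 1\<close>
      vectors lie in the span of \<open>n\<close> vectors, so they satisfy a nontrivial relation;
      orthogonality removes the coefficients of the \<open>e k\<close> and leaves
      \<open>d = 0\<close>.\<close>
    define f where "f k = (if k = 0 then d else e k)" for k
    have "\<exists>c. f k = (\<Sum>m=1..n. sc (c m) (q m))" if "k \<in> {0..n}" for k
    proof -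
      have "f k \<in> V" using that d_V e_V by (auto simp: f_def)
      then show ?thesis unfolding V_def by blast
    qed
    then obtain C where C: "\<And>k. k \<in> {0..n} \<Longrightarrow> f k = (\<Sum>m=1..n. sc (C k m) (q m))" by metis
    have "card {1..n} < card {0..n}" by simp
    then obtain b where b: "\<exists>k\<in>{0..n}. b k \<noteq> 0" "\<forall>m\<in>{1..n}. (\<Sum>k=0..n. C k m * b k) = 0"
      using homogeneous_system_solvable[OF finite_atLeastAtMost finite_atLeastAtMost,
          where a = "\<lambda>m k. C k m"] by blast
    have "(\<Sum>k=0..n. sc (b k) (f k)) = (\<Sum>k=0..n. \<Sum>m=1..n. sc (C k m * b k) (q m))"
      using C by (intro sum.cong) (auto simp: scale_sum_right mult.commute)
    also have "\<dots> = (\<Sum>m=1..n. sc (\<Sum>k=0..n. C k m * b k) (q m))"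
      unfolding scale_sum_left by (rule sum.swap)
    also have "\<dots> = 0" using b(2) by simp
    also have "(\<Sum>k=0..n. sc (b k) (f k)) = sc (b 0) d + (\<Sum>k=1..n. sc (b k) (e k))"
      by (simp add: sum.atLeast_Suc_atMost f_def)
    finally have rel: "sc (b 0) d + (\<Sum>k=1..n. sc (b k) (e k)) = 0" .
    have zero: "b k = 0" if k: "k \<in> {1..n}" for k
      using arg_cong[OF rel, of "ip (e k)"] ip_orthonormal_sum[OF e finite_atLeastAtMost order_refl k] k
      by (simp add: ip_add_right ip_scale_right e_d)
    obtain k where k: "k \<in> {0..n}" "b k \<noteq> 0" using b(1) by blast
    then have "k \<notin> {1..n}" using zero by blast
    then have "k = 0" using k(1) by simp
    moreover have "sc (b 0) d = 0" using rel zero by simp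
    ultimately have "d = 0" using k(2) by simp
    then show ?thesis by (simp add: d_def)
  qed
  have anti: "1 / L j \<le> 1 / L i" if "i \<in> {1..n}" "j \<in> {1..n}" "i \<le> j" for i j
    using L_mono[OF that] L_pos that by (intro divide_left_mono) auto
  have "ritz_pairs V n (\<lambda>i. 1 / L i) e"
    unfolding ritz_pairs_def using V e_V e expand T_e anti by blast
  then show "ritz_pairs V n (\<lambda>i. 1 / L i) (\<lambda>i. sc (of_real (1 / sqrt (L i))) (w i))"
    by (simp only: e_def[abs_def])
qed

section \<open>Powers of \<open>M\<close> in terms of expansion coefficients\<close>

lemma full_eigensystem_basis:
  assumes sa: "selfadjoint_operator sc ip D M" and pd: "positive_definite_operator ip D M"
    and compact: "compact_operator ip (op_inverse D M)"
    and eig: "full_eigensystem sc ip D M mu q"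
  shows "orthonormal_basis sc ip q"
    and "1 \<le> k \<Longrightarrow> op_inverse D M (q k) = sc (of_real (1 / mu k)) (q k)"
proof -
  let ?T = "op_inverse D M"
  interpret positive_operator sc ip ?T by (rule selfadjoint_inverse(1)[OF sa pd])
  have q: "mu k > 0" "q k \<in> eigenspace sc D M (of_real (mu k))" if "1 \<le> k" for k
    using eig that unfolding full_eigensystem_def by auto
  show eig_T: "?T (q k) = sc (of_real (1 / mu k)) (q k)" if "1 \<le> k" for k
    using eigenspace_iff_inverse[OF sa pd, of "mu k" "q k"] q[OF that] by simp
  have full: "y \<in> span (q ` {1..})" if "0 < m" "?T y = sc (of_real m) y" for m y
  proof -
    have "y \<in> eigenspace sc D M (of_real (1 / m))"
      using eigenspace_iff_inverse[OF sa pd, of "1 / m" y] that by simp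
    also have "\<dots> = span {q k | k. 1 \<le> k \<and> of_real (mu k) = complex_of_real (1 / m)}"
      using eig unfolding full_eigensystem_def by blast
    also have "\<dots> \<subseteq> span (q ` {1..})" by (rule span_mono) auto
    finally show ?thesis .
  qed
  show "orthonormal_basis sc ip q"
  proof
    show "orthonormal_on {1..} q"
      using eig unfolding full_eigensystem_def orthonormal_on_def by auto
    show "v = 0" if "\<And>k. 1 \<le> k \<Longrightarrow> ip (q k) v = 0" for v
      by (rule compact_eigenvectors_total[OF compact eig_T full that])
  qed
qed

text \<open>An element of \<open>D(M\<^sup>s)\<close> is handled through its preimage under
  \<open>P = M\<^sup>-\<^sup>s\<close>, whose plain norm is then the norm of
  \<open>D(M\<^sup>s)\<close>. As \<open>op_power\<close> is defined through \<open>inv\<close>,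
  this rests on the injectivity of \<open>P\<close>, which follows from its action on coefficients
  and totality.\<close>

lemma power_domain_coefficients:
  assumes sa: "selfadjoint_operator sc ip D M" and pd: "positive_definite_operator ip D M"
    and compact: "compact_operator ip (op_inverse D M)"
    and eig: "full_eigensystem sc ip D M mu q" and s: "s > 0"
  defines "P \<equiv> bounded_power sc ip (op_inverse D M) s"
  shows "sym_op P" and "1 \<le> k \<Longrightarrow> P (q k) = sc (of_real (mu k powr (- s))) (q k)"
    and "1 \<le> k \<Longrightarrow> ip (q k) (P x) = of_real (mu k powr (- s)) * ip (q k) x"
    and "power_domain sc ip D M s = range P"
    and "power_norm sc ip D M s (P x) = nm x"
proof -
  let ?T = "op_inverse D M"
  interpret positive_operator sc ip ?T by (rule selfadjoint_inverse(1)[OF sa pd])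
  interpret orthonormal_basis sc ip q by (rule full_eigensystem_basis[OF sa pd compact eig])
  have mu: "mu k > 0" if "1 \<le> k" for k using eig that unfolding full_eigensystem_def by auto
  show P: "sym_op P" unfolding P_def by (rule bounded_power_sym_op[OF s])
  show P_q: "P (q k) = sc (of_real (mu k powr (- s))) (q k)" if k: "1 \<le> k" for k
    unfolding P_def
    using bounded_power_eigenvector[OF s full_eigensystem_basis(2)[OF sa pd compact eig k]] mu[OF k]
    by (simp add: powr_minus powr_divide inverse_eq_divide)
  show P_ip: "ip (q k) (P x) = of_real (mu k powr (- s)) * ip (q k) x" if "1 \<le> k" for k x
    by (simp flip: sym_op_ip[OF P] add: P_q[OF that] ip_scale_left)
  show "power_domain sc ip D M s = range P" using s by (simp add: power_domain_def P_def)
  have "inj P"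
  proof (rule injI)
    fix x y assume "P x = P y"
    then have "P (x - y) = 0" by (simp add: sym_op_diff[OF P])
    then have "ip (q k) (x - y) = 0" if "1 \<le> k" for k
      using P_ip[OF that, of "x - y"] mu[OF that] by simp
    then have "x - y = 0" by (rule total)
    then show "x = y" by simp
  qed
  then show "power_norm sc ip D M s (P x) = nm x"
    using s by (simp add: power_norm_def op_power_def P_def)
qed

end

section \<open>From the error in \<open>H\<^sub>0\<close> to the error in
  \<open>H\<^sub>\<tau>\<close>\<close>

theorem theorem4p4:
  fixes sc :: "complex \<Rightarrow> 'a::ab_group_add \<Rightarrow> 'a"
    and ipH ipG :: "'a \<Rightarrow> 'a \<Rightarrow> complex"
    and DA DM :: "'a set"
    and A M :: "'a \<Rightarrow> 'a"
    and N :: enat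
    and lam mu :: "nat \<Rightarrow> real"
    and u q :: "nat \<Rightarrow> 'a"
    and Lam :: "nat \<Rightarrow> nat \<Rightarrow> real"
    and ur :: "nat \<Rightarrow> nat \<Rightarrow> 'a"
    and l :: nat
    and \<tau> \<sigma> :: real
  assumes H: "complex_hilbert_space sc ipH" "ip_separable ipH"
    and A: "selfadjoint_operator sc ipH DA A" "positive_definite_operator ipH DA A"
    and eig_A: "lower_eigensystem sc ipH DA A N lam u"
    and l_le: "enat l \<le> N"
    and l_full: "\<And>i. l < i \<Longrightarrow> enat i \<le> N \<Longrightarrow> lam l < lam i"
    and G: "complex_hilbert_space sc ipG"
      "equivalent_norms_on UNIV (ip_norm ipH) (ip_norm ipG)"
    and M: "selfadjoint_operator sc ipG DM M" "positive_definite_operator ipG DM M"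
      "compact_operator ipG (op_inverse DM M)"
    and eig_M: "full_eigensystem sc ipG DM M mu q"
    and ritz: "\<And>n. 1 \<le> n \<Longrightarrow> dual_harmonic_ritz sc ipH DA A q n (Lam n) (ur n)"
    and tau_pos: "0 < \<tau>"
    and tau_dom: "power_domain sc ipG DM M \<tau> = power_domain sc ipH DA A \<tau>"
      "equivalent_norms_on (power_domain sc ipG DM M \<tau>)
         (power_norm sc ipG DM M \<tau>) (power_norm sc ipH DA A \<tau>)"
    and two_tau_dom: "continuously_included
         (power_domain sc ipG DM M (2 * \<tau>)) (power_norm sc ipG DM M (2 * \<tau>))
         (power_domain sc ipH DA A (2 * \<tau>)) (power_norm sc ipH DA A (2 * \<tau>))"
    and ratio_finite: "\<And>j. j \<in> {1..l} \<Longrightarrow>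
         summable (\<lambda>k. mu (Suc k) powr (4 * \<tau>) * (cmod (ipG (u j) (q (Suc k))))\<^sup>2)"
    and ratio: "\<And>j. j \<in> {1..l} \<Longrightarrow>
         (\<lambda>n. (\<Sum>k. mu (n + 1 + k) powr (4 * \<tau>) * (cmod (ipG (u j) (q (n + 1 + k))))\<^sup>2)
            / (\<Sum>k. mu (n + 1 + k) powr (2 * \<tau>) * (cmod (ipG (u j) (q (n + 1 + k))))\<^sup>2))
         \<in> O(\<lambda>n. mu (n + 1) powr (2 * \<tau>))"
    and sigma: "\<tau> \<le> \<sigma>"
    and regular: "\<And>j. j \<in> {1..l} \<Longrightarrow> u j \<in> power_domain sc ipG DM M \<sigma>"
  shows "\<exists>v :: nat \<Rightarrow> nat \<Rightarrow> 'a. \<forall>j\<in>{1..l}.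
      (\<forall>\<^sub>F n in sequentially.
         v j n \<in> eigenspace sc DA A (of_real (lam j)) \<and>
         power_norm sc ipH DA A (- 1 / 2) (v j n) = 1 \<and>
         v j n - ur n j \<in> power_domain sc ipH DA A \<tau>) \<and>
      (\<lambda>n. power_norm sc ipH DA A \<tau> (v j n - ur n j)) \<in> o(\<lambda>n. mu (n + 1) powr (\<tau> - \<sigma>))"
proof (cases "l = 0")
  case True
  then show ?thesis by simp
next
  case False
  then have l: "1 \<le> l" "l \<in> {1..l}" by auto
  let ?nH = "ip_norm ipH" and ?nG = "ip_norm ipG"
  let ?T = "op_inverse DA A"
  interpret H: complex_hilbert_space sc ipH by (rule H(1))
  interpret G: complex_hilbert_space sc ipG by (rule G(1))
  interpret T: positive_operator sc ipH ?T by (rule H.selfadjoint_inverse(1)[OF A])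
  interpret Q: orthonormal_basis sc ipG q by (rule G.full_eigensystem_basis(1)[OF M eig_M])
  have J: "enat i \<le> N" if "i \<le> l" for i
    using l_le that by (meson enat_ord_simps(1) order_trans)
  have lam_pos: "0 < lam i" and u_eig: "u i \<in> eigenspace sc DA A (of_real (lam i))"
    if "i \<in> {1..l}" for i
    using eig_A J that unfolding lower_eigensystem_def Let_def by auto
  have lam_mono: "lam i \<le> lam j" if "i \<in> {1..l}" "j \<in> {1..l}" "i \<le> j" for i j
    using eig_A J that unfolding lower_eigensystem_def Let_def by auto
  have u: "H.orthonormal_on {1..l} u"
    using eig_A J unfolding lower_eigensystem_def Let_def H.orthonormal_on_def by auto
  define \<theta> where "\<theta> i = 1 / lam i" for i
  have T_u: "\<forall>i\<in>{1..l}. ?T (u i) = sc (of_real (\<theta> i)) (u i)"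
  proof
    fix i assume i: "i \<in> {1..l}"
    show "?T (u i) = sc (of_real (\<theta> i)) (u i)"
      using H.eigenspace_iff_inverse[OF A, of "lam i" "u i"] lam_pos[OF i] u_eig[OF i]
      by (simp add: \<theta>_def)
  qed
  have \<theta>_anti: "\<forall>i\<in>{1..l}. \<forall>j\<in>{1..l}. i \<le> j \<longrightarrow> \<theta> j \<le> \<theta> i"
    unfolding \<theta>_def using lam_mono lam_pos by (auto intro!: divide_left_mono)
  have \<theta>_pos: "\<theta> i > 0" if "i \<in> {1..l}" for i using lam_pos[OF that] by (simp add: \<theta>_def)
  have "\<exists>\<theta>'<1 / lam l. \<forall>x. (\<forall>i\<in>{1..l}. ipH (u i) x = 0) \<longrightarrow> Re (ipH (?T x) x) \<le> \<theta>' * (?nH x)\<^sup>2"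
    by (rule H.lower_eigensystem_gap[OF A eig_A l(1) l_le l_full])
  then obtain \<theta>' where gap: "\<theta>' < \<theta> l"
    "\<forall>x. (\<forall>i\<in>{1..l}. ipH (u i) x = 0) \<longrightarrow> Re (ipH (?T x) x) \<le> \<theta>' * (?nH x)\<^sup>2"
    unfolding \<theta>_def by blast
  obtain \<epsilon>0 K where \<epsilon>0: "0 < \<epsilon>0"
    and approx: "\<forall>V n \<nu> e \<epsilon> j. T.ritz_pairs V n \<nu> e \<longrightarrow> l \<le> n \<longrightarrow> 0 \<le> \<epsilon> \<longrightarrow> \<epsilon> \<le> \<epsilon>0 \<longrightarrow>
      (\<forall>i\<in>{1..l}. \<exists>p\<in>V. ?nH (u i - p) \<le> \<epsilon>) \<longrightarrow> j \<in> {1..l} \<longrightarrow>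
      (\<exists>b. \<theta> j * (?nH (\<Sum>i\<in>{i\<in>{1..l}. \<theta> i = \<theta> j}. sc (b i) (u i)))\<^sup>2 = 1 \<and>
        ?nH ((\<Sum>i\<in>{i\<in>{1..l}. \<theta> i = \<theta> j}. sc (b i) (u i)) - sc (of_real (1 / sqrt (\<nu> j))) (e j)) \<le> K * \<epsilon>)"
    by (rule T.ritz_approximation[OF l(1) u T_u \<theta>_anti \<theta>_pos[OF l(2)] gap])
  obtain c1 C1 where c1: "c1 > 0" "\<And>v. c1 * ?nH v \<le> ?nG v" and C1: "C1 > 0" "\<And>v. ?nG v \<le> C1 * ?nH v"
    using G(2) unfolding equivalent_norms_on_def by blast
  obtain C2 where C2: "C2 > 0" "\<And>v. v \<in> power_domain sc ipG DM M \<tau> \<Longrightarrow>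
      power_norm sc ipH DA A \<tau> v \<le> C2 * power_norm sc ipG DM M \<tau> v"
    using tau_dom(2) unfolding equivalent_norms_on_def by blast
  have mu_pos: "mu k > 0" if "1 \<le> k" for k using eig_M that unfolding full_eigensystem_def by auto
  have mu_mono: "mu j \<le> mu k" if "1 \<le> j" "j \<le> k" for j k
    using eig_M that unfolding full_eigensystem_def by auto
  have sigma_pos: "\<sigma> > 0" using tau_pos sigma by simp
  let ?P = "\<lambda>s. bounded_power sc ipG (op_inverse DM M) s"
  note P\<tau> = G.power_domain_coefficients[OF M eig_M tau_pos]
  note P\<sigma> = G.power_domain_coefficients[OF M eig_M sigma_pos]
  have "\<exists>z. u i = ?P \<sigma> z" if "i \<in> {1..l}" for i
    using regular[OF that] P\<sigma>(4) by blast
  then obtain z where z: "\<And>i. i \<in> {1..l} \<Longrightarrow> u i = ?P \<sigma> (z i)" by metis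
  \<comment> \<open>An eigenvector of \<open>A\<close> lies in the range of
    \<open>A\<^sup>-\<^sup>\<tau>\<close>, which is also that of
    \<open>M\<^sup>-\<^sup>\<tau>\<close>.\<close>
  have "\<exists>y. u i = ?P \<tau> y" if i: "i \<in> {1..l}" for i
  proof -
    let ?B = "bounded_power sc ipH ?T \<tau>"
    have "?B (u i) = sc (of_real (\<theta> i powr \<tau>)) (u i)"
      using T.bounded_power_eigenvector[OF tau_pos bspec[OF T_u i]] \<theta>_pos[OF i] by simp
    then have "?B (sc (of_real (1 / \<theta> i powr \<tau>)) (u i)) = u i"
      using \<theta>_pos[OF i] by (simp add: H.sym_op_scale[OF T.bounded_power_sym_op[OF tau_pos]])
    then have "u i \<in> power_domain sc ipH DA A \<tau>"
      using tau_pos unfolding power_domain_def by (metis not_le rangeI)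
    then show ?thesis using tau_dom(1) P\<tau>(4) by blast
  qed
  then obtain y where y: "\<And>i. i \<in> {1..l} \<Longrightarrow> u i = ?P \<tau> (y i)" by metis
  \<comment> \<open>The single source of the little-o: the tails of
    \<open>z i = M\<^sup>\<sigma> u\<^sub>i\<close>, summed so that one null sequence serves all
    \<open>i\<close>.\<close>
  define \<eta> where "\<eta> n = (\<Sum>i=1..l. ?nG (z i - Q.trunc n (z i)))" for n
  have \<eta>0: "0 \<le> \<eta> n" for n unfolding \<eta>_def by (rule sum_nonneg) simp
  have \<eta>_lim: "\<eta> \<longlonglongrightarrow> 0"
    unfolding \<eta>_def using tendsto_sum[of "{1..l}", OF Q.trunc_error_tendsto_0] by simp
  have \<eta>_ge: "?nG (z i - Q.trunc n (z i)) \<le> \<eta> n" if "i \<in> {1..l}" for i n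
    unfolding \<eta>_def by (rule member_le_sum[OF that]) auto
  have decay: "mu k powr (- s) \<le> mu (n + 1) powr (- s)" if "n < k" "0 \<le> s" for k n s
    using that mu_pos[of "n + 1"] mu_mono[of "n + 1" k] by (intro powr_mono2') auto
  have u_err: "?nG (u i - Q.trunc n (u i)) \<le> mu (n + 1) powr (- \<sigma>) * \<eta> n" if i: "i \<in> {1..l}" for i n
  proof -
    have "?nG (u i - Q.trunc n (u i)) \<le> mu (n + 1) powr (- \<sigma>) * ?nG (z i - Q.trunc n (z i))"
    proof (rule Q.trunc_error_mono)
      fix k assume k: "n < k"
      have "cmod (ipG (q k) (u i)) = mu k powr (- \<sigma>) * cmod (ipG (q k) (z i))"
        using k by (simp add: z[OF i] P\<sigma>(3) norm_mult)
      then show "cmod (ipG (q k) (u i)) \<le> mu (n + 1) powr (- \<sigma>) * cmod (ipG (q k) (z i))"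
        using decay[OF k] sigma_pos by (simp add: mult_right_mono)
    qed simp
    also have "\<dots> \<le> mu (n + 1) powr (- \<sigma>) * \<eta> n" by (intro mult_left_mono \<eta>_ge i) simp
    finally show ?thesis .
  qed
  \<comment> \<open>The coefficients of \<open>y i = M\<^sup>\<tau> u\<^sub>i\<close> are those of
    \<open>z i\<close> times \<open>mu k powr (\<tau> - \<sigma>)\<close>, a factor that does not
    increase with \<open>k\<close> since \<open>\<tau> \<le> \<sigma>\<close>.\<close>
  have y_err: "?nG (y i - Q.trunc n (y i)) \<le> mu (n + 1) powr (\<tau> - \<sigma>) * \<eta> n" if i: "i \<in> {1..l}" for i n
  proof -
    have "?nG (y i - Q.trunc n (y i)) \<le> mu (n + 1) powr (\<tau> - \<sigma>) * ?nG (z i - Q.trunc n (z i))"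
    proof (rule Q.trunc_error_mono)
      fix k assume k: "n < k"
      have "mu k powr (- \<tau>) * cmod (ipG (q k) (y i)) = cmod (ipG (q k) (u i))"
        using k by (simp add: y[OF i] P\<tau>(3) norm_mult)
      also have "\<dots> = mu k powr (- \<sigma>) * cmod (ipG (q k) (z i))"
        using k by (simp add: z[OF i] P\<sigma>(3) norm_mult)
      finally have "mu k powr \<tau> * (mu k powr (- \<tau>) * cmod (ipG (q k) (y i))) =
          mu k powr \<tau> * (mu k powr (- \<sigma>) * cmod (ipG (q k) (z i)))" by simp
      then have "cmod (ipG (q k) (y i)) = mu k powr (- (\<sigma> - \<tau>)) * cmod (ipG (q k) (z i))"
        using mu_pos[of k] k by (simp flip: mult.assoc powr_add)
      then show "cmod (ipG (q k) (y i)) \<le> mu (n + 1) powr (\<tau> - \<sigma>) * cmod (ipG (q k) (z i))"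
        using decay[OF k, of "\<sigma> - \<tau>"] sigma by (simp add: mult_right_mono)
    qed simp
    also have "\<dots> \<le> mu (n + 1) powr (\<tau> - \<sigma>) * \<eta> n" by (intro mult_left_mono \<eta>_ge i) simp
    finally show ?thesis .
  qed
  \<comment> \<open>The truncation error of the \<open>u i\<close>, carried from the norm of
    \<open>G\<^sub>0\<close> to that of \<open>H\<^sub>0\<close> by the equivalence constant
    \<open>c1\<close>.\<close>
  define \<epsilon> where "\<epsilon> n = mu (n + 1) powr (- \<sigma>) * \<eta> n / c1" for n
  have \<epsilon>_nonneg: "0 \<le> \<epsilon> n" for n using \<eta>0 c1(1) by (simp add: \<epsilon>_def)
  have "(\<lambda>n. mu 1 powr (- \<sigma>) / c1 * \<eta> n) \<longlonglongrightarrow> 0"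
    using tendsto_mult_left[OF \<eta>_lim, of "mu 1 powr (- \<sigma>) / c1"] by simp
  moreover have "\<epsilon> n \<le> mu 1 powr (- \<sigma>) / c1 * \<eta> n" for n
    using decay[of 0 "n + 1" \<sigma>] sigma_pos \<eta>0[of n] c1(1)
    by (simp add: \<epsilon>_def divide_right_mono mult_right_mono)
  ultimately have "\<epsilon> \<longlonglongrightarrow> 0"
    using \<epsilon>_nonneg by (intro tendsto_sandwich[of "\<lambda>_. 0" \<epsilon>]) auto
  then have good: "\<forall>\<^sub>F n in sequentially. l \<le> n \<and> \<epsilon> n < \<epsilon>0"
    using \<epsilon>0 by (intro eventually_conj eventually_ge_at_top order_tendstoD)
  \<comment> \<open>The first summand belongs to the part of the error beyond index
    \<open>n\<close>, a combination of at most \<open>l\<close> tails with coefficients up to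
    \<open>sqrt (lam l)\<close>; the second belongs to the part in the trial space.
    \<open>C2\<close> passes from \<open>M\<^sup>\<tau>\<close> to
    \<open>A\<^sup>\<tau>\<close>.\<close>
  define K' where "K' = C2 * (l * sqrt (lam l) + C1 * K / c1)"
  have "\<exists>v. v \<in> eigenspace sc DA A (of_real (lam j)) \<and> power_norm sc ipH DA A (- 1 / 2) v = 1 \<and>
      v - ur n j \<in> power_domain sc ipH DA A \<tau> \<and>
      power_norm sc ipH DA A \<tau> (v - ur n j) \<le> K' * (mu (n + 1) powr (\<tau> - \<sigma>) * \<eta> n)"
    if j: "j \<in> {1..l}" and n: "l \<le> n" "\<epsilon> n < \<epsilon>0" for j n
  proof -
    have n1: "1 \<le> n" and jn: "j \<in> {1..n}" using l j n by auto
    define V where "V = range (\<lambda>x :: nat \<Rightarrow> complex. \<Sum>k=1..n. sc (x k) (q k))"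
    note R = H.dual_harmonic_ritz_pairs[OF A ritz[OF n1], folded V_def]
    define \<nu> where "\<nu> i = 1 / Lam n i" for i
    define e where "e i = sc (of_real (1 / sqrt (Lam n i))) (ur n i)" for i
    have "\<forall>i\<in>{1..l}. \<exists>p\<in>V. ?nH (u i - p) \<le> \<epsilon> n"
    proof
      fix i assume i: "i \<in> {1..l}"
      have "c1 * ?nH (u i - Q.trunc n (u i)) \<le> mu (n + 1) powr (- \<sigma>) * \<eta> n"
        using c1(2)[of "u i - Q.trunc n (u i)"] u_err[OF i, of n] by linarith
      then have "?nH (u i - Q.trunc n (u i)) \<le> \<epsilon> n"
        using c1(1) by (simp add: \<epsilon>_def pos_le_divide_eq mult.commute)
      moreover have "Q.trunc n (u i) \<in> V" unfolding V_def Q.trunc_def by (rule rangeI)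
      ultimately show "\<exists>p\<in>V. ?nH (u i - p) \<le> \<epsilon> n" by blast
    qed
    from approx[THEN spec, THEN spec, THEN spec, THEN spec, THEN spec, THEN spec, THEN mp, THEN mp,
        THEN mp, THEN mp, THEN mp, THEN mp, OF R(2) n(1) \<epsilon>_nonneg less_imp_le[OF n(2)] this j]
    obtain b where b: "\<theta> j * (?nH (\<Sum>i\<in>{i\<in>{1..l}. \<theta> i = \<theta> j}. sc (b i) (u i)))\<^sup>2 = 1"
      "?nH ((\<Sum>i\<in>{i\<in>{1..l}. \<theta> i = \<theta> j}. sc (b i) (u i)) -
        sc (of_real (1 / sqrt (1 / Lam n j))) (sc (of_real (1 / sqrt (Lam n j))) (ur n j))) \<le> K * \<epsilon> n"
      by (elim exE conjE) (rule that)
    define I where "I = {i\<in>{1..l}. \<theta> i = \<theta> j}"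
    define v where "v = (\<Sum>i\<in>I. sc (b i) (u i))"
    have "I \<subseteq> {1..l}" by (auto simp: I_def)
    then have I: "finite I" "I \<subseteq> {1..l}" "card I \<le> l"
      using card_mono[of "{1..l}" I] by (auto intro: finite_subset)
    have Lam: "0 < Lam n j" by (rule R(1)[OF jn])
    have v_norm: "\<theta> j * (?nH v)\<^sup>2 = 1" using b(1) by (simp only: v_def I_def)
    have "sc (of_real (1 / sqrt (1 / Lam n j))) (sc (of_real (1 / sqrt (Lam n j))) (ur n j)) = ur n j"
      using Lam by (simp add: real_sqrt_divide)
    then have v_err: "?nH (v - ur n j) \<le> K * \<epsilon> n" using b(2) by (simp only: v_def I_def)
    have T_v: "?T v = sc (of_real (\<theta> j)) v"
      unfolding v_def T.T_sum T.T_scale H.scale_sum_right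
      by (rule sum.cong) (use T_u in \<open>auto simp: I_def mult.commute\<close>)
    then have v_eig: "v \<in> eigenspace sc DA A (of_real (lam j))"
      using H.eigenspace_iff_inverse[OF A, of "lam j" v] lam_pos[OF j] by (simp add: \<theta>_def)
    have "bounded_power sc ipH ?T (1 / 2) v = sc (of_real (\<theta> j powr (1 / 2))) v"
      using T.bounded_power_eigenvector[OF _ T_v, of "1 / 2"] \<theta>_pos[OF j] by simp
    then have "power_norm sc ipH DA A (- 1 / 2) v = sqrt (\<theta> j) * ?nH v"
      using \<theta>_pos[OF j] by (simp add: power_norm_def op_power_def H.nm_scale powr_half_sqrt)
    also have "\<dots> = sqrt (\<theta> j * (?nH v)\<^sup>2)" by (simp add: real_sqrt_mult)
    finally have v_power: "power_norm sc ipH DA A (- 1 / 2) v = 1" by (simp add: v_norm)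
    \<comment> \<open>The normalization in \<open>H\<^sub>-\<^sub>1\<^sub>/\<^sub>2\<close> gives
      \<open>(?nH v)\<^sup>2 = lam j\<close>, which bounds every coefficient in the orthonormal
      \<open>u i\<close>.\<close>
    have b_le: "cmod (b i) \<le> sqrt (lam l)" if i: "i \<in> I" for i
    proof (rule real_le_rsqrt)
      have "(cmod (b i))\<^sup>2 \<le> (\<Sum>i\<in>I. (cmod (b i))\<^sup>2)" by (intro member_le_sum i I) auto
      also have "\<dots> = (?nH v)\<^sup>2" unfolding v_def by (rule H.nm_orthonormal_sum[OF u I(1,2), symmetric])
      also have "\<dots> = lam j" using v_norm lam_pos[OF j] by (simp add: \<theta>_def field_simps)
      also have "\<dots> \<le> lam l" using lam_mono[OF j l(2)] j by simp
      finally show "(cmod (b i))\<^sup>2 \<le> lam l" .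
    qed
    have "ur n j \<in> V"
      using ritz[OF n1] jn unfolding dual_harmonic_ritz_def V_def by blast
    then obtain x where x: "ur n j = (\<Sum>k=1..n. sc (x k) (q k))" unfolding V_def by blast
    \<comment> \<open>\<open>w\<close> is \<open>M\<^sup>\<tau>\<close> applied to the error, so
      that its norm in \<open>G\<^sub>0\<close> is the quantity to be bounded.\<close>
    define w where "w = (\<Sum>i\<in>I. sc (b i) (y i)) - (\<Sum>k=1..n. sc (x k * of_real (mu k powr \<tau>)) (q k))"
    have P_w: "?P \<tau> w = v - ur n j"
    proof -
      have "?P \<tau> (\<Sum>i\<in>I. sc (b i) (y i)) = v"
        unfolding v_def G.sym_op_sum[OF P\<tau>(1)] G.sym_op_scale[OF P\<tau>(1)]
        using I(2) y by (intro sum.cong) auto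
      moreover have "?P \<tau> (\<Sum>k=1..n. sc (x k * of_real (mu k powr \<tau>)) (q k)) = ur n j"
        unfolding x G.sym_op_sum[OF P\<tau>(1)] G.sym_op_scale[OF P\<tau>(1)]
      proof (rule sum.cong[OF refl])
        fix k assume "k \<in> {1..n}"
        then have "1 \<le> k" "mu k powr \<tau> * mu k powr (- \<tau>) = 1"
          using mu_pos[of k] by (auto simp flip: powr_add)
        then show "sc (x k * of_real (mu k powr \<tau>)) (?P \<tau> (q k)) = sc (x k) (q k)"
          by (simp add: P\<tau>(2) mult.assoc flip: of_real_mult)
      qed
      ultimately show ?thesis by (simp add: w_def G.sym_op_diff[OF P\<tau>(1)])
    qed
    then have dom: "v - ur n j \<in> power_domain sc ipG DM M \<tau>" unfolding P\<tau>(4) by (metis rangeI)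
    let ?m = "mu (n + 1)"
    \<comment> \<open>Truncation reproduces the Ritz part of \<open>w\<close>, so beyond index
      \<open>n\<close> only the tails of the \<open>y i\<close> remain.\<close>
    have high: "?nG (w - Q.trunc n w) \<le> l * sqrt (lam l) * (?m powr (\<tau> - \<sigma>) * \<eta> n)"
    proof -
      have "w - Q.trunc n w = (\<Sum>i\<in>I. sc (b i) (y i - Q.trunc n (y i)))"
        unfolding w_def Q.trunc_diff Q.trunc_id unfolding Q.trunc_sum Q.trunc_scale
        by (simp add: H.scale_right_diff_distrib sum_subtractf)
      also have "?nG \<dots> \<le> (\<Sum>i\<in>I. ?nG (sc (b i) (y i - Q.trunc n (y i))))" by (rule G.nm_sum_le)
      also have "\<dots> \<le> (\<Sum>i\<in>I. sqrt (lam l) * (?m powr (\<tau> - \<sigma>) * \<eta> n))"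
        unfolding G.nm_scale using I(2) lam_pos[OF l(2)] by (intro sum_mono mult_mono b_le y_err) auto
      also have "\<dots> \<le> real l * (sqrt (lam l) * (?m powr (\<tau> - \<sigma>) * \<eta> n))"
        unfolding sum_constant using I(3) \<eta>0 lam_pos[OF l(2)] by (intro mult_right_mono) auto
      finally show ?thesis by simp
    qed
    \<comment> \<open>The inverse inequality: on the first \<open>n\<close> coefficients
      \<open>M\<^sup>\<tau>\<close> costs at most \<open>mu (n + 1) powr \<tau>\<close>. Against the
      error \<open>K * \<epsilon> n\<close> of order
      \<open>mu (n + 1) powr (- \<sigma>) * \<eta> n\<close>, this produces the required
      exponent.\<close>
    have "?nG (Q.trunc n w) \<le> ?m powr \<tau> * ?nG (v - ur n j)"
    proof (rule Q.nm_trunc_mono)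
      fix k assume k: "k \<in> {1..n}"
      have "mu k powr \<tau> * (mu k powr (- \<tau>) * cmod (ipG (q k) w)) = cmod (ipG (q k) w)"
        using mu_pos[of k] k by (simp flip: mult.assoc powr_add)
      moreover have "cmod (ipG (q k) (v - ur n j)) = mu k powr (- \<tau>) * cmod (ipG (q k) w)"
        using k by (simp flip: P_w add: P\<tau>(3) norm_mult)
      ultimately have "cmod (ipG (q k) w) = mu k powr \<tau> * cmod (ipG (q k) (v - ur n j))" by simp
      also have "\<dots> \<le> ?m powr \<tau> * cmod (ipG (q k) (v - ur n j))"
        using mu_pos[of k] mu_mono[of k "n + 1"] k tau_pos by (intro mult_right_mono powr_mono2) auto
      finally show "cmod (ipG (q k) w) \<le> ?m powr \<tau> * cmod (ipG (q k) (v - ur n j))" .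
    qed simp
    also have "\<dots> \<le> ?m powr \<tau> * (C1 * (K * \<epsilon> n))"
      using order_trans[OF C1(2) mult_left_mono[OF v_err, of C1]] C1(1)
      by (intro mult_left_mono) auto
    also have "\<dots> = C1 * K / c1 * (?m powr (\<tau> - \<sigma>) * \<eta> n)"
      by (simp add: \<epsilon>_def powr_diff powr_minus divide_inverse)
    finally have low: "?nG (Q.trunc n w) \<le> C1 * K / c1 * (?m powr (\<tau> - \<sigma>) * \<eta> n)" .
    have "power_norm sc ipH DA A \<tau> (v - ur n j) \<le> C2 * power_norm sc ipG DM M \<tau> (v - ur n j)"
      by (rule C2(2)[OF dom])
    also have "power_norm sc ipG DM M \<tau> (v - ur n j) = ?nG w"
      unfolding P_w[symmetric] by (rule P\<tau>(5))
    also have "?nG w \<le> ?nG (w - Q.trunc n w) + ?nG (Q.trunc n w)"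
      using G.nm_triangle[of "w - Q.trunc n w" "Q.trunc n w"] by simp
    also have "\<dots> \<le> (l * sqrt (lam l) + C1 * K / c1) * (?m powr (\<tau> - \<sigma>) * \<eta> n)"
      using high low unfolding distrib_right by (rule add_mono)
    finally have "power_norm sc ipH DA A \<tau> (v - ur n j) \<le> K' * (?m powr (\<tau> - \<sigma>) * \<eta> n)"
      using C2(1) by (simp add: K'_def mult.assoc)
    then show ?thesis using v_eig v_power dom tau_dom(1) by blast
  qed
  then obtain v where v: "\<And>j n. j \<in> {1..l} \<Longrightarrow> l \<le> n \<Longrightarrow> \<epsilon> n < \<epsilon>0 \<Longrightarrow>
      v j n \<in> eigenspace sc DA A (of_real (lam j)) \<and> power_norm sc ipH DA A (- 1 / 2) (v j n) = 1 \<and>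
      v j n - ur n j \<in> power_domain sc ipH DA A \<tau> \<and>
      power_norm sc ipH DA A \<tau> (v j n - ur n j) \<le> K' * (mu (n + 1) powr (\<tau> - \<sigma>) * \<eta> n)"
    by metis
  have "(\<lambda>n. power_norm sc ipH DA A \<tau> (v j n - ur n j)) \<in> o(\<lambda>n. mu (n + 1) powr (\<tau> - \<sigma>))"
    if j: "j \<in> {1..l}" for j
  proof (rule landau_o.smallI)
    fix c :: real assume c: "c > 0"
    have "(\<lambda>n. K' * \<eta> n) \<longlonglongrightarrow> 0" using tendsto_mult_left[OF \<eta>_lim, of K'] by simp
    then have "\<forall>\<^sub>F n in sequentially. K' * \<eta> n < c" using c by (rule order_tendstoD(2))
    with good show "\<forall>\<^sub>F n in sequentially. norm (power_norm sc ipH DA A \<tau> (v j n - ur n j)) \<le>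
        c * norm (mu (n + 1) powr (\<tau> - \<sigma>))"
    proof eventually_elim
      case (elim n)
      have "power_norm sc ipH DA A \<tau> (v j n - ur n j) \<le> (K' * \<eta> n) * mu (n + 1) powr (\<tau> - \<sigma>)"
        using v[OF j, of n] elim(1) by (simp add: mult_ac)
      also have "\<dots> \<le> c * mu (n + 1) powr (\<tau> - \<sigma>)" using elim(2) by (intro mult_right_mono) auto
      finally show ?case by (simp add: power_norm_def)
    qed
  qed
  moreover have "\<forall>\<^sub>F n in sequentially.
      v j n \<in> eigenspace sc DA A (of_real (lam j)) \<and> power_norm sc ipH DA A (- 1 / 2) (v j n) = 1 \<and>
      v j n - ur n j \<in> power_domain sc ipH DA A \<tau>" if "j \<in> {1..l}" for j
    using good by eventually_elim (use v that in blast)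
  ultimately show ?thesis by (intro exI[of _ v]) blast
qed

end
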